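(* Let $\Omega\in\mathrm{QD}_0(h)$ be simply connected, with Riemann map $\varphi$. (1) If $\Omega$ is bounded, let $r:=\Phi_\varphi^{-1}\big(w\,h(w)+\operatorname{Res}_\infty h\big)$. Then $r$ is rational, $r\in A_0(\mathbb D^* )$, and: if $0\notin\Omega$, $\varphi(z)=\varphi(0)\,e^{r^{\#}(z)}$; if $0\in\Omega$ and $\varphi(0)\ne0$, $\varphi(z)=\frac{\varphi(0)}{|z_0|}b_{z_0}(z)\,e^{r^{\#}(z)}$ with $z_0=\varphi^{-1}(0)\in\mathbb D$; if $\varphi(0)=0$, $\varphi(z)=\varphi'(0)\,z\,e^{r^{\#}(z)}$. (2) If $\Omega$ is unbounded and $c:=\lim_{z\to\infty}\varphi(z)/z>0$, let $r(z):=\Phi_\varphi^{-1}(w\,h(w))(z)-\Phi_\varphi^{-1}(w\,h(w))(0)$. Then $r$ is rational, $r\in A(\mathbb D)$, $r(0)=0$, and: if $0\notin\Omega$, $\varphi(z)=c\,z\,e^{r^{\#}(z)}$; if $0\in\Omega$, $\varphi(z)=c|z_0|\,z\,b_{z_0}(z)\,e^{r^{\#}(z)}$ with $z_0=\varphi^{-1}(0)$, $|z_0|>1$.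
   Context: $\hat{\mathbb C}$ is the Riemann sphere; a domain is a connected open subset of $\hat{\mathbb C}$. For $\Omega\subset\hat{\mathbb C}$, $\overline{\Omega}$ is its closure and $\Omega^*:=\hat{\mathbb C}\setminus\overline{\Omega}$. $\mathbb D=\{|z|<1\}$, $\mathbb D^*=\{|z|>1\}\cup\{\infty\}$. $dA=dx\,dy/\pi$ is normalized area measure; integrals over unbounded sets are principal values $\lim_{R\to\infty}\int_{\cdot\,\cap\{|w|<R\}}$. Contour integrals are normalized: $\oint_{\partial U}$ means $\frac{1}{2\pi i}\int_{\partial U}$ with $\partial U$ positively oriented with respect to $U$. $A(U)$ denotes functions analytic in $U$ and continuous on $\overline U$; for unbounded $U$, $A_0(U)=\{f\in A(U):f(\infty)=0\}$. $\mathrm{Rat}(\Omega)$ denotes rational functions all of whose poles lie in $\Omega$, and $\mathrm{Rat}_0(\Omega)$ those vanishing at $\infty$. Let $\rho_0(w)=|w|^{-2}$ and $L^1_a(\Omega;\rho_0)=\{f\in A(\Omega):\int_\Omega|f|\rho_0\,dA<\infty\}$. A rectifiable domain $\Omega\subset\hat{\mathbb C}$ with $0,\infty\notin\partial\Omega$ and $\Omega=\mathrm{Int}(\overline\Omega)$ is a log-weighted quadrature domain (LQD) with quadrature function $h$, written $\Omega\in\mathrm{QD}_0(h)$, if $h\in\mathrm{Rat}_0(\Omega)$ when $\Omega$ is bounded, $h\in\mathrm{Rat}(\Omega)$ when $\Omega$ is unbounded, and $\int_\Omega f(w)|w|^{-2}dA(w)=\oint_{\partial\Omega}f(w)h(w)\,dw$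 for all $f\in L^1_a(\Omega;\rho_0)$. $\operatorname{Res}_\infty h:=-\lim_{w\to\infty}w\,h(w)$ for $h$ vanishing at $\infty$. Reflection: $f^{\#}(z)=\overline{f(1/\bar z)}$. Blaschke factors: for $\lambda\neq0$, $b_\lambda(z)=\frac{\bar\lambda}{|\lambda|}\frac{z-\lambda}{\bar\lambda z-1}$. Riemann maps: if $\Omega$ is bounded, a conformal bijection $\varphi:\mathbb D\to\Omega$; if $\Omega$ is unbounded, a conformal bijection $\varphi:\mathbb D^*\to\Omega$ with $\varphi(\infty)=\infty$; $\psi=\varphi^{-1}$. Cauchy projection: for a rectifiable domain $U$ and $f$ continuous on $\partial U$, $[f]_U(w):=\oint_{\partial U}\frac{f(\xi)}{\xi-w}d\xi$, $w\in U$. Faber transform: if $\Omega$ is bounded, $\Phi_\varphi:A_0(\mathbb D^* )\to A_0(\Omega^* )$, $\Phi_\varphi(f)=[f\circ\psi]_{\Omega^*}$, with inverse $\Phi_\varphi^{-1}(g)=[g\circ\varphi]_{\mathbb D^*}$; if $\Omega$ is unbounded, $\Phi_\varphi:A(\mathbb D)\to A(\Omega^* )$, $\Phi_\varphi(f)=[f\circ\psi]_{\Omega^*}$, with inverse $\Phi_\varphi^{-1}(g)=[g\circ\varphi]_{\mathbb D}$. *)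

theory Defs
  imports "HOL-Complex_Analysis.Complex_Analysis" "HOL-Computational_Algebra.Polynomial"
begin

text \<open>Encoding of domains of the Riemann sphere.  A subset of the Riemann sphere
  is encoded by a pair (S, inO): S is its finite part (a subset of the complex
  plane) and the boolean inO says whether the point at infinity belongs to it.
  Since the point at infinity is never on the boundary of the domains considered,
  "bounded" corresponds to inO = False (and S bounded), "unbounded" to inO = True
  (and S containing a neighbourhood of infinity).\<close>

definition Dstar :: "complex set" where
  "Dstar = {z. 1 < cmod z}"

text \<open>Positively oriented rectifiable boundary cycle: finitely many pairwise
  disjoint rectifiable (Lipschitz parametrised) Jordan curves whose union is the
  boundary, oriented so that the total winding number is 1 at finite points of
  the set and 0 outside its closure (bounded case), resp. 0 and -1 (when the
  point at infinity belongs to the set).\<close>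

definition pos_bdry_cycle :: "complex set \<Rightarrow> bool \<Rightarrow> (real \<Rightarrow> complex) list \<Rightarrow> bool" where
  "pos_bdry_cycle S inO \<Gamma> \<longleftrightarrow>
     (\<forall>g\<in>set \<Gamma>. simple_path g \<and> pathfinish g = pathstart g \<and>
                   (\<exists>L. L-lipschitz_on {0..1} g)) \<and>
     (\<forall>i<length \<Gamma>. \<forall>j<length \<Gamma>. i \<noteq> j \<longrightarrow> path_image (\<Gamma>!i) \<inter> path_image (\<Gamma>!j) = {}) \<and>
     (\<Union>g\<in>set \<Gamma>. path_image g) = frontier S \<and>
     (\<forall>z. z \<notin> frontier S \<longrightarrow>
          (\<Sum>g\<leftarrow>\<Gamma>. winding_number g z) = (if z \<in> S then 1 else 0) - (if inO then 1 else 0))"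

definition bdry_int :: "complex set \<Rightarrow> bool \<Rightarrow> (complex \<Rightarrow> complex) \<Rightarrow> complex" where
  "bdry_int S inO f =
     (\<Sum>g\<leftarrow>(SOME \<Gamma>. pos_bdry_cycle S inO \<Gamma>). contour_integral g f) / (2 * of_real pi * \<i>)"

definition rectifiable_domain :: "complex set \<Rightarrow> bool \<Rightarrow> bool" where
  "rectifiable_domain S inO \<longleftrightarrow>
     open S \<and> connected S \<and> S \<noteq> {} \<and> (\<exists>\<Gamma>. pos_bdry_cycle S inO \<Gamma>) \<and>
     (if inO then (\<exists>R. {z. R < cmod z} \<subseteq> S) else bounded S)"

definition sphere_simply_connected :: "complex set \<Rightarrow> bool \<Rightarrow> bool" where
  "sphere_simply_connected S inO \<longleftrightarrow> (if inO then connected (- S) else simply_connected S)"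

definition in_A :: "complex set \<Rightarrow> bool \<Rightarrow> (complex \<Rightarrow> complex) \<Rightarrow> bool" where
  "in_A S inO f \<longleftrightarrow> f holomorphic_on S \<and> continuous_on (closure S) f \<and>
     (inO \<longrightarrow> (\<exists>L. (f \<longlongrightarrow> L) at_infinity))"

definition in_A0 :: "complex set \<Rightarrow> (complex \<Rightarrow> complex) \<Rightarrow> bool" where
  "in_A0 S f \<longleftrightarrow> in_A S True f \<and> (f \<longlongrightarrow> 0) at_infinity"

text \<open>Rat(Omega) for Omega containing infinity: rational, all finite poles in S
  (a pole at infinity is allowed).\<close>

definition rat_poles_in :: "complex set \<Rightarrow> (complex \<Rightarrow> complex) \<Rightarrow> bool" where
  "rat_poles_in S h \<longleftrightarrow> (\<exists>p q. q \<noteq> 0 \<and> (\<forall>z. poly q z = 0 \<longrightarrow> z \<in> S) \<and>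
       (\<forall>z. poly q z \<noteq> 0 \<longrightarrow> h z = poly p z / poly q z))"

definition rat0_poles_in :: "complex set \<Rightarrow> (complex \<Rightarrow> complex) \<Rightarrow> bool" where
  "rat0_poles_in S h \<longleftrightarrow> (\<exists>p q. q \<noteq> 0 \<and> (\<forall>z. poly q z = 0 \<longrightarrow> z \<in> S) \<and>
       (p = 0 \<or> degree p < degree q) \<and>
       (\<forall>z. poly q z \<noteq> 0 \<longrightarrow> h z = poly p z / poly q z))"

definition rational_on :: "complex set \<Rightarrow> (complex \<Rightarrow> complex) \<Rightarrow> bool" where
  "rational_on U f \<longleftrightarrow> (\<exists>p q. q \<noteq> 0 \<and> (\<forall>z\<in>U. poly q z \<noteq> 0 \<and> f z = poly p z / poly q z))"

definition L1a_rho0 :: "complex set \<Rightarrow> bool \<Rightarrow> (complex \<Rightarrow> complex) \<Rightarrow> bool" where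
  "L1a_rho0 S inO f \<longleftrightarrow> in_A S inO f \<and>
     set_integrable lborel S (\<lambda>w. f w / of_real ((cmod w)\<^sup>2))"

text \<open>Integral of f |w|^-2 dA with dA = dx dy / pi (the finite part S carries all
  the area).\<close>

definition weighted_area_int :: "complex set \<Rightarrow> (complex \<Rightarrow> complex) \<Rightarrow> complex" where
  "weighted_area_int S f = (LINT w:S|lborel. f w / of_real ((cmod w)\<^sup>2)) / of_real pi"

definition LQD :: "complex set \<Rightarrow> bool \<Rightarrow> (complex \<Rightarrow> complex) \<Rightarrow> bool" where
  "LQD S inO h \<longleftrightarrow>
     rectifiable_domain S inO \<and> 0 \<notin> frontier S \<and> interior (closure S) = S \<and>
     (if inO then rat_poles_in S h else rat0_poles_in S h) \<and>
     (\<forall>f. L1a_rho0 S inO f \<longrightarrow> weighted_area_int S f = bdry_int S inO (\<lambda>w. f w * h w))"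

definition res_inf :: "(complex \<Rightarrow> complex) \<Rightarrow> complex" where
  "res_inf h = - Lim at_infinity (\<lambda>w. w * h w)"

definition reflect :: "(complex \<Rightarrow> complex) \<Rightarrow> complex \<Rightarrow> complex" where
  "reflect f z = (if z = 0 then cnj (Lim at_infinity f) else cnj (f (1 / cnj z)))"

definition blaschke :: "complex \<Rightarrow> complex \<Rightarrow> complex" where
  "blaschke l z = cnj l / of_real (cmod l) * ((z - l) / (cnj l * z - 1))"

definition cauchy_proj :: "complex set \<Rightarrow> bool \<Rightarrow> (complex \<Rightarrow> complex) \<Rightarrow> complex \<Rightarrow> complex" where
  "cauchy_proj U inO f w = bdry_int U inO (\<lambda>\<xi>. f \<xi> / (\<xi> - w))"

definition bdry_ext :: "complex set \<Rightarrow> (complex \<Rightarrow> complex) \<Rightarrow> complex \<Rightarrow> complex" where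
  "bdry_ext D \<phi> \<xi> = Lim (at \<xi> within D) \<phi>"

definition riemann_map_bdd :: "complex set \<Rightarrow> (complex \<Rightarrow> complex) \<Rightarrow> bool" where
  "riemann_map_bdd S \<phi> \<longleftrightarrow> \<phi> holomorphic_on ball 0 1 \<and> inj_on \<phi> (ball 0 1) \<and> \<phi> ` ball 0 1 = S"

definition riemann_map_unbdd :: "complex set \<Rightarrow> (complex \<Rightarrow> complex) \<Rightarrow> bool" where
  "riemann_map_unbdd S \<phi> \<longleftrightarrow> \<phi> holomorphic_on Dstar \<and> inj_on \<phi> Dstar \<and> \<phi> ` Dstar = S \<and>
     filterlim \<phi> at_infinity at_infinity"

definition faber_inv_bdd :: "(complex \<Rightarrow> complex) \<Rightarrow> (complex \<Rightarrow> complex) \<Rightarrow> complex \<Rightarrow> complex" where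
  "faber_inv_bdd \<phi> g = cauchy_proj Dstar True (g \<circ> bdry_ext (ball 0 1) \<phi>)"

definition faber_inv_unbdd :: "(complex \<Rightarrow> complex) \<Rightarrow> (complex \<Rightarrow> complex) \<Rightarrow> complex \<Rightarrow> complex" where
  "faber_inv_unbdd \<phi> g = cauchy_proj (ball 0 1) False (g \<circ> bdry_ext Dstar \<phi>)"

end

(* Fix a point xi' outside the closure of the domain.  Testing the quadrature identity with
   w/(xi - w) - w/(xi' - w) shows that the potential
     u(xi) = 1/pi * integral over S of (1/cnj w) (1/(xi - w) - 1/(xi' - w))
   equals w h(w), up to a constant, outside S.  Only integrals of rational functions over the boundary
   are needed here.  Since u is Hoelder continuous, the equality persists on the boundary, and on S
   the function ln|w|^2 - u(w) is holomorphic (Morera on rectangles).  Hence ln|w|^2 is, up to o(1) at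
   the boundary, the sum of w h(w) and a function holomorphic in S.
   Writing the Riemann map as phi = const * k * e^g with |k| = 1 on the circle, this reads
     2 Re g = R + holomorphic + o(1)    as |z| -> 1,
   where R is the sum of the principal parts of (w h) o phi.  Replacing R by the conjugate of its
   reflection R#, with which it agrees on the circle, the maximum principle gives g = R#.  So g is
   rational and phi extends analytically across the circle; no Caratheodory theorem is required, and
   R can then be recognised as the Cauchy projection of the boundary values of (w h) o phi. *)

theory Submission
  imports Defs "HOL-Computational_Algebra.Fundamental_Theorem_Algebra" "HOL-Real_Asymp.Real_Asymp"
begin

text \<open>The boundary curves are only Lipschitz, and the cycle in \<open>bdry_int\<close> is an
  arbitrary choice, so nothing but its winding numbers may enter. Contour integrals therefore rest
  on differentiation on the line: a Lipschitz path is differentiable almost everywhere and is the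
  integral of its derivative. Composing such a path with a primitive, or taking its logarithm, gives
  a Lipschitz path again, and this settles every rational integrand with poles off the curves. The
  kernel subtracted at \<xi>' serves two purposes: the test function vanishes at infinity, and the
  kernel decays like |w|^(-2), as an unbounded domain requires. The Hoelder exponent 1/4 comes from
  splitting |\<xi> - \<eta>| into powers 1/4 and 3/4; this leaves |\<xi> - w|^(-5/4), which together
  with 1/|w| has order 9/4 > 2 at infinity while each singularity stays below order 2. The origin
  and infinity may belong to the domain. There the potential is controlled only up to a power, and
  the holomorphic part is obtained by removing a singularity.\<close>

section \<open>Lipschitz paths\<close>

text \<open>Applied both to \<open>F\<close> and to its inverse, this shows that the set where a lower derivate is below \<open>p\<close>
  and an upper derivate is above \<open>q > p\<close> is negligible.\<close>

lemma emeasure_image_growth_le: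
  fixes F :: "real \<Rightarrow> real"
  assumes up: "\<And>x y. x \<le> y \<Longrightarrow> F y - F x \<le> C * (y - x)"
    and inc: "strict_mono F"
    and E: "E \<in> lmeasurable" and FE: "F ` E \<in> sets lebesgue" and p: "p > 0"
    and slope: "\<And>x d. x \<in> E \<Longrightarrow> d > 0 \<Longrightarrow> \<exists>y. y \<noteq> x \<and> \<bar>y - x\<bar> < d \<and> (F y - F x) / (y - x) < p"
  shows "emeasure lebesgue (F ` E) \<le> ennreal p * emeasure lebesgue E"
proof -
  have C0: "C \<ge> 0"
    using up[of 0 1] strict_monoD[OF inc, of 0 1] by simp
  have lip: "norm (F x - F y) \<le> C * norm (x - y)" for x y
  proof (cases "x \<le> y")
    case True
    then show ?thesis using up[of x y] strict_mono_less_eq[OF inc, of x y] by simp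
  next
    case False
    then show ?thesis using up[of y x] strict_mono_less_eq[OF inc, of y x] by simp
  qed
  have contF: "continuous_on A F" for A
    by (rule lipschitz_on_continuous_on[of C]) (use lip C0 in \<open>auto simp: lipschitz_on_def dist_norm\<close>)
  have img: "F ` cball x r = cbox (F (x - r)) (F (x + r))" if "r > 0" for x r
  proof
    show "F ` cball x r \<subseteq> cbox (F (x - r)) (F (x + r))"
      using strict_mono_less_eq[OF inc] by (auto simp: cball_eq_atLeastAtMost)
    show "cbox (F (x - r)) (F (x + r)) \<subseteq> F ` cball x r"
    proof
      fix y assume "y \<in> cbox (F (x - r)) (F (x + r))"
      then have "\<exists>t. x - r \<le> t \<and> t \<le> x + r \<and> F t = y"
        using that by (intro IVT') (auto intro: contF)
      then show "y \<in> F ` cball x r" by (auto simp: cball_eq_atLeastAtMost)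
    qed
  qed
  have main: "emeasure lebesgue (F ` E) \<le> ennreal p * (emeasure lebesgue E + ennreal e)" if e: "e > 0" for e
  proof -
    \<comment> \<open>The open superset \<open>T\<close> caps the total length of the disjoint
      intervals chosen below at the measure of \<open>E\<close> plus \<open>e\<close>.\<close>
    obtain T where T: "open T" "E \<subseteq> T" "T - E \<in> lmeasurable" "emeasure lebesgue (T - E) < ennreal e"
      using sets_lebesgue_outer_open[OF fmeasurableD[OF E] e] by blast
    define K where "K = {(x, r). 0 < r \<and> cball x r \<subseteq> T \<and> F (x + r) - F (x - r) < p * (2 * r)}"
    have V: "\<exists>i. i \<in> K \<and> x \<in> cball (fst i) (snd i) \<and> snd i < d" if x: "x \<in> E" and d: "0 < d" for x d
    proof -
      obtain e1 where e1: "e1 > 0" "ball x e1 \<subseteq> T" using T x by (meson open_contains_ball subsetD)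
      obtain y where y: "y \<noteq> x" "\<bar>y - x\<bar> < min d e1" "(F y - F x) / (y - x) < p"
        using slope[OF x, of "min d e1"] d e1 by auto
      \<comment> \<open>The interval between \<open>x\<close> and \<open>y\<close> is recentred
        because the covering theorem selects closed balls; \<open>x\<close> becomes an
        endpoint.\<close>
      define m where "m = (x + y) / 2"
      define r where "r = \<bar>y - x\<bar> / 2"
      have r: "r > 0" using y by (simp add: r_def)
      have sub: "cball m r \<subseteq> T"
      proof -
        have "cball m r \<subseteq> ball x e1"
        proof
          fix z assume "z \<in> cball m r"
          then show "z \<in> ball x e1" using y unfolding m_def r_def by (auto simp: dist_real_def abs_if field_simps split: if_splits)
        qed
        then show ?thesis using e1 by blast
      qed
      have "F (m + r) - F (m - r) < p * (2 * r)"
      proof (cases "x < y")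
        case True
        then have eqs: "m + r = y" "m - r = x" "2 * r = y - x" by (auto simp: m_def r_def field_simps)
        have "F y - F x < p * (y - x)" using y True by (simp add: pos_divide_less_eq)
        then show ?thesis by (simp only: eqs)
      next
        case False
        then have "y < x" using y by simp
        then have eqs: "m + r = x" "m - r = y" "2 * r = x - y" by (auto simp: m_def r_def field_simps)
        have "(F x - F y) / (x - y) < p" using y(3) minus_divide_divide[of "F x - F y" "x - y"] by simp
        then have "F x - F y < p * (x - y)" using \<open>y < x\<close> by (simp add: pos_divide_less_eq)
        then show ?thesis by (simp only: eqs)
      qed
      then have "(m, r) \<in> K" using r sub by (simp add: K_def)
      moreover have "x \<in> cball m r" unfolding m_def r_def by (auto simp: dist_real_def abs_if field_simps)
      moreover have "r < d" using y d unfolding r_def by simp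
      ultimately show ?thesis by force
    qed
    obtain D where D: "countable D" "D \<subseteq> K"
       "pairwise (\<lambda>i j. disjnt (cball (fst i) (snd i)) (cball (fst j) (snd j))) D"
       "negligible (E - (\<Union>i\<in>D. cball (fst i) (snd i)))"
      using Vitali_covering_theorem_cballs[of K snd E fst] V by (force simp: K_def)
    let ?B = "\<lambda>i. cball (fst i) (snd i) :: real set"
    \<comment> \<open>Vitali leaves a null set uncovered; its Lipschitz image is again null.\<close>
    have neg: "negligible (F ` (E - (\<Union>i\<in>D. ?B i)))"
      by (rule negligible_locally_Lipschitz_image[OF order_refl D(4)])
         (use lip in \<open>auto intro!: exI[of _ UNIV]\<close>)
    have disj: "disjoint_family_on ?B D"
      using D(3) by (auto simp: disjoint_family_on_def pairwise_def disjnt_def)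
    have injF: "inj F" using inc by (rule strict_mono_imp_inj_on)
    have disjF: "disjoint_family_on (\<lambda>i. F ` ?B i) D"
      using disj by (simp add: disjoint_family_on_def flip: image_Int[OF injF])
    have imD: "F ` ?B i = cbox (F (fst i - snd i)) (F (fst i + snd i))" if "i \<in> D" for i
      using D that by (intro img) (auto simp: K_def)
    have mB: "F ` ?B i \<in> sets lebesgue" if "i \<in> D" for i
      unfolding imD[OF that] by simp
    have mU: "(\<Union>i\<in>D. F ` ?B i) \<in> sets lebesgue"
      by (intro sets.countable_UN' D image_subsetI mB)
    have "emeasure lebesgue (F ` E) \<le> emeasure lebesgue (F ` (E - (\<Union>i\<in>D. ?B i)) \<union> (\<Union>i\<in>D. F ` ?B i))"
      by (intro emeasure_mono sets.Un mU negligible_imp_sets neg) blast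
    also have "\<dots> \<le> emeasure lebesgue (F ` (E - (\<Union>i\<in>D. ?B i))) + emeasure lebesgue (\<Union>i\<in>D. F ` ?B i)"
      by (intro emeasure_subadditive mU negligible_imp_sets neg)
    also have "emeasure lebesgue (F ` (E - (\<Union>i\<in>D. ?B i))) = 0"
      using neg negligible_iff_emeasure0[OF negligible_imp_sets[OF neg]] by blast
    also have "emeasure lebesgue (\<Union>i\<in>D. F ` ?B i) = (\<integral>\<^sup>+i. emeasure lebesgue (F ` ?B i) \<partial>count_space D)"
      by (intro emeasure_UN_countable disjF D mB)
    also have "\<dots> \<le> (\<integral>\<^sup>+i. ennreal p * emeasure lebesgue (?B i) \<partial>count_space D)"
    proof (intro nn_integral_mono)
      fix i assume "i \<in> space (count_space D)"
      then have i: "i \<in> D" by simp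
      then have iK: "0 < snd i" "F (fst i + snd i) - F (fst i - snd i) < p * (2 * snd i)" using D by (auto simp: K_def)
      have "emeasure lebesgue (F ` ?B i) = ennreal (F (fst i + snd i) - F (fst i - snd i))"
        using iK strict_mono_less_eq[OF inc, of "fst i - snd i" "fst i + snd i"]
        by (simp add: imD[OF i])
      also have "\<dots> \<le> ennreal (p * (2 * snd i))" using iK by (intro ennreal_leI) simp
      also have "\<dots> = ennreal p * emeasure lebesgue (?B i)"
        using iK p by (simp add: cball_eq_atLeastAtMost ennreal_mult)
      finally show "emeasure lebesgue (F ` ?B i) \<le> ennreal p * emeasure lebesgue (?B i)" .
    qed
    also have "\<dots> = ennreal p * (\<integral>\<^sup>+i. emeasure lebesgue (?B i) \<partial>count_space D)"
      by (simp add: nn_integral_cmult)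
    also have "(\<integral>\<^sup>+i. emeasure lebesgue (?B i) \<partial>count_space D) = emeasure lebesgue (\<Union>i\<in>D. ?B i)"
      by (intro emeasure_UN_countable[symmetric] disj D) auto
    also have "\<dots> \<le> emeasure lebesgue T"
    proof (intro emeasure_mono)
      show "(\<Union>i\<in>D. ?B i) \<subseteq> T" using D(2) unfolding K_def by fastforce
    qed (use T(1) in simp)
    also have "emeasure lebesgue T \<le> emeasure lebesgue E + ennreal e"
    proof -
      have "emeasure lebesgue T = emeasure lebesgue (E \<union> (T - E))" using T(2) by (simp add: Un_absorb1)
      also have "\<dots> \<le> emeasure lebesgue E + emeasure lebesgue (T - E)"
        by (intro emeasure_subadditive) (use E T in auto)
      also have "\<dots> \<le> emeasure lebesgue E + ennreal e" using T(4) by (intro add_left_mono) simp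
      finally show ?thesis .
    qed
    finally show ?thesis using p by (simp add: mult_left_mono)
  qed
  show ?thesis
  proof (rule ennreal_le_epsilon)
    fix e :: real assume that: "0 < e"
    have "emeasure lebesgue (F ` E) \<le> ennreal p * (emeasure lebesgue E + ennreal (e / p))"
      using main[of "e/p"] that p by simp
    also have "\<dots> = ennreal p * emeasure lebesgue E + ennreal e"
      using p that by (simp add: distrib_left flip: ennreal_mult)
    finally show "emeasure lebesgue (F ` E) \<le> ennreal p * emeasure lebesgue E + ennreal e" .
  qed
qed

text \<open>On the set where, at every scale, some difference quotients drop below \<open>p\<close>
  and others exceed \<open>q > p\<close>, the growth lemma gives |F(E)| \<le> p |E| for
  \<open>F\<close> and |E| \<le> |F(E)| / q for its inverse \<open>G\<close>. Hence |E| \<le> (p/q)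
  |E|, which for finite measure forces |E| = 0. Countably many rational pairs exhaust the points of
  non-differentiability. The lower bound \<open>c\<close> makes the inverse Lipschitz and keeps the
  derivates positive.\<close>

lemma AE_differentiable_bilipschitz:
  fixes F :: "real \<Rightarrow> real"
  assumes c: "c > 0" and lo: "\<And>x y. x \<le> y \<Longrightarrow> c * (y - x) \<le> F y - F x"
    and up: "\<And>x y. x \<le> y \<Longrightarrow> F y - F x \<le> C * (y - x)"
  shows "negligible {x. \<not> F differentiable at x}"
proof -
  have inc: "strict_mono F"
  proof (rule strict_monoI)
    fix x y :: real assume "x < y"
    then show "F x < F y" using lo[of x y] c by (smt (verit) mult_pos_pos)
  qed
  have injF: "inj F" using inc by (rule strict_mono_imp_inj_on)
  have C0: "C \<ge> 0" using up[of 0 1] strict_monoD[OF inc, of 0 1] by simp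
  have lip: "\<bar>F x - F y\<bar> \<le> C * \<bar>x - y\<bar>" for x y
    using up[of x y] up[of y x] strict_mono_less_eq[OF inc, of x y] strict_mono_less_eq[OF inc, of y x]
    by (cases "x \<le> y") auto
  have contF: "continuous_on A F" for A
    by (rule lipschitz_on_continuous_on[of C]) (use lip C0 in \<open>auto simp: lipschitz_on_def dist_norm\<close>)
  have surF: "surj F"
  proof -
    have "\<exists>x. F x = y" for y
    proof -
      define M where "M = \<bar>y - F 0\<bar> / c"
      have M: "M \<ge> 0" "c * M = \<bar>y - F 0\<bar>" using c by (auto simp: M_def)
      have "F (-M) \<le> y" "y \<le> F M" using lo[of "-M" 0] lo[of 0 M] M by (auto simp: abs_if split: if_splits)
      then have "\<exists>t. -M \<le> t \<and> t \<le> M \<and> F t = y"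
        using M by (intro IVT') (auto intro: contF)
      then show ?thesis by blast
    qed
    then show ?thesis by (metis surjI)
  qed
  define G where "G = inv F"
  have FG[simp]: "F (G y) = y" "G (F x) = x" for x y
    using surF injF by (auto simp: G_def surj_f_inv_f)
  have incG: "strict_mono G"
    by (rule strict_monoI) (metis FG(1) inc strict_mono_less)
  have upG: "G y - G x \<le> (1/c) * (y - x)" if "x \<le> y" for x y
  proof -
    have "G x \<le> G y" using strict_mono_less_eq[OF incG] that by simp
    then show ?thesis using lo[of "G x" "G y"] c by (simp add: field_simps)
  qed
  have contG: "continuous_on UNIV G"
  proof (rule lipschitz_on_continuous_on[of "1/c"], unfold lipschitz_on_def, intro conjI ballI)
    fix x y show "dist (G x) (G y) \<le> 1 / c * dist x y"
      using upG[of x y] upG[of y x] strict_mono_less_eq[OF incG, of x y] strict_mono_less_eq[OF incG, of y x]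
      by (cases "x \<le> y") (auto simp: dist_real_def)
  qed (use c in simp)
  define s where "s = (\<lambda>x y. (F y - F x) / (y - x))"
  define Lo where "Lo = (\<lambda>p. {x. \<forall>d>0. \<exists>y. y \<noteq> x \<and> \<bar>y - x\<bar> < d \<and> s x y < p})"
  define Up where "Up = (\<lambda>q. {x. \<forall>d>0. \<exists>y. y \<noteq> x \<and> \<bar>y - x\<bar> < d \<and> s x y > q})"
  \<comment> \<open>Only the scales 1/(n+1) matter, and for a fixed increment \<open>h\<close> the
    condition is open in \<open>x\<close>; the set is thus a countable intersection of open
    sets.\<close>
  have borel_gen: "{x. \<forall>d>0. \<exists>y. y \<noteq> x \<and> \<bar>y - x\<bar> < d \<and> Q (s x y)} \<in> sets borel" if Q: "open {t. Q t}" for Q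
  proof -
    have "{x. \<forall>d>0. \<exists>y. y \<noteq> x \<and> \<bar>y - x\<bar> < d \<and> Q (s x y)}
        = (\<Inter>n::nat. \<Union>h\<in>{h. h \<noteq> 0 \<and> \<bar>h\<bar> < 1 / real (Suc n)}. {x. Q (s x (x + h))})" (is "?L = ?R")
    proof
      show "?L \<subseteq> ?R"
      proof
        fix x assume x: "x \<in> ?L"
        have "x \<in> (\<Union>h\<in>{h. h \<noteq> 0 \<and> \<bar>h\<bar> < 1 / real (Suc n)}. {x. Q (s x (x + h))})" for n
        proof -
          have "1 / real (Suc n) > 0" by simp
          then obtain y where "y \<noteq> x" "\<bar>y - x\<bar> < 1 / real (Suc n)" "Q (s x y)" using x by blast
          then show ?thesis by (intro UN_I[of "y - x"]) auto
        qed
        then show "x \<in> ?R" by blast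
      qed
      show "?R \<subseteq> ?L"
      proof
        fix x assume x: "x \<in> ?R"
        have "\<exists>y. y \<noteq> x \<and> \<bar>y - x\<bar> < d \<and> Q (s x y)" if "d > 0" for d
        proof -
          obtain n where n: "1 / real (Suc n) < d" using nat_approx_posE[OF \<open>d > 0\<close>] by blast
          then obtain h where "h \<noteq> 0" "\<bar>h\<bar> < 1 / real (Suc n)" "Q (s x (x + h))" using x by blast
          then show ?thesis using n by (intro exI[of _ "x + h"]) auto
        qed
        then show "x \<in> ?L" by blast
      qed
    qed
    moreover have "open {x. Q (s x (x + h))}" if "h \<noteq> 0" for h
    proof -
      have "continuous_on UNIV (\<lambda>x. s x (x + h))"
        unfolding s_def using that
        by (intro continuous_intros continuous_on_compose2[OF contF[of UNIV]]) auto
      then have "open ((\<lambda>x. s x (x + h)) -` {t. Q t})" using Q by (intro open_vimage) 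
      then show ?thesis by (simp add: vimage_def)
    qed
    then have "\<And>n. (\<Union>h\<in>{h. h \<noteq> 0 \<and> \<bar>h\<bar> < 1 / real (Suc n)}. {x. Q (s x (x + h))}) \<in> sets borel"
      by (intro borel_open open_UN) auto
    ultimately show ?thesis by (simp only:) (rule sets.countable_INT'; blast)
  qed
  \<comment> \<open>Cutting down to a bounded interval makes the measure finite, so that it can be
    cancelled.\<close>
  define E where "E = (\<lambda>p q N. Lo p \<inter> Up q \<inter> {- real N..real N})"
  have E0: "negligible (E p q N)" if pq: "0 < p" "p < q" for p q N
  proof -
    have Eb: "E p q N \<in> sets borel"
      unfolding E_def Lo_def Up_def using borel_gen[of "\<lambda>t. t < p"] borel_gen[of "\<lambda>t. t > q"]
      by (simp add: open_Collect_less)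
    have El: "E p q N \<in> lmeasurable"
      by (rule bounded_set_imp_lmeasurable) (use Eb in \<open>auto simp: E_def intro: bounded_subset[of "{- real N..real N}"]\<close>)
    have FEb: "F ` E p q N \<in> sets borel"
    proof -
      have "F ` E p q N = G -` E p q N \<inter> space borel"
        by auto (metis FG(1) image_eqI)
      then show ?thesis using measurable_sets[OF borel_measurable_continuous_onI[OF contG] Eb] by simp
    qed
    have bF: "bounded (F ` E p q N)"
      by (rule bounded_subset[of "F ` {- real N..real N}"])
         (auto simp: E_def intro!: compact_imp_bounded compact_continuous_image contF)
    have FEl: "F ` E p q N \<in> lmeasurable"
      by (rule bounded_set_imp_lmeasurable[OF bF]) (use FEb in auto)
    have 1: "emeasure lebesgue (F ` E p q N) \<le> ennreal p * emeasure lebesgue (E p q N)"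
    proof (rule emeasure_image_growth_le[OF up inc El _ pq(1)])
      fix x d :: real assume "x \<in> E p q N" "0 < d"
      then show "\<exists>y. y \<noteq> x \<and> \<bar>y - x\<bar> < d \<and> (F y - F x) / (y - x) < p"
        unfolding E_def Lo_def s_def by blast
    qed (use FEl in auto)
    have GF: "G ` F ` E p q N = E p q N" by (simp add: image_image)
    have 2: "emeasure lebesgue (G ` F ` E p q N) \<le> ennreal (1/q) * emeasure lebesgue (F ` E p q N)"
    proof (rule emeasure_image_growth_le[OF upG incG FEl])
      fix x d :: real assume x: "x \<in> F ` E p q N" and d: "0 < d"
      then obtain t where t: "x = F t" "t \<in> E p q N" by blast
      then have "t \<in> Up q" by (simp add: E_def)
      \<comment> \<open>A scale in the domain that \<open>F\<close> turns into less than
        \<open>d\<close>; the added 1 keeps the divisor positive, as only \<open>C \<ge> 0\<close>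
        is recorded.\<close>
      have "d / (C + 1) > 0" using d C0 by simp
      then obtain v where v: "v \<noteq> t" "\<bar>v - t\<bar> < d / (C + 1)" "s t v > q"
        using \<open>t \<in> Up q\<close> unfolding Up_def by blast
      have "\<bar>F v - F t\<bar> \<le> C * \<bar>v - t\<bar>" by (rule lip)
      also have "\<dots> \<le> (C + 1) * \<bar>v - t\<bar>" by (intro mult_right_mono) auto
      also have "\<dots> < d" using v(2) C0 by (simp add: field_simps)
      finally have a: "\<bar>F v - x\<bar> < d" by (simp add: t)
      have b: "F v \<noteq> x" using v t injF by (auto simp: inj_def)
      have "(v - t) / (F v - F t) < 1 / q"
      proof -
        have "(v - t) / (F v - F t) = inverse (s t v)" by (simp add: s_def)
        also have "\<dots> < inverse q" using v(3) pq by (intro less_imp_inverse_less) auto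
        finally show ?thesis by (simp add: inverse_eq_divide)
      qed
      then show "\<exists>y. y \<noteq> x \<and> \<bar>y - x\<bar> < d \<and> (G y - G x) / (y - x) < 1 / q"
        using a b by (intro exI[of _ "F v"]) (auto simp: t)
    qed (use pq El in \<open>auto simp: image_image\<close>)
    let ?m = "measure lebesgue (E p q N)"
    have "emeasure lebesgue (E p q N) \<le> ennreal (1/q) * (ennreal p * emeasure lebesgue (E p q N))"
      using 2 1 unfolding GF by (meson mult_left_mono order_trans zero_le)
    then have "ennreal ?m \<le> ennreal (1/q * (p * ?m))"
      using El pq by (simp add: emeasure_eq_measure2 fmeasurableD2 flip: ennreal_mult')
    then have "?m \<le> (1/q) * (p * ?m)" using pq by (subst (asm) ennreal_le_iff) auto
    then have "?m * (q - p) \<le> 0" using pq by (simp add: field_simps)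
    then have "?m = 0" using pq measure_nonneg[of lebesgue "E p q N"] by (simp add: mult_le_0_iff order_antisym)
    then show ?thesis using El by (simp add: negligible_iff_measure)
  qed
  have sub: "{x. \<not> F differentiable at x} \<subseteq> (\<Union>p\<in>\<rat> \<inter> {0<..}. \<Union>q\<in>\<rat> \<inter> {p<..}. \<Union>N. E p q N)"
  proof
    fix x assume "x \<in> {x. \<not> F differentiable at x}"
    then have nd: "\<not> F differentiable at x" by simp
    have sb: "c \<le> s x y" "s x y \<le> C" if "y \<noteq> x" for y
      using lo[of x y] up[of x y] lo[of y x] up[of y x] that unfolding s_def
      by (cases "x < y"; auto simp: field_simps)+
    let ?f = "\<lambda>y. ereal (s x y)"
    have ev: "eventually (\<lambda>y. y \<noteq> x) (at x)" by (simp add: eventually_at_filter)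
    \<comment> \<open>The bounds \<open>c\<close> and \<open>C\<close> keep both derivates finite,
      so that their equality would yield a real derivative.\<close>
    have LI: "Liminf (at x) ?f \<ge> ereal c" "Limsup (at x) ?f \<le> ereal C"
      by (rule Liminf_bounded Limsup_bounded; use ev sb in \<open>auto elim: eventually_mono\<close>)+
    have le: "Liminf (at x) ?f \<le> Limsup (at x) ?f" by (rule Liminf_le_Limsup) simp
    have "Liminf (at x) ?f \<noteq> Limsup (at x) ?f"
    proof
      assume eq: "Liminf (at x) ?f = Limsup (at x) ?f"
      then obtain l where l: "Limsup (at x) ?f = ereal l" using LI by (cases "Limsup (at x) ?f") auto
      have "(?f \<longlongrightarrow> ereal l) (at x)"
        using eq l by (subst tendsto_iff_Liminf_eq_Limsup) auto
      then have "(s x \<longlongrightarrow> l) (at x)" by simp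
      then have "(F has_field_derivative l) (at x)" unfolding s_def by (simp add: has_field_derivative_iff)
      then show False using nd by (auto simp: has_field_derivative_def intro: differentiableI)
    qed
    with le have lt: "Liminf (at x) ?f < Limsup (at x) ?f" by simp
    obtain p where p: "Liminf (at x) ?f < ereal (real_of_rat p)" "ereal (real_of_rat p) < Limsup (at x) ?f"
      using ereal_dense3[OF lt] by blast
    obtain q where q: "ereal (real_of_rat p) < ereal (real_of_rat q)" "ereal (real_of_rat q) < Limsup (at x) ?f"
      using ereal_dense3[OF p(2)] by blast
    have p0: "real_of_rat p > 0" using LI(1) p(1) c by (metis ereal_less_le less_ereal.simps(1) order.strict_trans order_le_less_trans)
    have fr: "x \<in> Lo (real_of_rat p)"
    proof (rule ccontr)
      assume "x \<notin> Lo (real_of_rat p)"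
      then obtain d where d: "d > 0" "\<And>y. y \<noteq> x \<Longrightarrow> \<bar>y - x\<bar> < d \<Longrightarrow> \<not> s x y < real_of_rat p"
        unfolding Lo_def by blast
      have "eventually (\<lambda>y. ereal (real_of_rat p) \<le> ?f y) (at x)"
        unfolding eventually_at using d by (intro exI[of _ d]) (auto simp: dist_real_def not_less)
      then have "ereal (real_of_rat p) \<le> Liminf (at x) ?f" by (rule Liminf_bounded)
      then show False using p(1) by simp
    qed
    have fr2: "x \<in> Up (real_of_rat q)"
    proof (rule ccontr)
      assume "x \<notin> Up (real_of_rat q)"
      then obtain d where d: "d > 0" "\<And>y. y \<noteq> x \<Longrightarrow> \<bar>y - x\<bar> < d \<Longrightarrow> \<not> s x y > real_of_rat q"
        unfolding Up_def by blast
      have "eventually (\<lambda>y. ?f y \<le> ereal (real_of_rat q)) (at x)"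
        unfolding eventually_at using d by (intro exI[of _ d]) (auto simp: dist_real_def not_less)
      then have "Limsup (at x) ?f \<le> ereal (real_of_rat q)" by (rule Limsup_bounded)
      then show False using q(2) by simp
    qed
    obtain N where "\<bar>x\<bar> \<le> real N" using real_arch_simple by blast
    then have "x \<in> E (real_of_rat p) (real_of_rat q) N" using fr fr2 by (auto simp: E_def abs_le_iff)
    then show "x \<in> (\<Union>p\<in>\<rat> \<inter> {0<..}. \<Union>q\<in>\<rat> \<inter> {p<..}. \<Union>N. E p q N)"
      using p0 q(1) by (intro UN_I[of "real_of_rat p"] UN_I[of "real_of_rat q"] UN_I[of N]) auto
  qed
  have neg1: "negligible (\<Union>N. E p q N)" if "0 < p" "p < q" for p q
    by (rule negligible_Union_nat) (rule E0[OF that])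
  have neg2: "negligible (\<Union>q\<in>\<rat> \<inter> {p<..}. \<Union>N. E p q N)" if "0 < p" for p
  proof (rule negligible_countable_Union)
    show "countable ((\<lambda>q. \<Union>N. E p q N) ` (\<rat> \<inter> {p<..}))"
      by (intro countable_image countable_Int1 countable_rat)
  qed (use neg1 that in blast)
  have "negligible (\<Union>p\<in>\<rat> \<inter> {0<..}. \<Union>q\<in>\<rat> \<inter> {p<..}. \<Union>N. E p q N)"
  proof (rule negligible_countable_Union)
    show "countable ((\<lambda>p. \<Union>q\<in>\<rat> \<inter> {p<..}. \<Union>N. E p q N) ` (\<rat> \<inter> {0<..}))"
      by (intro countable_image countable_Int1 countable_rat)
  qed (use neg2 in blast)
  then show ?thesis using sub negligible_subset by blast
qed

text \<open>Adding the linear function (L + 1) x gives a function with slopes between 1 and 2 L + 1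
  and does not affect differentiability.\<close>

lemma AE_differentiable_lipschitz_real:
  fixes f :: "real \<Rightarrow> real"
  assumes "L-lipschitz_on UNIV f"
  shows "negligible {x. \<not> f differentiable at x}"
proof -
  have L0: "L \<ge> 0" using assms by (rule lipschitz_on_nonneg)
  have l: "\<bar>f y - f x\<bar> \<le> L * \<bar>y - x\<bar>" for x y
    using lipschitz_onD[OF assms, of y x] by (simp add: dist_real_def)
  define F where "F = (\<lambda>x. f x + (L + 1) * x)"
  have "negligible {x. \<not> F differentiable at x}"
  proof (rule AE_differentiable_bilipschitz[of 1 F "2 * L + 1"])
    fix x y :: real assume "x \<le> y"
    then have "\<bar>f y - f x\<bar> \<le> L * (y - x)" using l[of y x] by simp
    then show "1 * (y - x) \<le> F y - F x" "F y - F x \<le> (2 * L + 1) * (y - x)"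
      unfolding F_def abs_le_iff by (simp_all add: algebra_simps)
  qed simp
  moreover have "f differentiable at x" if "F differentiable at x" for x
  proof -
    have "(\<lambda>x. F x - (L + 1) * x) differentiable at x" using that by (intro differentiable_diff) auto
    then show ?thesis by (simp add: F_def)
  qed
  ultimately show ?thesis by (elim negligible_subset) blast
qed

lemma AE_differentiable_lipschitz_complex:
  fixes g :: "real \<Rightarrow> complex"
  assumes L: "L-lipschitz_on UNIV g"
  shows "negligible {x. \<not> g differentiable at x}"
proof -
  have "L-lipschitz_on UNIV (\<lambda>x. Re (g x))" "L-lipschitz_on UNIV (\<lambda>x. Im (g x))"
    using L unfolding lipschitz_on_def dist_norm
    by (auto intro: order_trans[OF abs_Re_le_cmod] order_trans[OF abs_Im_le_cmod] simp flip: minus_complex.simps)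
  then have "negligible ({x. \<not> (\<lambda>x. Re (g x)) differentiable at x} \<union> {x. \<not> (\<lambda>x. Im (g x)) differentiable at x})"
    by (intro negligible_Un AE_differentiable_lipschitz_real)
  moreover have "g differentiable at x"
    if d: "(\<lambda>x. Re (g x)) differentiable at x" "(\<lambda>x. Im (g x)) differentiable at x" for x
  proof -
    obtain a b where "((\<lambda>x. Re (g x)) has_vector_derivative a) (at x)" "((\<lambda>x. Im (g x)) has_vector_derivative b) (at x)"
      using d by (auto simp: vector_derivative_works)
    then have "(g has_vector_derivative Complex a b) (at x)"
      by (simp add: has_vector_derivative_complex_iff has_real_derivative_iff_has_vector_derivative)
    then show ?thesis by (rule differentiableI_vector)
  qed
  ultimately show ?thesis by (elim negligible_subset) blast
qed

section \<open>The fundamental theorem of calculus for Lipschitz paths\<close>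

lemma has_vector_derivative_quotient_seq:
  fixes g :: "real \<Rightarrow> complex"
  assumes g: "(g has_vector_derivative v) (at t)" and h: "\<And>k::nat. h k > 0" "h \<longlonglongrightarrow> 0"
  shows "(\<lambda>k. (g (t + h k) - g t) /\<^sub>R h k) \<longlonglongrightarrow> v"
proof -
  have hl: "filterlim h (at 0) sequentially"
    using h by (auto simp: filterlim_at less_imp_neq[symmetric])
  have "((\<lambda>x. Re (g x)) has_real_derivative Re v) (at t)" "((\<lambda>x. Im (g x)) has_real_derivative Im v) (at t)"
    using g by (auto simp: has_vector_derivative_complex_iff)
  then have "(\<lambda>k. (Re (g (t + h k)) - Re (g t)) / h k) \<longlonglongrightarrow> Re v"
            "(\<lambda>k. (Im (g (t + h k)) - Im (g t)) / h k) \<longlonglongrightarrow> Im v"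
    unfolding DERIV_def by (auto intro: filterlim_compose[OF _ hl])
  then show ?thesis by (simp add: tendsto_complex_iff divide_inverse mult.commute)
qed

text \<open>With a primitive \<open>G\<close> of \<open>g\<close>, the integral of the difference
  quotient of \<open>g\<close> is the difference of the quotients of \<open>G\<close> at the two
  ends, which tends to g b - g a. The quotients are bounded by \<open>L\<close> and converge almost
  everywhere, so dominated convergence identifies the limit with the integral of the
  derivative.\<close>

lemma lipschitz_FTC_real_line:
  fixes g :: "real \<Rightarrow> complex"
  assumes L: "L-lipschitz_on UNIV g" and ab: "a \<le> b"
  shows "((\<lambda>t. vector_derivative g (at t)) has_integral (g b - g a)) {a..b}"
proof -
  have contg: "continuous_on A g" for A
    using L by (meson lipschitz_on_continuous_on lipschitz_on_subset subset_UNIV)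
  \<comment> \<open>The margins keep x and x + h k in the interior, as the steps are at most 1;
    there the derivative of \<open>G\<close> is two-sided.\<close>
  obtain G where G: "\<And>x. x \<in> {a-1..b+2} \<Longrightarrow> (G has_vector_derivative g x) (at x within {a-1..b+2})"
    using antiderivative_continuous[OF contg] by blast
  have G': "(G has_vector_derivative g x) (at x)" if "x \<in> {a-1<..<b+2}" for x
    using G[of x] that at_within_Icc_at[of "a-1" x "b+2"] by simp
  define N where "N = {x. \<not> g differentiable at x}"
  have negN: "negligible N" unfolding N_def by (rule AE_differentiable_lipschitz_complex[OF L])
  define d where "d = (\<lambda>t. if t \<in> N then 0 else vector_derivative g (at t))"
  define h where "h = (\<lambda>k::nat. inverse (real (Suc k)))"
  have h: "0 < h k" "h k \<le> 1" for k by (auto simp: h_def field_simps)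
  have h0: "h \<longlonglongrightarrow> 0" unfolding h_def by (rule LIMSEQ_inverse_real_of_nat)
  \<comment> \<open>Setting the quotients to 0 on the null set makes them converge at every point
    and changes no integral.\<close>
  define f where "f = (\<lambda>k t. if t \<in> N then 0 else (g (t + h k) - g t) /\<^sub>R h k)"
  define I where "I = (\<lambda>k. ((G (b + h k) - G b) /\<^sub>R h k) - ((G (a + h k) - G a) /\<^sub>R h k))"
  have fI: "(f k has_integral I k) {a..b}" for k
  proof -
    have "((\<lambda>t. (g (t + h k) - g t) /\<^sub>R h k) has_integral
          ((G (b + h k) - G b) /\<^sub>R h k - (G (a + h k) - G a) /\<^sub>R h k)) {a..b}"
    proof (rule fundamental_theorem_of_calculus[OF ab, where f = "\<lambda>t. (G (t + h k) - G t) /\<^sub>R h k"])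
      fix x assume x: "x \<in> {a..b}"
      have 1: "(G has_vector_derivative g (x + h k)) (at (x + h k))" using x h[of k] by (intro G') auto
      have "((\<lambda>t. G (t + h k)) has_vector_derivative g (x + h k)) (at x)"
        using vector_diff_chain_at[of "\<lambda>t. t + h k" 1 x G "g (x + h k)"] 1
        by (simp add: o_def has_vector_derivative_add_const)
      moreover have "(G has_vector_derivative g x) (at x)" using x by (intro G') auto
      ultimately have "((\<lambda>t. G (t + h k) - G t) has_vector_derivative (g (x + h k) - g x)) (at x)"
        by (rule has_vector_derivative_diff)
      from bounded_linear.has_vector_derivative[OF bounded_linear_scaleR_right[of "inverse (h k)"] this]
      show "((\<lambda>t. (G (t + h k) - G t) /\<^sub>R h k) has_vector_derivative (g (x + h k) - g x) /\<^sub>R h k) (at x within {a..b})"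
        by (rule has_vector_derivative_at_within)
    qed
    then show ?thesis unfolding I_def
      by (rule has_integral_spike[OF negN, rotated]) (auto simp: f_def)
  qed
  have bd: "norm (f k t) \<le> L" for k t
  proof -
    have "norm (g (t + h k) - g t) \<le> L * h k"
      using lipschitz_onD[OF L, of "t + h k" t] h[of k] by (simp add: dist_norm)
    then show ?thesis using h(1)[of k] lipschitz_on_nonneg[OF L] by (auto simp: f_def pos_divide_le_eq divide_inverse_commute[symmetric])
  qed
  have lim: "(\<lambda>k. f k t) \<longlonglongrightarrow> d t" for t
  proof (cases "t \<in> N")
    case False
    then have "(g has_vector_derivative vector_derivative g (at t)) (at t)"
      by (simp add: N_def vector_derivative_works)
    then have "(\<lambda>k. (g (t + h k) - g t) /\<^sub>R h k) \<longlonglongrightarrow> vector_derivative g (at t)"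
      using h(1) h0 by (rule has_vector_derivative_quotient_seq)
    then show ?thesis using False by (simp add: f_def d_def)
  qed (simp add: f_def d_def)
  have limI: "I \<longlonglongrightarrow> g b - g a"
    unfolding I_def by (intro tendsto_diff has_vector_derivative_quotient_seq G' h0 h(1)) (use ab in auto)
  have di: "d integrable_on {a..b}" "(\<lambda>k. integral {a..b} (f k)) \<longlonglongrightarrow> integral {a..b} d"
    by (rule dominated_convergence[where h = "\<lambda>_. L" and f = f]; use fI bd lim in \<open>auto simp: has_integral_integrable intro: has_integral_integrable\<close>)+
  then have "integral {a..b} d = g b - g a"
    using limI integral_unique[OF fI] by (auto intro: LIMSEQ_unique)
  then have "(d has_integral (g b - g a)) {a..b}" using di by (metis integrable_integral)
  then show ?thesis by (rule has_integral_spike[OF negN, rotated]) (auto simp: d_def)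
qed

text \<open>Clamping the parameter extends a path on [0,1] to the whole line with the same Lipschitz
  constant. At interior parameters the derivatives are unchanged, so the results on the line carry
  over to paths.\<close>

lemma vector_derivative_clamp:
  fixes g :: "real \<Rightarrow> complex"
  assumes "t \<in> {0<..<1}"
  shows "(g has_vector_derivative v) (at t within {0..1}) \<longleftrightarrow>
         ((\<lambda>x. g (max 0 (min 1 x))) has_vector_derivative v) (at t)"
proof -
  have "at t within {0..1} = at t" using assms by (simp add: at_within_Icc_at)
  moreover have "(g has_vector_derivative v) (at t) \<longleftrightarrow>
         ((\<lambda>x. g (max 0 (min 1 x))) has_vector_derivative v) (at t)"
    using has_vector_derivative_transform_within_open[of g v t "{0<..<1}" "\<lambda>x. g (max 0 (min 1 x))"]
          has_vector_derivative_transform_within_open[of "\<lambda>x. g (max 0 (min 1 x))" v t "{0<..<1}" g] assms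
    by auto
  ultimately show ?thesis by simp
qed

lemma lipschitz_clamp:
  fixes g :: "real \<Rightarrow> complex"
  assumes "L-lipschitz_on {0..1} g"
  shows "L-lipschitz_on UNIV (\<lambda>x. g (max 0 (min 1 x)))"
  unfolding lipschitz_on_def
proof (intro conjI ballI)
  show "0 \<le> L" using assms by (rule lipschitz_on_nonneg)
  fix x y :: real
  have "dist (g (max 0 (min 1 x))) (g (max 0 (min 1 y))) \<le> L * dist (max 0 (min 1 x)) (max 0 (min 1 y))"
    by (rule lipschitz_onD[OF assms]) auto
  also have "\<dots> \<le> L * dist x y"
    using lipschitz_on_nonneg[OF assms] by (intro mult_left_mono) (auto simp: dist_real_def)
  finally show "dist (g (max 0 (min 1 x))) (g (max 0 (min 1 y))) \<le> L * dist x y" .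
qed

lemma AE_vector_derivative_lipschitz:
  fixes g :: "real \<Rightarrow> complex"
  assumes "L-lipschitz_on {0..1} g"
  shows "negligible {t \<in> {0..1}. \<not> (g has_vector_derivative vector_derivative g (at t within {0..1})) (at t within {0..1})}"
proof -
  let ?G = "\<lambda>x. g (max 0 (min 1 x))"
  have "negligible ({t. \<not> ?G differentiable at t} \<union> {0, 1})"
    using AE_differentiable_lipschitz_complex[OF lipschitz_clamp[OF assms]] by simp
  moreover have "(g has_vector_derivative vector_derivative g (at t within {0..1})) (at t within {0..1})"
    if "?G differentiable at t" "t \<in> {0<..<1}" for t
  proof -
    have "(?G has_vector_derivative vector_derivative ?G (at t)) (at t)" using that vector_derivative_works by blast
    then have "(g has_vector_derivative vector_derivative ?G (at t)) (at t within {0..1})"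
      using vector_derivative_clamp[OF that(2)] by blast
    then show ?thesis using vector_derivative_works differentiableI_vector by blast
  qed
  ultimately show ?thesis by (elim negligible_subset) force
qed

lemma lipschitz_FTC:
  fixes g :: "real \<Rightarrow> complex"
  assumes "L-lipschitz_on {0..1} g"
  shows "((\<lambda>t. vector_derivative g (at t within {0..1})) has_integral (g 1 - g 0)) {0..1}"
proof -
  let ?G = "\<lambda>x. g (max 0 (min 1 x))"
  have "((\<lambda>t. vector_derivative ?G (at t)) has_integral (?G 1 - ?G 0)) {0..1}"
    by (rule lipschitz_FTC_real_line[OF lipschitz_clamp[OF assms]]) simp
  then have "((\<lambda>t. vector_derivative g (at t within {0..1})) has_integral (?G 1 - ?G 0)) {0..1}"
  proof (rule has_integral_spike[of "{0,1}", rotated 2])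
    fix t :: real assume "t \<in> {0..1} - {0, 1}"
    then have "t \<in> {0<..<1}" by auto
    then show "vector_derivative g (at t within {0..1}) = vector_derivative ?G (at t)"
      unfolding vector_derivative_def by (simp only: vector_derivative_clamp)
  qed simp
  then show ?thesis by simp
qed

text \<open>\<open>K\<close> may fail to be convex, so the mean value inequality is used only for
  points at distance at most \<open>e\<close>, within a ball contained in the compact enlargement
  \<open>?V\<close>. More distant pairs are covered by the bound 2 C = (2 C / e) e on the
  values.\<close>

lemma holomorphic_lipschitz_on_compact:
  assumes F: "F holomorphic_on U" and U: "open U" and K: "compact K" "K \<subseteq> U"
  obtains M where "M \<ge> 0" "\<And>x y. x \<in> K \<Longrightarrow> y \<in> K \<Longrightarrow> cmod (F x - F y) \<le> M * cmod (x - y)"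
proof -
  obtain e where e: "e > 0" "(\<Union>x\<in>K. cball x e) \<subseteq> U"
    using compact_subset_open_imp_cball_epsilon_subset[OF K(1) U K(2)] by blast
  let ?V = "\<Union>x\<in>K. cball x e"
  have cV: "compact ?V" by (rule compact_minkowski_sum_cball[OF K(1)])
  have "continuous_on ?V (deriv F)"
    using holomorphic_deriv[OF F U] e(2) by (meson holomorphic_on_imp_continuous_on continuous_on_subset)
  then obtain B where B: "B > 0" "\<And>x. x \<in> ?V \<Longrightarrow> cmod (deriv F x) \<le> B"
    using compact_imp_bounded[OF compact_continuous_image[OF _ cV]] by (force simp: bounded_pos)
  have "continuous_on K F" using F K(2) by (meson holomorphic_on_imp_continuous_on continuous_on_subset)
  then obtain C where C: "C > 0" "\<And>x. x \<in> K \<Longrightarrow> cmod (F x) \<le> C"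
    using compact_imp_bounded[OF compact_continuous_image[OF _ K(1)]] by (force simp: bounded_pos)
  show ?thesis
  proof (rule that[of "B + 2 * C / e"])
    show "0 \<le> B + 2 * C / e" using B C e by simp
    fix x y assume xy: "x \<in> K" "y \<in> K"
    show "cmod (F x - F y) \<le> (B + 2 * C / e) * cmod (x - y)"
    proof (cases "cmod (x - y) \<le> e")
      case True
      have sub: "cball x e \<subseteq> ?V" using xy by blast
      have "cmod (F x - F y) \<le> B * cmod (x - y)"
      proof (rule field_differentiable_bound[of "cball x e" F "deriv F"])
        fix z assume z: "z \<in> cball x e"
        then show "(F has_field_derivative deriv F z) (at z within cball x e)"
          using F U e(2) sub by (meson holomorphic_derivI subsetD)
        show "cmod (deriv F z) \<le> B" using B z sub by blast
      qed (use True e in \<open>auto simp: dist_norm norm_minus_commute\<close>)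
      also have "\<dots> \<le> (B + 2 * C / e) * cmod (x - y)" using C e by (intro mult_right_mono) auto
      finally show ?thesis .
    next
      case False
      have "cmod (F x - F y) \<le> 2 * C" using norm_triangle_ineq4[of "F x" "F y"] C(2)[OF xy(1)] C(2)[OF xy(2)] by linarith
      also have "\<dots> = (2 * C / e) * e" using e by simp
      also have "\<dots> \<le> (B + 2 * C / e) * cmod (x - y)" using B C e False by (intro mult_mono) auto
      finally show ?thesis .
    qed
  qed
qed

text \<open>\<open>F \<circ> g\<close> is Lipschitz because \<open>F\<close> is Lipschitz on the
  compact image of \<open>g\<close>. The chain rule holds wherever \<open>g\<close> is
  differentiable, and the fundamental theorem for \<open>F \<circ> g\<close> gives the
  value.\<close>

lemma has_contour_integral_primitive_lipschitz:
  assumes g: "L-lipschitz_on {0..1} g" and im: "path_image g \<subseteq> U" and U: "open U"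
    and F: "\<And>z. z \<in> U \<Longrightarrow> (F has_field_derivative f z) (at z)"
  shows "(f has_contour_integral (F (pathfinish g) - F (pathstart g))) g"
proof -
  have contg: "continuous_on {0..1} g" using g by (rule lipschitz_on_continuous_on)
  have K: "compact (path_image g)" using contg by (simp add: path_def compact_path_image)
  have holF: "F holomorphic_on U" using F U by (auto simp: holomorphic_on_open)
  obtain M where M: "M \<ge> 0" "\<And>x y. x \<in> path_image g \<Longrightarrow> y \<in> path_image g \<Longrightarrow> cmod (F x - F y) \<le> M * cmod (x - y)"
    using holomorphic_lipschitz_on_compact[OF holF U K im] by blast
  have lip: "(M * L)-lipschitz_on {0..1} (F \<circ> g)"
    unfolding lipschitz_on_def
  proof (intro conjI ballI)
    show "0 \<le> M * L" using M lipschitz_on_nonneg[OF g] by simp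
    fix x y :: real assume xy: "x \<in> {0..1}" "y \<in> {0..1}"
    have "dist ((F \<circ> g) x) ((F \<circ> g) y) \<le> M * dist (g x) (g y)"
      using M(2)[of "g x" "g y"] xy by (auto simp: dist_norm path_image_def)
    also have "\<dots> \<le> M * (L * dist x y)" using lipschitz_onD[OF g xy] M by (intro mult_left_mono)
    finally show "dist ((F \<circ> g) x) ((F \<circ> g) y) \<le> M * L * dist x y" by simp
  qed
  let ?N = "{t \<in> {0..1}. \<not> (g has_vector_derivative vector_derivative g (at t within {0..1})) (at t within {0..1})}"
  have "((\<lambda>t. f (g t) * vector_derivative g (at t within {0..1})) has_integral ((F \<circ> g) 1 - (F \<circ> g) 0)) {0..1}"
  proof (rule has_integral_spike[OF AE_vector_derivative_lipschitz[OF g] _ lipschitz_FTC[OF lip]])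
    fix t assume t: "t \<in> {0..1} - ?N"
    then have d: "(g has_vector_derivative vector_derivative g (at t within {0..1})) (at t within {0..1})" by blast
    have "g t \<in> U" using t im by (auto simp: path_image_def)
    then have "((F \<circ> g) has_vector_derivative (vector_derivative g (at t within {0..1}) * f (g t))) (at t within {0..1})"
      by (rule field_vector_diff_chain_within[OF d has_field_derivative_at_within[OF F]])
    then have "vector_derivative (F \<circ> g) (at t within {0..1}) = vector_derivative g (at t within {0..1}) * f (g t)"
      using t by (intro vector_derivative_within_closed_interval) auto
    then show "f (g t) * vector_derivative g (at t within {0..1}) = vector_derivative (F \<circ> g) (at t within {0..1})"
      by simp
  qed
  then show ?thesis by (simp add: has_contour_integral_def pathfinish_def pathstart_def)
qed

text \<open>Local inverse estimate for exp at 0: the derivative of exp v - v has modulus at most 1/2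
  on the disc of radius 1/4. It converts increments of a path into increments of its
  logarithm.\<close>

lemma norm_exp_minus_1_ge:
  fixes v :: complex
  assumes v: "cmod v \<le> 1/4"
  shows "cmod v \<le> 4 * cmod (exp v - 1)"
proof -
  have b1: "cmod (exp w - 1) \<le> 2 * cmod w" if "cmod w \<le> 1/4" for w
  proof -
    have "cmod (exp w - exp 0) \<le> 2 * cmod (w - 0)"
    proof (rule field_differentiable_bound[of "cball 0 (1/2)" exp exp])
      fix z :: complex assume "z \<in> cball 0 (1/2)"
      then show "cmod (exp z) \<le> 2" using exp_bound_half[of z] by simp
    qed (use that in \<open>auto intro!: derivative_eq_intros\<close>)
    then show ?thesis by simp
  qed
  have "cmod ((exp v - v) - (exp 0 - 0)) \<le> (1/2) * cmod (v - 0)"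
  proof (rule field_differentiable_bound[of "cball 0 (1/4)" "\<lambda>z. exp z - z" "\<lambda>z. exp z - 1"])
    fix z :: complex assume "z \<in> cball 0 (1/4)"
    then show "cmod (exp z - 1) \<le> 1/2" using b1[of z] by simp
  qed (use v in \<open>auto intro!: derivative_eq_intros\<close>)
  then have "cmod ((exp v - 1) - v) \<le> cmod v / 2" by (simp add: algebra_simps)
  then show ?thesis using norm_triangle_ineq2[of v "exp v - 1"] norm_minus_commute[of v "exp v - 1"] norm_ge_zero[of v] by linarith
qed

text \<open>A continuous logarithm \<open>q\<close> of \<open>g - z\<close> is again Lipschitz, so
  the integral of g'/(g - z) = q' is the increment of \<open>q\<close>, that is, the winding number
  up to the factor 2 pi i.\<close>

lemma has_contour_integral_winding_lipschitz:
  assumes g: "L-lipschitz_on {0..1} g" and z: "z \<notin> path_image g"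
  shows "((\<lambda>w. 1 / (w - z)) has_contour_integral (2 * of_real pi * \<i> * winding_number g z)) g"
proof -
  have contg: "continuous_on {0..1} g" using g by (rule lipschitz_on_continuous_on)
  then have pg: "path g" by (simp add: path_def)
  obtain q where q: "path q" "pathfinish q - pathstart q = 2 * of_real pi * \<i> * winding_number g z"
    "\<And>t. t \<in> {0..1} \<Longrightarrow> g t = z + exp (q t)"
    using winding_number_as_continuous_log[OF pg z] by blast
  have contq: "continuous_on {0..1} q" using q(1) by (simp add: path_def)
  obtain m where m: "m > 0" "\<And>t. t \<in> {0..1} \<Longrightarrow> cmod (g t - z) \<ge> m"
  proof -
    have "closed (path_image g)" using pg by (simp add: closed_path_image)
    then obtain m where "m > 0" "\<forall>w\<in>path_image g. m \<le> dist z w"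
      using separate_point_closed z by blast
    then show ?thesis using that[of m] by (auto simp: path_image_def dist_norm norm_minus_commute)
  qed
  have uq: "uniformly_continuous_on {0..1} q" using contq by (intro compact_uniformly_continuous) auto
  \<comment> \<open>Below the scale \<open>d\<close> the increments of \<open>q\<close> stay within
    the radius 1/4 on which exp can be inverted; beyond it the bound \<open>B\<close> on
    \<open>q\<close> suffices.\<close>
  obtain d where d: "d > 0" "\<And>s t. s \<in> {0..1} \<Longrightarrow> t \<in> {0..1} \<Longrightarrow> dist s t < d \<Longrightarrow> dist (q s) (q t) < 1/4"
    by (rule uniformly_continuous_onE[OF uq, of "1/4"]) (auto simp: dist_commute)
  have "bounded (q ` {0..1})" using contq by (intro compact_imp_bounded compact_continuous_image) auto
  then obtain B where B: "B > 0" "\<And>t. t \<in> {0..1} \<Longrightarrow> cmod (q t) \<le> B" by (force simp: bounded_pos)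
  have L0: "L \<ge> 0" using g by (rule lipschitz_on_nonneg)
  have lip: "(4 * L / m + 2 * B / d)-lipschitz_on {0..1} q"
    unfolding lipschitz_on_def
  proof (intro conjI ballI)
    show "0 \<le> 4 * L / m + 2 * B / d" using m B d L0 by simp
    fix s t :: real assume st: "s \<in> {0..1}" "t \<in> {0..1}"
    show "dist (q s) (q t) \<le> (4 * L / m + 2 * B / d) * dist s t"
    proof (cases "dist s t < d")
      case True
      then have "cmod (q s - q t) \<le> 1/4" using d(2)[OF st True] by (simp add: dist_norm)
      then have "cmod (q s - q t) \<le> 4 * cmod (exp (q s - q t) - 1)" by (rule norm_exp_minus_1_ge)
      also have "exp (q s - q t) - 1 = (g s - g t) / (g t - z)"
        using q(3)[OF st(1)] q(3)[OF st(2)] by (simp add: exp_diff field_simps)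
      also have "4 * cmod ((g s - g t) / (g t - z)) \<le> 4 * ((L * dist s t) / m)"
        unfolding norm_divide
        using lipschitz_onD[OF g st] m(2)[OF st(2)] m(1) L0
        by (intro mult_left_mono frac_le) (auto simp: dist_norm)
      also have "\<dots> = (4 * L / m) * dist s t" by simp
      also have "\<dots> \<le> (4 * L / m + 2 * B / d) * dist s t" using B d by (intro mult_right_mono) auto
      finally show ?thesis by (simp add: dist_norm)
    next
      case False
      have "dist (q s) (q t) \<le> 2 * B"
        using norm_triangle_ineq4[of "q s" "q t"] B(2)[OF st(1)] B(2)[OF st(2)] unfolding dist_norm by linarith
      also have "\<dots> = (2 * B / d) * d" using d by simp
      also have "\<dots> \<le> (4 * L / m + 2 * B / d) * dist s t" using B d m L0 False by (intro mult_mono) auto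
      finally show ?thesis .
    qed
  qed
  let ?N = "{t \<in> {0..1}. \<not> (q has_vector_derivative vector_derivative q (at t within {0..1})) (at t within {0..1})}"
  have "((\<lambda>t. 1 / (g t - z) * vector_derivative g (at t within {0..1})) has_integral (q 1 - q 0)) {0..1}"
  proof (rule has_integral_spike[OF AE_vector_derivative_lipschitz[OF lip] _ lipschitz_FTC[OF lip]])
    fix t assume t: "t \<in> {0..1} - ?N"
    then have d: "(q has_vector_derivative vector_derivative q (at t within {0..1})) (at t within {0..1})" by blast
    have "(((\<lambda>w. z + exp w) \<circ> q) has_vector_derivative (vector_derivative q (at t within {0..1}) * exp (q t))) (at t within {0..1})"
      by (rule field_vector_diff_chain_within[OF d]) (auto intro!: derivative_eq_intros)
    then have "(g has_vector_derivative (vector_derivative q (at t within {0..1}) * exp (q t))) (at t within {0..1})"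
      by (rule has_vector_derivative_transform[rotated 2]) (use t q(3) in auto)
    then have "vector_derivative g (at t within {0..1}) = vector_derivative q (at t within {0..1}) * exp (q t)"
      using t by (intro vector_derivative_within_closed_interval) auto
    then show "1 / (g t - z) * vector_derivative g (at t within {0..1}) = vector_derivative q (at t within {0..1})"
      using t q(3)[of t] by simp
  qed
  then show ?thesis using q(2) by (simp add: has_contour_integral_def pathfinish_def pathstart_def)
qed

section \<open>Contour integrals of rational functions along Lipschitz cycles\<close>

definition closed_lipschitz :: "(real \<Rightarrow> complex) \<Rightarrow> bool" where
  "closed_lipschitz g \<longleftrightarrow> pathfinish g = pathstart g \<and> (\<exists>L. L-lipschitz_on {0..1} g)"

lemma closed_lipschitz_contour_primitive:
  assumes "closed_lipschitz g" "path_image g \<subseteq> U" "open U"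
    and "\<And>z. z \<in> U \<Longrightarrow> (F has_field_derivative f z) (at z)"
  shows "(f has_contour_integral 0) g"
proof -
  obtain L where "L-lipschitz_on {0..1} g" "pathfinish g = pathstart g"
    using assms(1) by (auto simp: closed_lipschitz_def)
  then show ?thesis using has_contour_integral_primitive_lipschitz[of L g U F f] assms by simp
qed

lemma closed_lipschitz_Cauchy_convex:
  assumes "closed_lipschitz g" "path_image g \<subseteq> U" "open U" "convex U" "f holomorphic_on U"
  shows "(f has_contour_integral 0) g"
proof -
  obtain F where "\<And>z. z \<in> U \<Longrightarrow> (F has_field_derivative f z) (at z within U)"
    using holomorphic_convex_primitive'[OF assms(4,3,5)] by blast
  then have "\<And>z. z \<in> U \<Longrightarrow> (F has_field_derivative f z) (at z)"
    using at_within_open[OF _ assms(3)] by metis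
  then show ?thesis by (rule closed_lipschitz_contour_primitive[OF assms(1,2,3)])
qed

lemma closed_lipschitz_winding:
  assumes "closed_lipschitz g" "z \<notin> path_image g"
  shows "((\<lambda>w. c / (w - z)) has_contour_integral (2 * of_real pi * \<i> * (c * winding_number g z))) g"
proof -
  obtain L where L: "L-lipschitz_on {0..1} g"
    using assms(1) by (auto simp: closed_lipschitz_def)
  show ?thesis
    using has_contour_integral_lmul[OF has_contour_integral_winding_lipschitz[OF L assms(2)], of c]
    by (simp add: mult_ac)
qed

text \<open>Pure powers of order at least two have a single-valued primitive and hence no
  residue.\<close>

lemma closed_lipschitz_power:
  assumes "closed_lipschitz g" "z \<notin> path_image g" "k \<ge> 2"
  shows "((\<lambda>w. c / (w - z) ^ k) has_contour_integral 0) g"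
proof -
  obtain m where k: "k = Suc (Suc m)" using assms(3) by (metis add_2_eq_Suc le_Suc_ex)
  have "((\<lambda>w. (- c / of_nat (Suc m)) * inverse ((w - z) ^ Suc m)) has_field_derivative c / (w - z) ^ k) (at w)"
    if w: "w \<in> - {z}" for w
  proof -
    have nz: "w - z \<noteq> 0" using w by simp
    have "((\<lambda>w. (- c / of_nat (Suc m)) * inverse ((w - z) ^ Suc m)) has_field_derivative
         (- c / of_nat (Suc m)) * (- (inverse ((w - z) ^ Suc m) * (of_nat (Suc m) * (w - z) ^ m) * inverse ((w - z) ^ Suc m)))) (at w)"
      using nz by (auto intro!: derivative_eq_intros simp del: power_Suc of_nat_Suc)
    moreover have "(- c / n) * (- (inverse (v ^ Suc m) * (n * v ^ m) * inverse (v ^ Suc m))) = c / v ^ k"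
      if "v \<noteq> 0" "n \<noteq> 0" for v n :: complex
      using that unfolding k by (simp add: field_simps)
    ultimately show ?thesis using nz of_nat_neq_0 by metis
  qed
  then show ?thesis
    by (rule closed_lipschitz_contour_primitive[OF assms(1), of "- {z}", rotated 2]) (use assms(2) in auto)
qed

text \<open>Here \<open>c a\<close> is the residue at \<open>a\<close>; the last clause identifies the sum of all residues with minus the
  residue at infinity.\<close>

lemma rational_contour_integral_lipschitz:
  fixes q s :: "complex poly"
  assumes "q \<noteq> 0"
  shows "\<exists>c. (\<forall>g. closed_lipschitz g \<longrightarrow> (\<forall>w. poly q w = 0 \<longrightarrow> w \<notin> path_image g) \<longrightarrow>
            ((\<lambda>w. poly s w / poly q w) has_contour_integral
              (2 * of_real pi * \<i> * (\<Sum>a | poly q a = 0. c a * winding_number g a))) g) \<and>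
         ((\<forall>i\<ge>degree q. coeff s i = 0) \<longrightarrow> (\<Sum>a | poly q a = 0. c a) = coeff s (degree q - 1) / lead_coeff q)"
  using assms
proof (induction "degree q" arbitrary: q s rule: less_induct)
  case (less q s)
  show ?case
  proof (cases "degree q = 0")
    case True
    then obtain b where b: "q = [:b:]" by (metis degree_eq_zeroE)
    with less.prems have b0: "b \<noteq> 0" by simp
    have "((\<lambda>w. poly s w / poly q w) has_contour_integral 0) g" if "closed_lipschitz g" for g
      by (rule closed_lipschitz_Cauchy_convex[OF that, of UNIV])
         (use b0 in \<open>auto simp: b intro!: holomorphic_intros\<close>)
    moreover have "{a. poly q a = 0} = {}" using b0 by (simp add: b)
    ultimately show ?thesis using True by simp
  next
    case False
    then obtain a where a: "poly q a = 0"
      using alg_closed_imp_poly_has_root[of q] by auto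
    define k where "k = order a q"
    have k: "k \<ge> 1" using a less.prems by (simp add: k_def order_root Suc_le_eq)
    obtain q1 where q1: "q = [:- a, 1:] ^ k * q1" "\<not> [:- a, 1:] dvd q1"
      using order_decomp[OF less.prems, of a] by (auto simp: k_def)
    have q1a: "poly q1 a \<noteq> 0" using q1(2) by (simp add: poly_eq_0_iff_dvd)
    have q10: "q1 \<noteq> 0" using q1a by auto
    \<comment> \<open>Coefficient of the leading polar term at \<open>a\<close>: subtracting
      \<kappa> / (w - a)^k makes the numerator divisible by w - a, so the remaining quotient has the
      denominator \<open>q'\<close>, of degree one less.\<close>
    define \<kappa> where "\<kappa> = poly s a / poly q1 a"
    have "poly (s - smult \<kappa> q1) a = 0" using q1a by (simp add: \<kappa>_def)
    then obtain s1 where s1: "s - smult \<kappa> q1 = [:- a, 1:] * s1" unfolding poly_eq_0_iff_dvd dvd_def by blast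
    define q' where "q' = [:- a, 1:] ^ (k - 1) * q1"
    have q'0: "q' \<noteq> 0" using q10 by (simp add: q'_def)
    have qq': "q = [:- a, 1:] * q'" using k unfolding q1(1) q'_def by (cases k) (auto simp: mult_ac)
    have deg: "degree q = Suc (degree q')" using q'0 unfolding qq' by (subst degree_mult_eq) auto
    have degk: "degree q = k + degree q1" using q10 unfolding q1(1) by (subst degree_mult_eq) (auto simp: degree_power_eq)
    have lc: "lead_coeff q = lead_coeff q1" "lead_coeff q = lead_coeff q'"
      unfolding q1(1) q'_def by (simp_all add: lead_coeff_mult lead_coeff_power)
    obtain c' where c': "\<And>g. closed_lipschitz g \<Longrightarrow> (\<And>w. poly q' w = 0 \<Longrightarrow> w \<notin> path_image g) \<Longrightarrow>
            ((\<lambda>w. poly s1 w / poly q' w) has_contour_integral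
              (2 * of_real pi * \<i> * (\<Sum>a | poly q' a = 0. c' a * winding_number g a))) g"
       "(\<forall>i\<ge>degree q'. coeff s1 i = 0) \<Longrightarrow> (\<Sum>a | poly q' a = 0. c' a) = coeff s1 (degree q' - 1) / lead_coeff q'"
      using less.hyps[of q' s1] deg q'0 by auto
    \<comment> \<open>The polar term contributes a residue only if \<open>a\<close> is a simple root
      of \<open>q\<close>; for a multiple root, \<open>a\<close> is still a root of
      \<open>q'\<close> and its residue comes from the induction hypothesis.\<close>
    define c where "c = (\<lambda>b. (if poly q' b = 0 then c' b else 0) + (if b = a \<and> k = 1 then \<kappa> else 0))"
    have fin: "finite {b. poly q b = 0}" using less.prems by (rule poly_roots_finite)
    have sumc: "(\<Sum>b | poly q b = 0. c b * f b) = (\<Sum>b | poly q' b = 0. c' b * f b) + (if k = 1 then \<kappa> * f a else 0)" for f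
    proof -
      have "(\<Sum>b | poly q b = 0. c b * f b) = (\<Sum>b | poly q b = 0. (if poly q' b = 0 then c' b * f b else 0))
         + (\<Sum>b | poly q b = 0. (if b = a then (if k = 1 then \<kappa> * f a else 0) else 0))"
        unfolding c_def by (subst sum.distrib[symmetric]) (intro sum.cong, auto simp: algebra_simps)
      also have "(\<Sum>b | poly q b = 0. (if poly q' b = 0 then c' b * f b else 0)) = (\<Sum>b | poly q' b = 0. c' b * f b)"
        using fin by (intro sum.mono_neutral_cong_right) (auto simp: qq')
      also have "(\<Sum>b | poly q b = 0. (if b = a then (if k = 1 then \<kappa> * f a else 0) else 0)) = (if k = 1 then \<kappa> * f a else 0)"
        using fin a by (subst sum.delta) auto
      finally show ?thesis .
    qed
    have "((\<lambda>w. poly s w / poly q w) has_contour_integral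
              (2 * of_real pi * \<i> * (\<Sum>a | poly q a = 0. c a * winding_number g a))) g"
      if g: "closed_lipschitz g" "\<And>w. poly q w = 0 \<Longrightarrow> w \<notin> path_image g" for g
    proof -
      have ag: "a \<notin> path_image g" using g a by blast
      have 1: "((\<lambda>w. poly s1 w / poly q' w) has_contour_integral
              (2 * of_real pi * \<i> * (\<Sum>a | poly q' a = 0. c' a * winding_number g a))) g"
        by (rule c'(1)[OF g(1)]) (use g(2) in \<open>auto simp: qq'\<close>)
      have 2: "((\<lambda>w. \<kappa> / (w - a) ^ k) has_contour_integral
              (2 * of_real pi * \<i> * (if k = 1 then \<kappa> * winding_number g a else 0))) g"
      proof (cases "k = 1")
        case True
        then show ?thesis using closed_lipschitz_winding[OF g(1) ag, of \<kappa>] by simp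
      next
        case False
        then show ?thesis using closed_lipschitz_power[OF g(1) ag, of k \<kappa>] k by simp
      qed
      have "((\<lambda>w. poly s1 w / poly q' w + \<kappa> / (w - a) ^ k) has_contour_integral
              (2 * of_real pi * \<i> * (\<Sum>a | poly q a = 0. c a * winding_number g a))) g"
        using has_contour_integral_add[OF 1 2] unfolding sumc by (simp add: distrib_left)
      then show ?thesis
      proof (rule has_contour_integral_eq)
        fix w assume w: "w \<in> path_image g"
        then have nz: "poly q w \<noteq> 0" using g(2) by blast
        then have wa: "w \<noteq> a" "poly q' w \<noteq> 0" "poly q1 w \<noteq> 0" using a by (auto simp: qq' q'_def)
        have "poly s w = \<kappa> * poly q1 w + (w - a) * poly s1 w"
          using arg_cong[OF s1, of "\<lambda>p. poly p w"] by (simp add: algebra_simps)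
        moreover have "poly q w = (w - a) ^ k * poly q1 w" using arg_cong[OF q1(1), of "\<lambda>p. poly p w"] by simp
        moreover have "poly q w = (w - a) * poly q' w" using arg_cong[OF qq', of "\<lambda>p. poly p w"] by (simp add: algebra_simps)
        ultimately have "poly s w / poly q w = \<kappa> * poly q1 w / ((w - a) ^ k * poly q1 w) + (w - a) * poly s1 w / ((w - a) * poly q' w)"
          by (metis add_divide_distrib)
        then show "poly s1 w / poly q' w + \<kappa> / (w - a) ^ k = poly s w / poly q w"
          using wa by simp
      qed
    qed
    moreover have "(\<Sum>a | poly q a = 0. c a) = coeff s (degree q - 1) / lead_coeff q" if d: "\<forall>i\<ge>degree q. coeff s i = 0"
    proof -
      have s_eq: "s = smult \<kappa> q1 + pCons 0 s1 - smult a s1" using s1 by (simp add: algebra_simps)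
      have q1d: "coeff q1 i = 0" if "i \<ge> degree q" for i using that degk k by (intro coeff_eq_0) simp
      \<comment> \<open>Comparing coefficients shows that the reduced quotient is again proper, and
        that its top coefficient differs from that of \<open>s\<close> by \<kappa> times the leading
        coefficient of \<open>q\<close> if k = 1, and not at all otherwise.\<close>
      have rec: "coeff s (Suc i) = \<kappa> * coeff q1 (Suc i) + coeff s1 i - a * coeff s1 (Suc i)" for i
        unfolding s_eq by simp
      have s1d: "degree s1 < degree q' \<or> s1 = 0"
      proof (rule ccontr)
        assume "\<not> ?thesis"
        then have n: "degree s1 \<ge> degree q'" "s1 \<noteq> 0" by auto
        have "coeff s (Suc (degree s1)) = coeff s1 (degree s1)"
          using rec[of "degree s1"] q1d[of "Suc (degree s1)"] n deg by (simp add: coeff_eq_0)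
        moreover have "coeff s (Suc (degree s1)) = 0" using d n deg by simp
        ultimately show False using n by simp
      qed
      then have s1z: "\<forall>i\<ge>degree q'. coeff s1 i = 0" by (auto simp: coeff_eq_0)
      have "(\<Sum>a | poly q a = 0. c a) = coeff s1 (degree q' - 1) / lead_coeff q' + (if k = 1 then \<kappa> else 0)"
        using sumc[of "\<lambda>_. 1"] c'(2)[OF s1z] by simp
      also have "\<dots> = coeff s (degree q - 1) / lead_coeff q"
      proof (cases "degree q' = 0")
        case True
        then have "s1 = 0" using s1d by auto
        moreover have "k = 1" "degree q1 = 0" using True deg degk k by auto
        moreover from this have "coeff q1 0 \<noteq> 0" using leading_coeff_neq_0[OF q10] by simp
        ultimately show ?thesis using True deg q10 lc by (simp add: s_eq)
      next
        case False
        then obtain m where m: "degree q' = Suc m" using not0_implies_Suc by blast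
        have cs: "coeff s (Suc m) = \<kappa> * coeff q1 (Suc m) + coeff s1 m" using rec[of m] s1z m by simp
        have cq: "coeff q1 (Suc m) = (if k = 1 then lead_coeff q else 0)"
          using degk deg m k lc by (auto intro!: coeff_eq_0)
        have "lead_coeff q \<noteq> 0" using less.prems by simp
        then show ?thesis using lc by (simp add: m deg cs cq field_simps)
      qed
      finally show ?thesis .
    qed
    ultimately show ?thesis by blast
  qed
qed

text \<open>The cycle surrounds all poles equally often, n0 times, so only the sum of the residues
  of s/q matters, where p/q - \<kappa> = (w - \<xi>) s/q and \<kappa> is the value at \<xi>. For
  proper p/q that sum is -\<kappa>, read off from the top coefficients. For n0 = 0 it is multiplied
  by zero, which covers the improper \<open>h\<close> allowed for unbounded domains.\<close>

lemma rational_cauchy_cycle: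
  fixes p q :: "complex poly"
  assumes q: "q \<noteq> 0" and G: "\<And>g. g \<in> set \<Gamma> \<Longrightarrow> closed_lipschitz g"
    and av: "\<And>g w. g \<in> set \<Gamma> \<Longrightarrow> poly q w = 0 \<or> w = \<xi> \<Longrightarrow> w \<notin> path_image g"
    and n0: "\<And>a. poly q a = 0 \<Longrightarrow> (\<Sum>g\<leftarrow>\<Gamma>. winding_number g a) = n0"
    and n1: "(\<Sum>g\<leftarrow>\<Gamma>. winding_number g \<xi>) = n1"
    and \<xi>: "poly q \<xi> \<noteq> 0"
    and deg: "n0 = 0 \<or> p = 0 \<or> degree p < degree q"
    and f: "\<And>g w. g \<in> set \<Gamma> \<Longrightarrow> w \<in> path_image g \<Longrightarrow> f w = poly p w / poly q w / (w - \<xi>)"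
  shows "(\<Sum>g\<leftarrow>\<Gamma>. contour_integral g f) = 2 * of_real pi * \<i> * ((n1 - n0) * (poly p \<xi> / poly q \<xi>))"
    and "\<forall>g\<in>set \<Gamma>. f contour_integrable_on g"
proof -
  define \<kappa> where "\<kappa> = poly p \<xi> / poly q \<xi>"
  have "poly (p - smult \<kappa> q) \<xi> = 0" using \<xi> by (simp add: \<kappa>_def)
  then obtain s where s: "p - smult \<kappa> q = [:- \<xi>, 1:] * s" unfolding poly_eq_0_iff_dvd dvd_def by blast
  obtain c where c: "\<And>g. closed_lipschitz g \<Longrightarrow> (\<And>w. poly q w = 0 \<Longrightarrow> w \<notin> path_image g) \<Longrightarrow>
            ((\<lambda>w. poly s w / poly q w) has_contour_integral
              (2 * of_real pi * \<i> * (\<Sum>a | poly q a = 0. c a * winding_number g a))) g"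
       "(\<forall>i\<ge>degree q. coeff s i = 0) \<Longrightarrow> (\<Sum>a | poly q a = 0. c a) = coeff s (degree q - 1) / lead_coeff q"
    using rational_contour_integral_lipschitz[OF q, of s] by auto
  let ?I = "\<lambda>g. 2 * of_real pi * \<i> * ((\<Sum>a | poly q a = 0. c a * winding_number g a) + \<kappa> * winding_number g \<xi>)"
  have hI: "(f has_contour_integral ?I g) g" if g: "g \<in> set \<Gamma>" for g
  proof -
    have "((\<lambda>w. poly s w / poly q w + \<kappa> / (w - \<xi>)) has_contour_integral ?I g) g"
      using has_contour_integral_add[OF c(1)[OF G[OF g]] closed_lipschitz_winding[OF G[OF g], of \<xi> \<kappa>]] av[OF g]
      by (simp add: distrib_left)
    then show ?thesis
    proof (rule has_contour_integral_eq)
      fix w assume w: "w \<in> path_image g"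
      then have nz: "poly q w \<noteq> 0" "w \<noteq> \<xi>" using av[OF g] by auto
      have "poly p w = \<kappa> * poly q w + (w - \<xi>) * poly s w"
        using arg_cong[OF s, of "\<lambda>p. poly p w"] by (simp add: algebra_simps)
      then show "poly s w / poly q w + \<kappa> / (w - \<xi>) = f w"
        using nz f[OF g w] by (simp add: field_simps)
    qed
  qed
  then show "\<forall>g\<in>set \<Gamma>. f contour_integrable_on g" by (auto simp: contour_integrable_on_def)
  have swap: "(\<Sum>g\<leftarrow>\<Gamma>'. ?I g) = 2 * of_real pi * \<i> * ((\<Sum>a | poly q a = 0. c a * (\<Sum>g\<leftarrow>\<Gamma>'. winding_number g a)) + \<kappa> * (\<Sum>g\<leftarrow>\<Gamma>'. winding_number g \<xi>))" for \<Gamma>'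
    by (induction \<Gamma>') (simp_all add: algebra_simps sum.distrib)
  have "(\<Sum>g\<leftarrow>\<Gamma>. contour_integral g f) = (\<Sum>g\<leftarrow>\<Gamma>. ?I g)"
    using hI by (intro arg_cong[of _ _ sum_list] map_cong) (auto intro: contour_integral_unique)
  also have "\<dots> = 2 * of_real pi * \<i> * (n0 * (\<Sum>a | poly q a = 0. c a) + \<kappa> * n1)"
    unfolding swap n1 using n0 by (simp add: sum_distrib_left mult.commute)
  also have "n0 * (\<Sum>a | poly q a = 0. c a) = - n0 * \<kappa>"
  proof (cases "n0 = 0")
    case False
    then have dp: "p = 0 \<or> degree p < degree q" using deg by blast
    have p0: "coeff p i = 0" if "i \<ge> degree q" for i using dp that by (auto intro: coeff_eq_0)
    have p_eq: "p = smult \<kappa> q + pCons 0 s - smult \<xi> s" using s by (simp add: algebra_simps)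
    have rec: "coeff p (Suc i) = \<kappa> * coeff q (Suc i) + coeff s i - \<xi> * coeff s (Suc i)" for i
      unfolding p_eq by simp
    have sd: "degree s < degree q \<or> s = 0"
    proof (rule ccontr)
      assume "\<not> ?thesis"
      then have n: "degree s \<ge> degree q" "s \<noteq> 0" by auto
      have "coeff p (Suc (degree s)) = coeff s (degree s)"
        using rec[of "degree s"] n by (simp add: coeff_eq_0)
      then show False using p0[of "Suc (degree s)"] n by simp
    qed
    then have sz: "\<forall>i\<ge>degree q. coeff s i = 0" by (auto simp: coeff_eq_0)
    have "(\<Sum>a | poly q a = 0. c a) = - \<kappa>"
    proof (cases "degree q")
      case 0
      then have "s = 0" "p = 0" using sd dp by auto
      then show ?thesis using c(2)[OF sz] by (simp add: \<kappa>_def)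
    next
      case (Suc m)
      have "0 = \<kappa> * lead_coeff q + coeff s m" using rec[of m] p0[of "Suc m"] sz Suc by simp
      then have "coeff s m = - \<kappa> * lead_coeff q" by (simp add: eq_neg_iff_add_eq_0 add.commute)
      moreover have "lead_coeff q \<noteq> 0" using q by simp
      ultimately show ?thesis using c(2)[OF sz] Suc by simp
    qed
    then show ?thesis by simp
  qed simp
  finally show "(\<Sum>g\<leftarrow>\<Gamma>. contour_integral g f) = 2 * of_real pi * \<i> * ((n1 - n0) * (poly p \<xi> / poly q \<xi>))"
    by (simp add: left_diff_distrib flip: \<kappa>_def)
qed

section \<open>The logarithmic potential of a domain\<close>

text \<open>The exponents lie on either side of the critical exponent \<open>-2\<close> of the plane, which makes
  \<open>sing_dom\<close> integrable both at 0 and at infinity; \<open>sing_line\<close> is a one-dimensional factor of a majorant.\<close>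

definition sing_dom :: "complex \<Rightarrow> real" where
  "sing_dom w = (if cmod w \<le> 1 then cmod w powr (-3/2) else cmod w powr (-9/4))"

definition sing_line :: "real \<Rightarrow> ennreal" where
  "sing_line t = (if t = 0 then \<infinity> else if \<bar>t\<bar> \<le> 1 then ennreal (\<bar>t\<bar> powr (-3/4)) else ennreal (\<bar>t\<bar> powr (-9/8)))"

lemma sing_dom_nonneg [simp]: "sing_dom w \<ge> 0"
  by (simp add: sing_dom_def)

lemma sing_line_pos: "sing_line t > 0"
  by (auto simp: sing_line_def)

lemma borel_measurable_sing_dom [measurable]: "sing_dom \<in> borel_measurable borel"
  unfolding sing_dom_def by measurable

lemma borel_measurable_sing_line [measurable]: "sing_line \<in> borel_measurable borel"
  unfolding sing_line_def by measurable

text \<open>Both coordinates are at most the modulus, so the exponent can be shared between them: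
  3/2 = 3/4 + 3/4 and 9/4 = 9/8 + 9/8. The product majorant reduces planar integrability to the
  line; on the axes it is infinite and the inequality is trivial.\<close>

lemma sing_dom_le: "ennreal (sing_dom w) \<le> sing_line (Re w) * sing_line (Im w)"
proof (cases "Re w = 0 \<or> Im w = 0")
  case True
  then have "sing_line (Re w) * sing_line (Im w) = \<infinity>"
    using sing_line_pos[of "Re w"] sing_line_pos[of "Im w"]
    by (auto simp: sing_line_def[of 0] ennreal_mult_eq_top_iff)
  then show ?thesis by simp
next
  case False
  define x y c where "x = \<bar>Re w\<bar>" and "y = \<bar>Im w\<bar>" and "c = cmod w"
  have pos: "x > 0" "y > 0" and le: "x \<le> c" "y \<le> c" and c: "c > 0"
    using False abs_Re_le_cmod[of w] abs_Im_le_cmod[of w] by (auto simp: x_def y_def c_def)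
  have mono: "c powr (-r) \<le> t powr (-r)" if "0 < t" "t \<le> c" "r \<ge> 0" for t r
    using that by (intro powr_mono2') auto
  have split: "c powr (-(r + s)) \<le> x powr (-r) * y powr (-s)" if "r \<ge> 0" "s \<ge> 0" for r s
  proof -
    have "c powr (-(r + s)) = c powr (-r) * c powr (-s)" by (simp only: powr_add[symmetric]) simp
    also have "\<dots> \<le> x powr (-r) * y powr (-s)" using pos le that by (intro mult_mono mono) auto
    finally show ?thesis .
  qed
  define sx where "sx = (\<lambda>t::real. if t \<le> 1 then t powr (-3/4) else t powr (-9/8))"
  have "sing_dom w \<le> sx x * sx y"
  proof (cases "x \<le> 1"; cases "y \<le> 1")
    assume 1: "x \<le> 1" "y \<le> 1"
    have "sing_dom w \<le> c powr (-3/2)"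
      unfolding sing_dom_def c_def[symmetric] by (auto intro: powr_mono)
    also have "\<dots> \<le> x powr (-3/4) * y powr (-3/4)" using split[of "3/4" "3/4"] by simp
    finally show ?thesis using 1 by (simp add: sx_def)
  next
    assume 1: "x \<le> 1" "\<not> y \<le> 1"
    have "sing_dom w = c powr (-9/4)" using 1 le by (simp add: sing_dom_def flip: c_def)
    \<comment> \<open>In the mixed cases the small coordinate may carry only 3/4; the large one
      receives the remaining 3/2, which is then weakened to 9/8.\<close>
    also have "\<dots> \<le> x powr (-3/4) * y powr (-3/2)" using split[of "3/4" "3/2"] by simp
    also have "\<dots> \<le> x powr (-3/4) * y powr (-9/8)" using 1 by (intro mult_left_mono powr_mono) auto
    finally show ?thesis using 1 by (simp add: sx_def)
  next
    assume 1: "\<not> x \<le> 1" "y \<le> 1"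
    have "sing_dom w = c powr (-9/4)" using 1 le by (simp add: sing_dom_def flip: c_def)
    also have "\<dots> \<le> x powr (-3/2) * y powr (-3/4)" using split[of "3/2" "3/4"] by simp
    also have "\<dots> \<le> x powr (-9/8) * y powr (-3/4)" using 1 by (intro mult_right_mono powr_mono) auto
    finally show ?thesis using 1 by (simp add: sx_def)
  next
    assume 1: "\<not> x \<le> 1" "\<not> y \<le> 1"
    have "sing_dom w = c powr (-9/4)" using 1 le by (simp add: sing_dom_def flip: c_def)
    also have "\<dots> \<le> x powr (-9/8) * y powr (-9/8)" using split[of "9/8" "9/8"] by simp
    finally show ?thesis using 1 by (simp add: sx_def)
  qed
  moreover have "sing_line (Re w) = ennreal (sx x)" "sing_line (Im w) = ennreal (sx y)"
    using False by (auto simp: sing_line_def sx_def x_def y_def)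
  ultimately show ?thesis by (simp add: sx_def flip: ennreal_mult)
qed

text \<open>3/4 < 1 gives integrability at 0 and 9/8 > 1 at infinity; the point 0, where
  \<open>sing_line\<close> is infinite, has measure zero.\<close>

lemma sing_line_integral: "(\<integral>\<^sup>+t. sing_line t \<partial>lborel) < \<infinity>"
proof -
  define s1 where "s1 = (\<lambda>t::real. ennreal (t powr (-3/4)) * indicator {0..1} t + ennreal (t powr (-9/8)) * indicator {1..} t)"
  have [measurable]: "s1 \<in> borel_measurable borel" unfolding s1_def by measurable
  have i1: "(\<integral>\<^sup>+t. ennreal (t powr (-3/4)) * indicator {0..1} t \<partial>lborel) < \<infinity>"
    using nn_integral_has_integral_lebesgue'[OF _ has_integral_powr_from_0[of "-3/4" 1]]
    by (simp add: nn_integral_completion)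
  have i2: "(\<integral>\<^sup>+t. ennreal (t powr (-9/8)) * indicator {1..} t \<partial>lborel) < \<infinity>"
    using nn_integral_has_integral_lebesgue'[OF _ has_integral_powr_to_inf[of "-9/8" 1]]
    by (simp add: nn_integral_completion)
  have s1: "(\<integral>\<^sup>+t. s1 t \<partial>lborel) < \<infinity>"
    unfolding s1_def using i1 i2 by (subst nn_integral_add) auto
  have "(\<integral>\<^sup>+t. s1 (0 + (-1) * t) \<partial>lborel) < \<infinity>"
    using s1 nn_integral_real_affine[of s1 "-1" 0] by simp
  then have s2: "(\<integral>\<^sup>+t. s1 (- t) \<partial>lborel) < \<infinity>" by simp
  have "(\<integral>\<^sup>+t. sing_line t \<partial>lborel) \<le> (\<integral>\<^sup>+t. s1 t + s1 (- t) \<partial>lborel)"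
  proof (rule nn_integral_mono_AE)
    have "AE t in lborel. t \<noteq> (0::real)" by (rule AE_lborel_singleton)
    then show "AE t in lborel. sing_line t \<le> s1 t + s1 (- t)"
      by eventually_elim (auto simp: sing_line_def s1_def abs_if indicator_def)
  qed
  also have "\<dots> < \<infinity>" using s1 s2 by (subst nn_integral_add) auto
  finally show ?thesis .
qed

definition sing_mass :: real where "sing_mass = enn2real (\<integral>\<^sup>+w. ennreal (sing_dom w) \<partial>lborel)"

lemma sing_dom_integral: "(\<integral>\<^sup>+w. ennreal (sing_dom w) \<partial>lborel) = ennreal sing_mass"
proof -
  have "(\<integral>\<^sup>+w. ennreal (sing_dom w) \<partial>lborel) \<le> (\<integral>\<^sup>+w. (\<Prod>b\<in>Basis. sing_line (w \<bullet> b)) \<partial>(lborel :: complex measure))"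
    by (intro nn_integral_mono) (use sing_dom_le in \<open>auto simp: Basis_complex_def inner_complex_def\<close>)
  also have "\<dots> = (\<Prod>b\<in>(Basis::complex set). \<integral>\<^sup>+t. sing_line t \<partial>lborel)"
    by (rule nn_integral_lborel_prod) auto
  also have "\<dots> < \<infinity>" using sing_line_integral by (auto simp: Basis_complex_def ennreal_mult_less_top)
  finally show ?thesis unfolding sing_mass_def by (simp add: less_top)
qed

lemma sing_mass_nonneg [simp]: "sing_mass \<ge> 0" by (simp add: sing_mass_def)

lemma sing_dom_integral_shift: "(\<integral>\<^sup>+w. ennreal (sing_dom (\<xi> - w)) \<partial>lborel) = ennreal sing_mass"
proof -
  have "sing_dom (\<xi> - w) = sing_dom (- \<xi> + w)" for w
    using norm_minus_commute[of \<xi> w] by (simp add: sing_dom_def)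
  then have "(\<integral>\<^sup>+w. ennreal (sing_dom (\<xi> - w)) \<partial>lborel) = (\<integral>\<^sup>+w. ennreal (sing_dom (- \<xi> + w)) \<partial>lborel)"
    by simp
  also have "\<dots> = (\<integral>\<^sup>+w. ennreal (sing_dom w) \<partial>distr lborel borel ((+) (- \<xi>)))"
    by (subst nn_integral_distr) auto
  finally show ?thesis by (simp add: lborel_distr_plus sing_dom_integral)
qed

text \<open>Bound for the integral of |w|^(-1) |\<xi> - w|^(-5/4) over the plane. It blows up at
  \<xi> = 0, where the two singularities merge into the non-integrable order 9/4, and is locally
  bounded elsewhere.\<close>

definition two_point_const :: "complex \<Rightarrow> real" where
  "two_point_const \<xi> = 2 * sing_mass * (1 + (cmod \<xi> / 2) powr (-3/4))"

lemma two_point_const_nonneg [simp]: "two_point_const \<xi> \<ge> 0"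
  by (simp add: two_point_const_def)

text \<open>The larger of the distances |w| and |\<xi> - w| is at least |\<xi>|/2. If the smaller
  one is at most 1, the larger gives up a factor (|\<xi>|/2)^(-3/4) and passes its remaining
  exponent to the smaller, which then carries 9/4 - 3/4 = 3/2; otherwise the smaller one carries all
  of 9/4. These are the two exponents in \<open>sing_dom\<close>.\<close>

lemma two_point_le:
  assumes "\<xi> \<noteq> 0"
  shows "1 / cmod w * cmod (\<xi> - w) powr (-5/4) \<le> (1 + (cmod \<xi> / 2) powr (-3/4)) * (sing_dom w + sing_dom (\<xi> - w))"
proof -
  define s a c where "s = cmod \<xi> / 2" and "a = cmod (\<xi> - w)" and "c = cmod w"
  have s: "s > 0" using assms by (simp add: s_def)
  have sac: "2 * s \<le> a + c" unfolding s_def a_def c_def using norm_triangle_ineq[of "\<xi> - w" w] by simp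
  have rhs: "(1 + s powr (-3/4)) * t \<le> (1 + s powr (-3/4)) * (sing_dom w + sing_dom (\<xi> - w))"
    if "t \<le> sing_dom w \<or> t \<le> sing_dom (\<xi> - w)" for t
    using that by (intro mult_left_mono) (auto intro: add_increasing add_increasing2)
  show ?thesis
  proof (cases "a = 0 \<or> c = 0")
    case True
    then have "1 / cmod w * cmod (\<xi> - w) powr (-5/4) = 0" by (auto simp: a_def c_def)
    then show ?thesis by (simp only:) (intro mult_nonneg_nonneg add_nonneg_nonneg; simp)
  next
    case False
    then have ac: "a > 0" "c > 0" by (auto simp: a_def c_def)
    have inv: "1 / c = c powr (-1)" using ac by (simp add: powr_minus_divide)
    have mono: "u powr (-r) \<le> t powr (-r)" if "0 < t" "t \<le> u" "r \<ge> 0" for t u r :: real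
      using that by (intro powr_mono2') auto
    have "1 / c * a powr (-5/4) \<le> (1 + s powr (-3/4)) * sing_dom w \<or>
          1 / c * a powr (-5/4) \<le> (1 + s powr (-3/4)) * sing_dom (\<xi> - w)"
    proof (cases "c \<le> a")
      case True
      then have sa: "s \<le> a" using sac by simp
      show ?thesis
      proof (cases "c \<le> 1")
        case c1: True
        have "1 / c * a powr (-5/4) = c powr (-1) * (a powr (-3/4) * a powr (-1/2))"
          unfolding inv by (simp only: mult.assoc powr_add[symmetric]) simp
        also have "\<dots> \<le> c powr (-1) * (s powr (-3/4) * c powr (-1/2))"
          using mono[of s a "3/4"] mono[of c a "1/2"] s sa ac True by (intro mult_left_mono mult_mono) auto
        also have "\<dots> = s powr (-3/4) * c powr (-3/2)" 
        proof -
          have "c powr (-1) * c powr (-1/2) = c powr (-3/2)" by (simp only: powr_add[symmetric]) simp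
          then show ?thesis by (simp only: mult.left_commute[of "c powr (-1)"])
        qed
        also have "\<dots> \<le> (1 + s powr (-3/4)) * sing_dom w"
          using c1 by (simp add: sing_dom_def distrib_right flip: c_def)
        finally show ?thesis by blast
      next
        case c1: False
        have "1 / c * a powr (-5/4) \<le> c powr (-1) * c powr (-5/4)"
          unfolding inv using mono[of c a "5/4"] ac True by (intro mult_left_mono) auto
        also have "\<dots> = c powr (-9/4)" by (simp only: powr_add[symmetric]) simp
        also have "\<dots> \<le> (1 + s powr (-3/4)) * sing_dom w"
          using c1 by (simp add: sing_dom_def distrib_right flip: c_def)
        finally show ?thesis by blast
      qed
    next
      case False
      then have sa: "s \<le> c" using sac by simp
      show ?thesis
      proof (cases "a \<le> 1")
        case c1: True
        have "1 / c * a powr (-5/4) = (c powr (-3/4) * c powr (-1/4)) * a powr (-5/4)"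
          unfolding inv by (simp only: mult.assoc powr_add[symmetric]) simp
        also have "\<dots> \<le> (s powr (-3/4) * a powr (-1/4)) * a powr (-5/4)"
          using mono[of s c "3/4"] mono[of a c "1/4"] s sa ac False by (intro mult_right_mono mult_mono) auto
        also have "\<dots> = s powr (-3/4) * a powr (-3/2)" by (simp only: mult.assoc powr_add[symmetric]) simp
        also have "\<dots> \<le> (1 + s powr (-3/4)) * sing_dom (\<xi> - w)"
          using c1 by (simp add: sing_dom_def distrib_right flip: a_def)
        finally show ?thesis by blast
      next
        case c1: False
        have "1 / c * a powr (-5/4) \<le> a powr (-1) * a powr (-5/4)"
          unfolding inv using mono[of a c 1] ac False by (intro mult_right_mono) auto
        also have "\<dots> = a powr (-9/4)" by (simp only: powr_add[symmetric]) simp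
        also have "\<dots> \<le> (1 + s powr (-3/4)) * sing_dom (\<xi> - w)"
          using c1 by (simp add: sing_dom_def distrib_right flip: a_def)
        finally show ?thesis by blast
      qed
    qed
    then show ?thesis using rhs[of "sing_dom w"] rhs[of "sing_dom (\<xi> - w)"]
      unfolding a_def c_def s_def by linarith
  qed
qed

lemma two_point_integral:
  assumes "\<xi> \<noteq> 0"
  shows "(\<integral>\<^sup>+w. ennreal (1 / cmod w * cmod (\<xi> - w) powr (-5/4)) \<partial>lborel) \<le> ennreal (two_point_const \<xi>)"
proof -
  let ?C = "1 + (cmod \<xi> / 2) powr (-3/4)"
  have "(\<integral>\<^sup>+w. ennreal (1 / cmod w * cmod (\<xi> - w) powr (-5/4)) \<partial>lborel)
      \<le> (\<integral>\<^sup>+w. ennreal ?C * (ennreal (sing_dom w) + ennreal (sing_dom (\<xi> - w))) \<partial>lborel)"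
    by (intro nn_integral_mono) (use two_point_le[OF assms] in \<open>simp flip: ennreal_plus ennreal_mult\<close>)
  also have "\<dots> = ennreal ?C * (ennreal sing_mass + ennreal sing_mass)"
    by (subst nn_integral_cmult, measurable, subst nn_integral_add) (auto simp: sing_dom_integral sing_dom_integral_shift)
  also have "\<dots> = ennreal (two_point_const \<xi>)"
    by (simp add: two_point_const_def flip: ennreal_plus ennreal_mult)
  finally show ?thesis .
qed

text \<open>The difference has modulus d/(a b), where d \<le> a + b \<le> 2 b for the larger
  distance b. Writing d = d^(1/4) d^(3/4) and bounding d^(3/4) by 2 b^(3/4) leaves b^(-1/4)/a \<le>
  a^(-5/4).\<close>

lemma cauchy_kernel_diff_le:
  "cmod (1 / (\<xi> - w) - 1 / (\<eta> - w)) \<le>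
     2 * cmod (\<xi> - \<eta>) powr (1/4) * (cmod (\<xi> - w) powr (-5/4) + cmod (\<eta> - w) powr (-5/4))"
proof -
  have main: "cmod (1 / (\<xi> - w) - 1 / (\<eta> - w)) \<le>
     2 * cmod (\<xi> - \<eta>) powr (1/4) * (cmod (\<xi> - w) powr (-5/4) + cmod (\<eta> - w) powr (-5/4))"
    if le: "cmod (\<xi> - w) \<le> cmod (\<eta> - w)" for \<xi> \<eta>
  proof (cases "\<xi> = \<eta>")
    case ne: False
    define a b d where "a = cmod (\<xi> - w)" and "b = cmod (\<eta> - w)" and "d = cmod (\<xi> - \<eta>)"
    have d: "d > 0" using ne by (simp add: d_def)
    have dab: "d \<le> a + b" unfolding a_def b_def d_def using norm_triangle_ineq4[of "\<xi> - w" "\<eta> - w"] by simp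
    have ab: "a \<le> b" using le by (simp add: a_def b_def)
    have b: "b > 0" using d dab ab by linarith
    show ?thesis
    proof (cases "\<xi> = w")
      case True
      \<comment> \<open>At the singularity both 1 / 0 and the power of 0 are 0 by convention, and
        the other summand carries the bound.\<close>
      have "cmod (1 / (\<xi> - w) - 1 / (\<eta> - w)) = 1 / d" using True by (simp add: d_def norm_divide norm_minus_commute)
      also have "1 / d \<le> 2 * (d powr (1/4) * d powr (-5/4))"
      proof -
        have "d powr (1/4) * d powr (-5/4) = 1 / d"
          using d by (simp only: powr_add[symmetric]) (simp add: powr_minus_divide)
        then show ?thesis using d by (simp add: divide_right_mono)
      qed
      finally show ?thesis using True by (simp add: d_def norm_minus_commute)
    next
      case False
      then have a: "a > 0" by (simp add: a_def)
      have nz: "\<xi> \<noteq> w" "\<eta> \<noteq> w" using a b by (auto simp: a_def b_def)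
      have "1 / (\<xi> - w) - 1 / (\<eta> - w) = (\<eta> - \<xi>) / ((\<xi> - w) * (\<eta> - w))"
        using nz by (simp add: field_simps)
      then have "cmod (1 / (\<xi> - w) - 1 / (\<eta> - w)) = d / (a * b)"
        by (simp add: norm_divide norm_mult a_def b_def d_def norm_minus_commute)
      also have "d = d powr (1/4) * d powr (3/4)" using d by (simp only: powr_add[symmetric]) simp
      also have "\<dots> \<le> d powr (1/4) * (2 * b powr (3/4))"
      proof (intro mult_left_mono)
        have "d powr (3/4) \<le> (2 * b) powr (3/4)" using dab ab d by (intro powr_mono2) auto
        also have "\<dots> = 2 powr (3/4) * b powr (3/4)" using b by (simp add: powr_mult)
        also have "\<dots> \<le> 2 * b powr (3/4)"
          using powr_mono[of "3/4" 1 "2::real"] by (intro mult_right_mono) auto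
        finally show "d powr (3/4) \<le> 2 * b powr (3/4)" .
      qed auto
      finally have "cmod (1 / (\<xi> - w) - 1 / (\<eta> - w)) \<le> d powr (1/4) * (2 * b powr (3/4)) / (a * b)"
        using a b by (simp add: divide_right_mono)
      also have "\<dots> = 2 * d powr (1/4) * (b powr (-1/4) / a)"
      proof -
        have "b powr (-1/4) = b powr (3/4) * b powr (-1)" by (simp only: powr_add[symmetric]) simp
        also have "\<dots> = b powr (3/4) / b" using b by (simp add: powr_minus_divide)
        finally have "b powr (-1/4) = b powr (3/4) / b" .
        then show ?thesis by (simp only:) (simp add: mult.commute)
      qed
      also have "\<dots> \<le> 2 * d powr (1/4) * (a powr (-5/4))"
      proof (intro mult_left_mono)
        have "b powr (-1/4) / a \<le> a powr (-1/4) / a" using a ab by (intro divide_right_mono powr_mono2') auto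
        also have "\<dots> = a powr (-1/4) * a powr (-1)" using a by (simp add: powr_minus_divide)
        also have "\<dots> = a powr (-5/4)" by (simp only: powr_add[symmetric]) simp
        finally show "b powr (-1/4) / a \<le> a powr (-5/4)" .
      qed auto
      also have "\<dots> \<le> 2 * d powr (1/4) * (a powr (-5/4) + b powr (-5/4))" by (intro mult_left_mono) auto
      finally show ?thesis by (simp add: a_def b_def d_def)
    qed
  qed simp
  show ?thesis
  proof (cases "cmod (\<xi> - w) \<le> cmod (\<eta> - w)")
    case True then show ?thesis by (rule main)
  next
    case False
    then show ?thesis using main[of \<eta> \<xi>] by (simp add: norm_minus_commute add.commute)
  qed
qed

section \<open>Rectangle integrals and Morera's theorem\<close>

definition rect_int :: "(complex \<Rightarrow> complex) \<Rightarrow> complex \<Rightarrow> complex \<Rightarrow> complex" where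
  "rect_int f a b =
     (LINT x:{Re a..Re b}|lborel. f (Complex x (Im a))) - (LINT x:{Re a..Re b}|lborel. f (Complex x (Im b)))
     + \<i> * ((LINT y:{Im a..Im b}|lborel. f (Complex (Re b) y)) - (LINT y:{Im a..Im b}|lborel. f (Complex (Re a) y)))"

lemma contour_integral_linepath_same_Im:
  assumes "Im z = c" "Im z' = c" "Re z = a" "Re z' = b" "a < b"
  shows   "contour_integral (linepath z z') f = integral {a..b} (\<lambda>x. f (Complex x c))"
proof -
  have zz': "z = Complex a c" "z' = Complex b c"
    using assms by (auto simp: complex_eq_iff)
  have "contour_integral (linepath z z') f =
         (z' - z) * integral {0..1} (\<lambda>x. f (linepath z z' x))"
    by (simp add: contour_integral_integral)
  also have "z' - z = of_real (b - a)"
    by (simp add: zz' Complex_eq algebra_simps)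
  also have "integral {0..1} (\<lambda>x. f (linepath z z' x)) =
             integral {0..1} (\<lambda>x. f (Complex (linepath a b x) c))"
    by (simp add: linepath_def Complex_eq scaleR_conv_of_real algebra_simps zz')
  also have "\<dots> = integral {0..(b - a) / (b - a)} (\<lambda>x. f (Complex (a + (b - a) * x) c))"
    using \<open>a < b\<close> by (simp add: algebra_simps linepath_def)
  also have "{0..(b - a) / (b - a)} = (\<lambda>x. x / (b - a)) ` {0..b - a}"
    using \<open>a < b\<close> by simp
  also have "integral \<dots> (\<lambda>x. f (Complex (a + (b - a) * x) c)) =
             integral {a-a..b-a} (\<lambda>x. f (Complex (x + a) c)) / of_real (b - a)"
    using \<open>a < b\<close> by (subst integral_stretch_real) (auto simp: scaleR_conv_of_real add_ac)
  also have "\<dots> = integral {a..b} (\<lambda>x. f (Complex x c)) / of_real (b - a)"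
    by (subst integral_shift_real_ivl) (rule refl)
  finally show ?thesis
    using \<open>a < b\<close> by simp
qed

lemma continuous_on_rect_edges:
  assumes f: "continuous_on (path_image (rectpath a b)) f" and ab: "Re a \<le> Re b" "Im a \<le> Im b"
  shows "continuous_on {Re a..Re b} (\<lambda>x. f (Complex x (Im a)))"
    "continuous_on {Re a..Re b} (\<lambda>x. f (Complex x (Im b)))"
    "continuous_on {Im a..Im b} (\<lambda>y. f (Complex (Re a) y))"
    "continuous_on {Im a..Im b} (\<lambda>y. f (Complex (Re b) y))"
  using ab by (auto intro!: continuous_on_compose2[OF f] continuous_on_Complex continuous_intros
      simp: path_image_rectpath)

text \<open>\<open>rect_int\<close> spells the contour integral out as four Lebesgue integrals over
  real intervals, a form in which Fubini applies edge by edge; this link gives access to winding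
  numbers.\<close>

lemma rect_int_conv_contour:
  assumes f: "continuous_on (path_image (rectpath a b)) f" and ab: "Re a < Re b" "Im a < Im b"
  shows "rect_int f a b = contour_integral (rectpath a b) f"
proof -
  define a2 a4 where "a2 = Complex (Re b) (Im a)" and "a4 = Complex (Re a) (Im b)"
  have im: "path_image (rectpath a b) = closed_segment a a2 \<union> closed_segment a2 b \<union> closed_segment b a4 \<union> closed_segment a4 a"
    by (simp add: rectpath_def Let_def path_image_join a2_def a4_def Un_assoc)
  have i: "f contour_integrable_on linepath a a2" "f contour_integrable_on linepath a2 b"
      "f contour_integrable_on linepath b a4" "f contour_integrable_on linepath a4 a"
    by (rule contour_integrable_continuous_linepath[OF continuous_on_subset[OF f]], use im in blast)+
  have e: "contour_integral (linepath a a2) f = integral {Re a..Re b} (\<lambda>x. f (Complex x (Im a)))"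
       "contour_integral (linepath a4 b) f = integral {Re a..Re b} (\<lambda>x. f (Complex x (Im b)))"
       "contour_integral (linepath a2 b) f = \<i> * integral {Im a..Im b} (\<lambda>y. f (Complex (Re b) y))"
       "contour_integral (linepath a a4) f = \<i> * integral {Im a..Im b} (\<lambda>y. f (Complex (Re a) y))"
    by (intro contour_integral_linepath_same_Im contour_integral_linepath_same_Re; use ab in \<open>simp add: a2_def a4_def\<close>)+
  have r: "contour_integral (linepath b a4) f = - contour_integral (linepath a4 b) f"
      "contour_integral (linepath a4 a) f = - contour_integral (linepath a a4) f"
    by (rule contour_integral_reverse_linepath[OF continuous_on_subset[OF f]], use im closed_segment_commute in blast)+
  have "contour_integral (rectpath a b) f = contour_integral (linepath a a2) f + contour_integral (linepath a2 b) f
      - contour_integral (linepath a4 b) f - contour_integral (linepath a a4) f"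
    using i by (simp add: rectpath_def Let_def r flip: a2_def a4_def)
  moreover have "set_integrable lborel {Re a..Re b} (\<lambda>x. f (Complex x (Im a)))"
    "set_integrable lborel {Re a..Re b} (\<lambda>x. f (Complex x (Im b)))"
    "set_integrable lborel {Im a..Im b} (\<lambda>y. f (Complex (Re a) y))"
    "set_integrable lborel {Im a..Im b} (\<lambda>y. f (Complex (Re b) y))"
    using continuous_on_rect_edges[OF f] ab by (auto intro: borel_integrable_atLeastAtMost')
  ultimately show ?thesis
    unfolding rect_int_def e by (simp add: set_borel_integral_eq_integral(2) algebra_simps)
qed

lemma rect_int_diff:
  assumes f: "continuous_on (path_image (rectpath a b)) f" and g: "continuous_on (path_image (rectpath a b)) g"
    and ab: "Re a \<le> Re b" "Im a \<le> Im b"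
  shows "rect_int (\<lambda>z. f z - g z) a b = rect_int f a b - rect_int g a b"
  unfolding rect_int_def
  using continuous_on_rect_edges[OF f ab] continuous_on_rect_edges[OF g ab]
  by (simp add: set_integral_diff borel_integrable_atLeastAtMost' algebra_simps)

text \<open>The constant \<open>e\<close> stands for the reference kernel 1/(\<xi>' - w), which does
  not depend on \<xi> and so integrates to zero around the rectangle.\<close>

lemma rect_int_cauchy_kernel:
  assumes ab: "Re a < Re b" "Im a < Im b" and w: "w \<notin> path_image (rectpath a b)"
  shows "rect_int (\<lambda>\<xi>. 1 / (\<xi> - w) - e) a b = (if w \<in> box a b then 2 * of_real pi * \<i> else 0)"
proof -
  have c: "continuous_on (path_image (rectpath a b)) (\<lambda>\<xi>. 1 / (\<xi> - w))"
    using w by (intro continuous_intros) auto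
  have "rect_int (\<lambda>\<xi>. 1 / (\<xi> - w) - e) a b = rect_int (\<lambda>\<xi>. 1 / (\<xi> - w)) a b - rect_int (\<lambda>\<xi>. e) a b"
    by (rule rect_int_diff[OF c]) (use ab in auto)
  also have "rect_int (\<lambda>\<xi>. e) a b = 0" by (simp add: rect_int_def)
  also have "rect_int (\<lambda>\<xi>. 1 / (\<xi> - w)) a b = contour_integral (rectpath a b) (\<lambda>\<xi>. 1 / (\<xi> - w))"
    by (rule rect_int_conv_contour[OF c ab])
  also have "\<dots> = 2 * of_real pi * \<i> * winding_number (rectpath a b) w"
    using w by (subst winding_number_valid_path) auto
  also have "winding_number (rectpath a b) w = (if w \<in> box a b then 1 else 0)"
  proof (cases "w \<in> box a b")
    case False
    then have "w \<notin> cbox a b" using w ab by (auto simp: path_image_rectpath_cbox_minus_box)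
    then show ?thesis using False ab by (simp add: winding_number_rectpath_outside)
  qed (simp add: winding_number_rectpath)
  finally show ?thesis by simp
qed

lemma AE_not_rect_boundary:
  assumes "Re a \<le> Re b" "Im a \<le> Im b"
  shows "AE w in lborel. w \<notin> path_image (rectpath a b)"
proof (rule AE_not_in)
  have "cbox a b - box a b \<in> null_sets lebesgue"
    using negligible_frontier_interval[of a b] by (simp add: negligible_iff_null_sets)
  moreover have "cbox a b - box a b \<in> sets lborel" by simp
  ultimately have "cbox a b - box a b \<in> null_sets lborel" using null_sets_completion_iff by blast
  then show "path_image (rectpath a b) \<in> null_sets lborel"
    using path_image_rectpath_cbox_minus_box[OF assms] by simp
qed

text \<open>The primitive \<open>F\<close> integrates \<open>f\<close> along the bottom side and
  then upwards; vanishing rectangle integrals make it equal to integration up the left side and then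
  across. The first form shows the vertical derivative \<i> f, the second the horizontal derivative
  f, and with continuity this makes \<open>F\<close> complex differentiable. So \<open>f\<close> is
  locally the derivative of a holomorphic function.\<close>

lemma Morera_rectangle:
  assumes U: "open U" and f: "continuous_on U f"
    and r: "\<And>a b. Re a < Re b \<Longrightarrow> Im a < Im b \<Longrightarrow> cbox a b \<subseteq> U \<Longrightarrow> rect_int f a b = 0"
  shows "f holomorphic_on U"
proof -
  have "\<exists>e>0. f holomorphic_on ball p e" if p: "p \<in> U" for p
  proof -
    obtain a b where "cbox a b \<subseteq> U" "p \<in> box a b" "\<forall>i\<in>Basis. a \<bullet> i < b \<bullet> i"
      by (rule open_contains_cbox[OF U p])
    then have ab: "p \<in> box a b" "cbox a b \<subseteq> U" by auto
    have less: "Re a < Re b" "Im a < Im b" using ab(1) by (auto simp: in_box_complex_iff)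
    have in_cbox: "Complex x y \<in> cbox a b \<longleftrightarrow> x \<in> {Re a..Re b} \<and> y \<in> {Im a..Im b}" for x y
      by (auto simp: in_cbox_complex_iff)
    have fc: "continuous_on (cbox a b) f" using f ab(2) by (rule continuous_on_subset)
    have fx: "continuous_on {Re a..Re b} (\<lambda>x. f (Complex x y))" if "y \<in> {Im a..Im b}" for y
      using that by (intro continuous_on_compose2[OF fc] continuous_on_Complex continuous_intros) (auto simp: in_cbox)
    have fy: "continuous_on {Im a..Im b} (\<lambda>y. f (Complex x y))" if "x \<in> {Re a..Re b}" for x
      using that by (intro continuous_on_compose2[OF fc] continuous_on_Complex continuous_intros) (auto simp: in_cbox)
    define H where "H = (\<lambda>x y. integral {Re a..x} (\<lambda>t. f (Complex t y)))"
    define V where "V = (\<lambda>x y. integral {Im a..y} (\<lambda>t. f (Complex x t)))"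
    define F where "F = (\<lambda>x y. H x (Im a) + \<i> * V x y)"
    have H0: "H (Re a) y = 0" for y by (simp add: H_def)
    have V0: "V x (Im a) = 0" for x by (simp add: V_def)
    have F2: "F x y = \<i> * V (Re a) y + H x y" if x: "x \<in> {Re a<..<Re b}" and y: "y \<in> {Im a<..<Im b}" for x y
    proof -
      have "cbox a (Complex x y) \<subseteq> U" using ab(2) x y by (auto simp: in_cbox_complex_iff subset_iff)
      then have "rect_int f a (Complex x y) = 0" using x y by (intro r) auto
      moreover have "set_integrable lborel {Re a..x} (\<lambda>t. f (Complex t v))" if "v \<in> {Im a..Im b}" for v
        using x by (intro borel_integrable_atLeastAtMost' continuous_on_subset[OF fx[OF that]]) auto
      moreover have "set_integrable lborel {Im a..y} (\<lambda>t. f (Complex v t))" if "v \<in> {Re a..Re b}" for v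
        using y by (intro borel_integrable_atLeastAtMost' continuous_on_subset[OF fy[OF that]]) auto
      ultimately show ?thesis
        using x y less unfolding rect_int_def F_def H_def V_def
        by (simp add: set_borel_integral_eq_integral(2) algebra_simps)
    qed
    have dH: "((\<lambda>x. H x y) has_vector_derivative f (Complex x y)) (at x)"
      if "x \<in> {Re a<..<Re b}" "y \<in> {Im a..Im b}" for x y
      using integral_has_vector_derivative[OF fx[OF that(2)], of x] that at_within_Icc_at[of "Re a" x "Re b"]
      by (simp add: H_def)
    have dV: "((\<lambda>y. V x y) has_vector_derivative f (Complex x y)) (at y)"
      if "x \<in> {Re a..Re b}" "y \<in> {Im a<..<Im b}" for x y
      using integral_has_vector_derivative[OF fy[OF that(1)], of y] that at_within_Icc_at[of "Im a" y "Im b"]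
      by (simp add: V_def)
    have dF: "((\<lambda>z. F (Re z) (Im z)) has_field_derivative f z) (at z)" if z: "z \<in> box a b" for z
    proof -
      define X where "X = {Re a<..<Re b}"
      define Y where "Y = {Im a<..<Im b}"
      have zX: "Re z \<in> X" "Im z \<in> Y" using z by (auto simp: X_def Y_def in_box_complex_iff)
      have oX: "open X" "open Y" by (simp_all add: X_def Y_def)
      have "((\<lambda>(x, y). F x y) has_derivative
          (\<lambda>(tx, ty). (\<lambda>t. t *\<^sub>R f z) tx + blinfun_scaleR_left (\<i> * f (Complex (Re z) (Im z))) ty)) (at (Re z, Im z) within X \<times> Y)"
      \<comment> \<open>The horizontal derivative is required at the one point only, the vertical
        one throughout the box together with its continuity.\<close>
      proof (rule has_derivative_partialsI)
        have "((\<lambda>x. \<i> * V (Re a) (Im z) + H x (Im z)) has_vector_derivative f (Complex (Re z) (Im z))) (at (Re z))"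
          using zX dH[of "Re z" "Im z"] by (simp add: X_def Y_def has_vector_derivative_add_const add.commute)
        then have "((\<lambda>x. \<i> * V (Re a) (Im z) + H x (Im z)) has_vector_derivative f z) (at (Re z) within X)"
          by (auto intro: has_vector_derivative_at_within)
        then have "((\<lambda>x. F x (Im z)) has_vector_derivative f z) (at (Re z) within X)"
          by (rule has_vector_derivative_transform[rotated 2]) (use zX F2 in \<open>auto simp: X_def Y_def\<close>)
        then show "((\<lambda>x. F x (Im z)) has_derivative (\<lambda>t. t *\<^sub>R f z)) (at (Re z) within X)"
          by (simp add: has_vector_derivative_def)
        fix x y assume xy: "x \<in> X" "y \<in> Y"
        have "((\<lambda>y. V x y) has_vector_derivative f (Complex x y)) (at y within Y)"
          using xy dV[of x y] by (auto simp: X_def Y_def intro: has_vector_derivative_at_within)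
        from has_vector_derivative_add[OF has_vector_derivative_const has_vector_derivative_mult_right[OF this, of \<i>], of "H x (Im a)"]
        have "((\<lambda>y. F x y) has_vector_derivative \<i> * f (Complex x y)) (at y within Y)"
          by (simp add: F_def)
        then show "((\<lambda>y. F x y) has_derivative blinfun_apply (blinfun_scaleR_left (\<i> * f (Complex x y)))) (at y within Y)"
          by (simp add: has_vector_derivative_def)
      next
        have "continuous_on (X \<times> Y) (\<lambda>p. f (Complex (fst p) (snd p)))"
          by (intro continuous_on_compose2[OF fc] continuous_on_Complex continuous_intros) (auto simp: in_cbox X_def Y_def)
        then have "continuous_on (X \<times> Y) (\<lambda>(x, y). blinfun_scaleR_left (\<i> * f (Complex x y)))"
          unfolding case_prod_unfold by (intro continuous_intros bounded_linear.continuous_on[OF bounded_linear_blinfun_scaleR_left])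
        then show "continuous (at (Re z, Im z) within X \<times> Y) (\<lambda>(x, y). blinfun_scaleR_left (\<i> * f (Complex x y)))"
          using zX by (simp add: continuous_on_eq_continuous_within)
      qed (use zX in \<open>auto simp: Y_def\<close>)
      then have D: "((\<lambda>(x, y). F x y) has_derivative (\<lambda>(tx, ty). tx *\<^sub>R f z + ty *\<^sub>R (\<i> * f z))) (at (Re z, Im z))"
      proof -
        have aw: "at (Re z, Im z) within X \<times> Y = at (Re z, Im z)"
          by (rule at_within_open) (use zX in simp, rule open_Times[OF oX])
        have eq: "(\<lambda>(tx, ty). (\<lambda>t. t *\<^sub>R f z) tx + blinfun_apply (blinfun_scaleR_left (\<i> * f (Complex (Re z) (Im z)))) ty)
            = (\<lambda>(tx, ty). tx *\<^sub>R f z + ty *\<^sub>R (\<i> * f z))"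
          by (simp add: fun_eq_iff)
        assume "((\<lambda>(x, y). F x y) has_derivative
          (\<lambda>(tx, ty). (\<lambda>t. t *\<^sub>R f z) tx + blinfun_apply (blinfun_scaleR_left (\<i> * f (Complex (Re z) (Im z)))) ty)) (at (Re z, Im z) within X \<times> Y)"
        then show ?thesis unfolding aw eq .
      qed
      have "((\<lambda>z. (Re z, Im z)) has_derivative (\<lambda>h. (Re h, Im h))) (at z)"
        by (auto intro!: derivative_eq_intros)
      from has_derivative_compose[OF this D[unfolded fst_conv]]
      have "((\<lambda>z. F (Re z) (Im z)) has_derivative (\<lambda>h. Re h *\<^sub>R f z + Im h *\<^sub>R (\<i> * f z))) (at z)" by simp
      moreover have "(\<lambda>h. Re h *\<^sub>R f z + Im h *\<^sub>R (\<i> * f z)) = (*) (f z)"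
      proof
        fix h show "Re h *\<^sub>R f z + Im h *\<^sub>R (\<i> * f z) = f z * h"
          by (subst (3) complex_eq[of h]) (simp add: scaleR_conv_of_real algebra_simps)
      qed
      ultimately show ?thesis by (simp add: has_field_derivative_def)
    qed
    obtain e where e: "e > 0" "ball p e \<subseteq> box a b"
      by (rule openE[OF open_box ab(1)])
    have "(\<lambda>z. F (Re z) (Im z)) holomorphic_on ball p e"
      using dF e by (auto simp: holomorphic_on_open)
    then have "deriv (\<lambda>z. F (Re z) (Im z)) holomorphic_on ball p e" by (intro holomorphic_deriv) auto
    then have "f holomorphic_on ball p e"
      by (rule holomorphic_transform) (use e(2) in \<open>blast intro: DERIV_imp_deriv[OF dF]\<close>)
    then show ?thesis using e by blast
  qed
  then show ?thesis
    by (meson U analytic_imp_holomorphic analytic_on_def)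
qed

section \<open>Plane measure as a product; integrability and continuity of the potential\<close>

lemma lborel_complex: "(lborel :: complex measure) = distr (lborel \<Otimes>\<^sub>M lborel) borel (\<lambda>(x, y). Complex x y)"
proof (rule lborel_eqI)
  fix l u :: complex
  assume lu: "\<And>b. b \<in> Basis \<Longrightarrow> l \<bullet> b \<le> u \<bullet> b"
  have le: "Re l \<le> Re u" "Im l \<le> Im u"
    using lu[of 1] lu[of \<i>] by (auto simp: Basis_complex_def)
  have m: "(\<lambda>(x, y). Complex x y) \<in> borel_measurable (lborel \<Otimes>\<^sub>M lborel)"
    unfolding lborel_prod case_prod_unfold
    by (simp, intro borel_measurable_continuous_onI continuous_on_Complex continuous_intros)
  have "(\<lambda>(x, y). Complex x y) -` box l u \<inter> space (lborel \<Otimes>\<^sub>M lborel) = {Re l<..<Re u} \<times> {Im l<..<Im u}"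
    by (auto simp: space_pair_measure in_box_complex_iff)
  then have "emeasure (distr (lborel \<Otimes>\<^sub>M lborel) borel (\<lambda>(x, y). Complex x y)) (box l u)
      = emeasure (lborel \<Otimes>\<^sub>M lborel) ({Re l<..<Re u} \<times> {Im l<..<Im u})"
    using m by (subst emeasure_distr) auto
  also have "\<dots> = ennreal (Re u - Re l) * ennreal (Im u - Im l)"
    using le by (subst lborel.emeasure_pair_measure_Times) auto
  also have "\<dots> = (\<Prod>b\<in>Basis. (u - l) \<bullet> b)"
    using le by (simp add: Basis_complex_def ennreal_mult)
  finally show "emeasure (distr (lborel \<Otimes>\<^sub>M lborel) borel (\<lambda>(x, y). Complex x y)) (box l u) = (\<Prod>b\<in>Basis. (u - l) \<bullet> b)" .
qed simp

text \<open>This is w/|w|^2 on \<open>S\<close>: the factor \<open>w\<close> of the test functions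
  turns the weight |w|^(-2) into 1/cnj w, whose singularity at 0 is integrable in the plane.\<close>

definition log_density :: "complex set \<Rightarrow> complex \<Rightarrow> complex" where
  "log_density S w = indicator S w / cnj w"

text \<open>Decays like |w|^(-2); a single Cauchy kernel times 1/|w| would not be integrable over a
  neighbourhood of infinity.\<close>

definition cauchy_diff :: "complex \<Rightarrow> complex \<Rightarrow> complex \<Rightarrow> complex" where
  "cauchy_diff \<xi>' \<xi> w = 1 / (\<xi> - w) - 1 / (\<xi>' - w)"

definition log_potential :: "complex set \<Rightarrow> complex \<Rightarrow> complex \<Rightarrow> complex" where
  "log_potential S \<xi>' \<xi> = (\<integral>w. log_density S w * cauchy_diff \<xi>' \<xi> w \<partial>lborel) / of_real pi"

lemma borel_measurable_cnj' [measurable]: "cnj \<in> borel_measurable borel"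
  by (intro borel_measurable_continuous_onI continuous_intros)

lemma borel_measurable_log_density [measurable]:
  assumes "S \<in> sets borel"
  shows "log_density S \<in> borel_measurable borel"
proof -
  have "(\<lambda>w. indicator S w / cnj w) \<in> borel_measurable borel"
    by (intro borel_measurable_divide borel_measurable_indicator borel_measurable_cnj' assms)
  then show ?thesis by (simp add: log_density_def[abs_def])
qed

lemma borel_measurable_cauchy_diff [measurable]:
  "(\<lambda>w. cauchy_diff \<xi>' \<xi> w) \<in> borel_measurable borel"
  unfolding cauchy_diff_def by measurable

lemma cmod_log_density_le: "cmod (log_density S w) \<le> 1 / cmod w"
  by (auto simp: log_density_def norm_divide indicator_def)

text \<open>One estimate with two uses: its finiteness gives integrability, and its factor |\<xi> -
  \<eta>|^(1/4) gives the Hoelder bound.\<close>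

lemma nn_integral_log_density_cauchy_diff:
  assumes "\<xi> \<noteq> 0" "\<eta> \<noteq> 0"
  shows "(\<integral>\<^sup>+w. ennreal (cmod (log_density S w * cauchy_diff \<eta> \<xi> w)) \<partial>lborel)
     \<le> ennreal (2 * cmod (\<xi> - \<eta>) powr (1/4) * (two_point_const \<xi> + two_point_const \<eta>))"
proof -
  let ?d = "2 * cmod (\<xi> - \<eta>) powr (1/4)"
  let ?t = "\<lambda>\<xi> w. 1 / cmod w * cmod (\<xi> - w) powr (-5/4)"
  have "cmod (log_density S w * cauchy_diff \<eta> \<xi> w) \<le> ?d * (?t \<xi> w + ?t \<eta> w)" for w
  proof -
    have "cmod (log_density S w * cauchy_diff \<eta> \<xi> w) \<le> (1 / cmod w) *
       (?d * (cmod (\<xi> - w) powr (-5/4) + cmod (\<eta> - w) powr (-5/4)))"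
      unfolding norm_mult cauchy_diff_def
      by (intro mult_mono cmod_log_density_le cauchy_kernel_diff_le) auto
    then show ?thesis by (simp add: algebra_simps)
  qed
  then have "(\<integral>\<^sup>+w. ennreal (cmod (log_density S w * cauchy_diff \<eta> \<xi> w)) \<partial>lborel)
     \<le> (\<integral>\<^sup>+w. ennreal ?d * (ennreal (?t \<xi> w) + ennreal (?t \<eta> w)) \<partial>lborel)"
    by (intro nn_integral_mono) (simp flip: ennreal_plus ennreal_mult)
  also have "\<dots> = ennreal ?d * ((\<integral>\<^sup>+w. ennreal (?t \<xi> w) \<partial>lborel) + (\<integral>\<^sup>+w. ennreal (?t \<eta> w) \<partial>lborel))"
    by (subst nn_integral_cmult, measurable, subst nn_integral_add) auto
  also have "\<dots> \<le> ennreal ?d * (ennreal (two_point_const \<xi>) + ennreal (two_point_const \<eta>))"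
    by (intro mult_left_mono add_mono two_point_integral assms) auto
  also have "\<dots> = ennreal (?d * (two_point_const \<xi> + two_point_const \<eta>))"
    by (simp flip: ennreal_plus ennreal_mult)
  finally show ?thesis .
qed

lemma integrable_log_density_cauchy_diff:
  assumes "S \<in> sets borel" "\<xi> \<noteq> 0" "\<eta> \<noteq> 0"
  shows "integrable lborel (\<lambda>w. log_density S w * cauchy_diff \<eta> \<xi> w)"
proof (rule integrableI_bounded)
  show "(\<integral>\<^sup>+w. ennreal (cmod (log_density S w * cauchy_diff \<eta> \<xi> w)) \<partial>lborel) < \<infinity>"
    using nn_integral_log_density_cauchy_diff[OF assms(2,3)] by (rule le_less_trans) simp
qed (use assms(1) in measurable)

lemma integral_log_density_cauchy_diff_le:
  assumes "S \<in> sets borel" "\<xi> \<noteq> 0" "\<eta> \<noteq> 0"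
  shows "cmod (\<integral>w. log_density S w * cauchy_diff \<eta> \<xi> w \<partial>lborel)
     \<le> 2 * cmod (\<xi> - \<eta>) powr (1/4) * (two_point_const \<xi> + two_point_const \<eta>)"
proof -
  have "ennreal (cmod (\<integral>w. log_density S w * cauchy_diff \<eta> \<xi> w \<partial>lborel))
     \<le> (\<integral>\<^sup>+w. ennreal (cmod (log_density S w * cauchy_diff \<eta> \<xi> w)) \<partial>lborel)"
    by (rule integral_norm_bound_ennreal[OF integrable_log_density_cauchy_diff[OF assms]])
  also note nn_integral_log_density_cauchy_diff[OF assms(2,3)]
  finally show ?thesis by (subst (asm) ennreal_le_iff) auto
qed

lemma log_potential_diff:
  assumes "S \<in> sets borel" "\<xi> \<noteq> 0" "\<eta> \<noteq> 0" "\<xi>' \<noteq> 0"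
  shows "log_potential S \<xi>' \<xi> - log_potential S \<xi>' \<eta> = (\<integral>w. log_density S w * cauchy_diff \<eta> \<xi> w \<partial>lborel) / of_real pi"
proof -
  have "(\<integral>w. log_density S w * cauchy_diff \<xi>' \<xi> w \<partial>lborel) - (\<integral>w. log_density S w * cauchy_diff \<xi>' \<eta> w \<partial>lborel)
     = (\<integral>w. log_density S w * cauchy_diff \<xi>' \<xi> w - log_density S w * cauchy_diff \<xi>' \<eta> w \<partial>lborel)"
    by (intro Bochner_Integration.integral_diff[symmetric] integrable_log_density_cauchy_diff assms)
  also have "\<dots> = (\<integral>w. log_density S w * cauchy_diff \<eta> \<xi> w \<partial>lborel)"
    by (intro Bochner_Integration.integral_cong) (simp_all add: cauchy_diff_def algebra_simps)
  finally show ?thesis unfolding log_potential_def by (simp flip: diff_divide_distrib)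
qed

lemma log_potential_diff_le:
  assumes "S \<in> sets borel" "\<xi> \<noteq> 0" "\<eta> \<noteq> 0" "\<xi>' \<noteq> 0"
  shows "cmod (log_potential S \<xi>' \<xi> - log_potential S \<xi>' \<eta>)
     \<le> cmod (\<xi> - \<eta>) powr (1/4) * (two_point_const \<xi> + two_point_const \<eta>)"
proof -
  have "cmod (log_potential S \<xi>' \<xi> - log_potential S \<xi>' \<eta>)
     = cmod (\<integral>w. log_density S w * cauchy_diff \<eta> \<xi> w \<partial>lborel) / pi"
    by (simp add: log_potential_diff[OF assms] norm_divide)
  also have "\<dots> \<le> (2 * cmod (\<xi> - \<eta>) powr (1/4) * (two_point_const \<xi> + two_point_const \<eta>)) / 2"
    by (intro frac_le integral_log_density_cauchy_diff_le assms mult_nonneg_nonneg add_nonneg_nonneg) (use pi_ge_two in auto)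
  finally show ?thesis by simp
qed

lemma continuous_on_two_point_const: "continuous_on (- {0}) two_point_const"
  unfolding two_point_const_def by (intro continuous_intros) auto

lemma continuous_on_log_potential:
  assumes "S \<in> sets borel" "\<xi>' \<noteq> 0"
  shows "continuous_on (- {0}) (log_potential S \<xi>')"
  unfolding continuous_on_def
proof
  fix \<eta> :: complex assume \<eta>: "\<eta> \<in> - {0}"
  have t: "(two_point_const \<longlongrightarrow> two_point_const \<eta>) (at \<eta> within - {0})"
    using continuous_on_two_point_const \<eta> by (simp add: continuous_on_def)
  have "((\<lambda>\<xi>. cmod (\<xi> - \<eta>) powr (1/4)) \<longlongrightarrow> cmod (\<eta> - \<eta>) powr (1/4)) (at \<eta> within - {0})"
    by (intro tendsto_powr' tendsto_intros) auto
  then have "((\<lambda>\<xi>. cmod (\<xi> - \<eta>) powr (1/4) * (two_point_const \<xi> + two_point_const \<eta>)) \<longlongrightarrow>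
     cmod (\<eta> - \<eta>) powr (1/4) * (two_point_const \<eta> + two_point_const \<eta>)) (at \<eta> within - {0})"
    by (intro tendsto_mult tendsto_add t tendsto_const)
  then have l: "((\<lambda>\<xi>. cmod (\<xi> - \<eta>) powr (1/4) * (two_point_const \<xi> + two_point_const \<eta>)) \<longlongrightarrow> 0) (at \<eta> within - {0})"
    by simp
  have "((\<lambda>\<xi>. log_potential S \<xi>' \<xi> - log_potential S \<xi>' \<eta>) \<longlongrightarrow> 0) (at \<eta> within - {0})"
    by (rule Lim_null_comparison[OF _ l])
       (use \<eta> assms log_potential_diff_le[of S _ \<eta> \<xi>'] in \<open>auto simp: eventually_at_filter\<close>)
  then show "(log_potential S \<xi>' \<longlongrightarrow> log_potential S \<xi>' \<eta>) (at \<eta> within - {0})"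
    by (simp add: LIM_zero_iff)
qed

lemma log_potential_le:
  assumes "S \<in> sets borel" "\<xi> \<noteq> 0" "\<xi>' \<noteq> 0"
  shows "cmod (log_potential S \<xi>' \<xi>) \<le> cmod (\<xi> - \<xi>') powr (1/4) * (two_point_const \<xi> + two_point_const \<xi>')"
  using log_potential_diff_le[OF assms(1,2,3,3)] by (simp add: log_potential_def cauchy_diff_def)

text \<open>The majorant of the inner integral depends continuously on the point of the edge as long
  as the edge avoids 0, so it is bounded on the compact edge; this is the absolute integrability
  that Fubini requires.\<close>

lemma log_potential_Fubini_edge:
  fixes \<gamma> :: "real \<Rightarrow> complex"
  assumes S: "S \<in> sets borel" and \<xi>': "\<xi>' \<noteq> 0" and \<gamma>: "continuous_on UNIV \<gamma>" and nz: "\<And>t. t \<in> {c..d} \<Longrightarrow> \<gamma> t \<noteq> 0"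
  shows "(LINT t:{c..d}|lborel. log_potential S \<xi>' (\<gamma> t)) =
       (\<integral>w. log_density S w * (LINT t:{c..d}|lborel. cauchy_diff \<xi>' (\<gamma> t) w) \<partial>lborel) / of_real pi" (is ?eq)
    and "integrable lborel (\<lambda>w. log_density S w * (LINT t:{c..d}|lborel. cauchy_diff \<xi>' (\<gamma> t) w))" (is ?int)
proof -
  define f where "f = (\<lambda>t w. indicator {c..d} t *\<^sub>R (log_density S w * cauchy_diff \<xi>' (\<gamma> t) w))"
  have [measurable]: "\<gamma> \<in> borel_measurable borel" using \<gamma> by (rule borel_measurable_continuous_onI)
  have meas: "case_prod f \<in> borel_measurable (lborel \<Otimes>\<^sub>M lborel)"
    unfolding f_def cauchy_diff_def using S by measurable
  have cont: "continuous_on {c..d} (\<lambda>t. 2 * cmod (\<gamma> t - \<xi>') powr (1/4) * (two_point_const (\<gamma> t) + two_point_const \<xi>'))"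
    by (intro continuous_intros continuous_on_compose2[OF continuous_on_two_point_const] continuous_on_subset[OF \<gamma>] continuous_on_powr')
       (use nz in auto)
  then have "bounded ((\<lambda>t. 2 * cmod (\<gamma> t - \<xi>') powr (1/4) * (two_point_const (\<gamma> t) + two_point_const \<xi>')) ` {c..d})"
    by (intro compact_imp_bounded compact_continuous_image) auto
  then obtain B where B: "B > 0" "\<And>t. t \<in> {c..d} \<Longrightarrow> 2 * cmod (\<gamma> t - \<xi>') powr (1/4) * (two_point_const (\<gamma> t) + two_point_const \<xi>') \<le> B"
    unfolding bounded_pos by fastforce
  have "(\<integral>\<^sup>+p. ennreal (norm (case_prod f p)) \<partial>(lborel \<Otimes>\<^sub>M lborel)) = (\<integral>\<^sup>+t. \<integral>\<^sup>+w. ennreal (norm (f t w)) \<partial>lborel \<partial>lborel)"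
    using meas by (subst lborel.nn_integral_fst[symmetric]) auto
  also have "\<dots> \<le> (\<integral>\<^sup>+t. ennreal B * indicator {c..d} t \<partial>lborel)"
  proof (intro nn_integral_mono)
    fix t :: real
    show "(\<integral>\<^sup>+w. ennreal (norm (f t w)) \<partial>lborel) \<le> ennreal B * indicator {c..d} t"
    proof (cases "t \<in> {c..d}")
      case True
      then have "(\<integral>\<^sup>+w. ennreal (norm (f t w)) \<partial>lborel) = (\<integral>\<^sup>+w. ennreal (cmod (log_density S w * cauchy_diff \<xi>' (\<gamma> t) w)) \<partial>lborel)"
        by (simp add: f_def)
      also have "\<dots> \<le> ennreal (2 * cmod (\<gamma> t - \<xi>') powr (1/4) * (two_point_const (\<gamma> t) + two_point_const \<xi>'))"
        by (rule nn_integral_log_density_cauchy_diff[OF nz[OF True] \<xi>'])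
      also have "\<dots> \<le> ennreal B" using B(2)[OF True] by (rule ennreal_leI)
      finally show ?thesis using True by simp
    qed (simp add: f_def)
  qed
  also have "\<dots> < \<infinity>" by (simp add: nn_integral_cmult_indicator ennreal_mult_less_top emeasure_lborel_Icc_eq)
  finally have integ: "integrable (lborel \<Otimes>\<^sub>M lborel) (case_prod f)"
    by (intro integrableI_bounded meas)
  have 1: "(\<integral>w. f t w \<partial>lborel) = indicator {c..d} t *\<^sub>R (log_potential S \<xi>' (\<gamma> t) * of_real pi)" for t
    by (simp add: f_def log_potential_def)
  have 2: "(\<integral>t. f t w \<partial>lborel) = log_density S w * (LINT t:{c..d}|lborel. cauchy_diff \<xi>' (\<gamma> t) w)" for w
    unfolding f_def set_lebesgue_integral_def
    by (subst Bochner_Integration.integral_mult_right_zero[symmetric]) (simp add: mult_scaleR_right)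
  have "(\<integral>w. \<integral>t. f t w \<partial>lborel \<partial>lborel) = (\<integral>t. \<integral>w. f t w \<partial>lborel \<partial>lborel)"
    by (rule lborel_pair.Fubini_integral[OF integ])
  also have "\<dots> = (LINT t:{c..d}|lborel. log_potential S \<xi>' (\<gamma> t)) * of_real pi"
    unfolding 1 set_lebesgue_integral_def
    by (subst Bochner_Integration.integral_mult_left_zero[symmetric]) (simp add: mult_scaleR_left)
  finally show ?eq unfolding 2 by simp
  show ?int using lborel_pair.integrable_snd[OF integ] unfolding 2 .
qed

text \<open>After Fubini the inner integral is that of the Cauchy kernel around the rectangle: 2 pi
  i inside and 0 outside, the boundary being a null set. This is the weak form of the statement that
  the d-bar derivative of the potential on \<open>S\<close> is 1/cnj w.\<close>

lemma rect_int_log_potential: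
  assumes S: "S \<in> sets borel" and \<xi>': "\<xi>' \<noteq> 0" and ab: "Re a < Re b" "Im a < Im b"
    and sub: "cbox a b \<subseteq> S - {0}"
  shows "rect_int (log_potential S \<xi>') a b = 2 * \<i> * (LINT w:cbox a b|lborel. 1 / cnj w)"
proof -
  have in_cbox: "Complex x y \<in> cbox a b \<longleftrightarrow> x \<in> {Re a..Re b} \<and> y \<in> {Im a..Im b}" for x y
    by (auto simp: in_cbox_complex_iff)
  have nz: "Complex x y \<noteq> 0" if "x \<in> {Re a..Re b}" "y \<in> {Im a..Im b}" for x y
    using sub in_cbox that by blast
  let ?m = "log_density S"
  let ?k = "cauchy_diff \<xi>'"
  let ?e = "\<lambda>\<gamma> c d w. LINT t:{c..d}|lborel. cauchy_diff \<xi>' (\<gamma> t) w"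
  define e1 where "e1 = ?e (\<lambda>x. Complex x (Im a)) (Re a) (Re b)"
  define e2 where "e2 = ?e (\<lambda>x. Complex x (Im b)) (Re a) (Re b)"
  define e3 where "e3 = ?e (\<lambda>y. Complex (Re b) y) (Im a) (Im b)"
  define e4 where "e4 = ?e (\<lambda>y. Complex (Re a) y) (Im a) (Im b)"
  have E1: "(LINT x:{Re a..Re b}|lborel. log_potential S \<xi>' (Complex x (Im a))) = (\<integral>w. ?m w * e1 w \<partial>lborel) / of_real pi"
     "integrable lborel (\<lambda>w. ?m w * e1 w)"
    unfolding e1_def by (rule log_potential_Fubini_edge[OF S \<xi>']; use nz ab in \<open>auto intro!: continuous_on_Complex continuous_intros\<close>)+
  have E2: "(LINT x:{Re a..Re b}|lborel. log_potential S \<xi>' (Complex x (Im b))) = (\<integral>w. ?m w * e2 w \<partial>lborel) / of_real pi"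
     "integrable lborel (\<lambda>w. ?m w * e2 w)"
    unfolding e2_def by (rule log_potential_Fubini_edge[OF S \<xi>']; use nz ab in \<open>auto intro!: continuous_on_Complex continuous_intros\<close>)+
  have E3: "(LINT y:{Im a..Im b}|lborel. log_potential S \<xi>' (Complex (Re b) y)) = (\<integral>w. ?m w * e3 w \<partial>lborel) / of_real pi"
     "integrable lborel (\<lambda>w. ?m w * e3 w)"
    unfolding e3_def by (rule log_potential_Fubini_edge[OF S \<xi>']; use nz ab in \<open>auto intro!: continuous_on_Complex continuous_intros\<close>)+
  have E4: "(LINT y:{Im a..Im b}|lborel. log_potential S \<xi>' (Complex (Re a) y)) = (\<integral>w. ?m w * e4 w \<partial>lborel) / of_real pi"
     "integrable lborel (\<lambda>w. ?m w * e4 w)"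
    unfolding e4_def by (rule log_potential_Fubini_edge[OF S \<xi>']; use nz ab in \<open>auto intro!: continuous_on_Complex continuous_intros\<close>)+
  have R: "e1 w - e2 w + \<i> * (e3 w - e4 w) = (if w \<in> box a b then 2 * of_real pi * \<i> else 0)"
    if "w \<notin> path_image (rectpath a b)" for w
    using rect_int_cauchy_kernel[OF ab that, of "1 / (\<xi>' - w)"]
    by (simp add: rect_int_def e1_def e2_def e3_def e4_def cauchy_diff_def)
  have "rect_int (log_potential S \<xi>') a b =
     ((\<integral>w. ?m w * e1 w \<partial>lborel) - (\<integral>w. ?m w * e2 w \<partial>lborel) + \<i> * ((\<integral>w. ?m w * e3 w \<partial>lborel) - (\<integral>w. ?m w * e4 w \<partial>lborel))) / of_real pi"
    unfolding rect_int_def E1 E2 E3 E4 by (simp add: field_simps)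
  also have "(\<integral>w. ?m w * e1 w \<partial>lborel) - (\<integral>w. ?m w * e2 w \<partial>lborel) + \<i> * ((\<integral>w. ?m w * e3 w \<partial>lborel) - (\<integral>w. ?m w * e4 w \<partial>lborel))
     = (\<integral>w. (?m w * e1 w - ?m w * e2 w) + \<i> * (?m w * e3 w - ?m w * e4 w) \<partial>lborel)"
    using E1(2) E2(2) E3(2) E4(2)
    by (subst Bochner_Integration.integral_add) (auto intro!: Bochner_Integration.integrable_diff integrable_mult_right)
  also have "\<dots> = (\<integral>w. (2 * of_real pi * \<i>) * (indicator (cbox a b) w *\<^sub>R (1 / cnj w)) \<partial>lborel)"
  proof (rule integral_cong_AE)
    show "(\<lambda>w. (?m w * e1 w - ?m w * e2 w) + \<i> * (?m w * e3 w - ?m w * e4 w)) \<in> borel_measurable lborel"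
      using E1(2) E2(2) E3(2) E4(2) by (auto dest!: borel_measurable_integrable)
    show "(\<lambda>w. (2 * of_real pi * \<i>) * (indicator (cbox a b) w *\<^sub>R (1 / cnj w))) \<in> borel_measurable lborel"
      by measurable
    show "AE w in lborel. (?m w * e1 w - ?m w * e2 w) + \<i> * (?m w * e3 w - ?m w * e4 w)
        = (2 * of_real pi * \<i>) * (indicator (cbox a b) w *\<^sub>R (1 / cnj w))"
      using AE_not_rect_boundary[OF less_imp_le[OF ab(1)] less_imp_le[OF ab(2)]]
    proof eventually_elim
      case (elim w)
      have "(?m w * e1 w - ?m w * e2 w) + \<i> * (?m w * e3 w - ?m w * e4 w) = ?m w * (e1 w - e2 w + \<i> * (e3 w - e4 w))"
        by (simp add: algebra_simps)
      also have "\<dots> = ?m w * (if w \<in> box a b then 2 * of_real pi * \<i> else 0)" by (simp only: R[OF elim])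
      also have "\<dots> = (2 * of_real pi * \<i>) * (indicator (cbox a b) w *\<^sub>R (1 / cnj w))"
      proof (cases "w \<in> box a b")
        case True
        then have "w \<in> cbox a b" using box_subset_cbox by blast
        then show ?thesis using True sub by (auto simp: log_density_def)
      next
        case False
        then have "w \<notin> cbox a b" using elim ab by (auto simp: path_image_rectpath_cbox_minus_box)
        then show ?thesis using False by simp
      qed
      finally show ?case .
    qed
  qed
  also have "\<dots> = (2 * of_real pi * \<i>) * (LINT w:cbox a b|lborel. 1 / cnj w)"
    unfolding set_lebesgue_integral_def by (rule Bochner_Integration.integral_mult_right_zero)
  finally show ?thesis by simp
qed

section \<open>Green's formula for ln |w|^2 and its comparison with the potential\<close>

lemma set_integral_cbox_complex:
  fixes f :: "complex \<Rightarrow> complex"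
  assumes f: "continuous_on (cbox a b) f"
  shows "(LINT w:cbox a b|lborel. f w) = (LINT y:{Im a..Im b}|lborel. LINT x:{Re a..Re b}|lborel. f (Complex x y))"
    and "(LINT w:cbox a b|lborel. f w) = (LINT x:{Re a..Re b}|lborel. LINT y:{Im a..Im b}|lborel. f (Complex x y))"
proof -
  define F where "F = (\<lambda>x y. indicator {Re a..Re b} x *\<^sub>R (indicator {Im a..Im b} y *\<^sub>R f (Complex x y)))"
  have int: "integrable lborel (\<lambda>w. indicator (cbox a b) w *\<^sub>R f w)"
    by (rule borel_integrable_compact[OF compact_cbox f])
  have m: "(\<lambda>(x, y). Complex x y) \<in> borel_measurable (lborel \<Otimes>\<^sub>M lborel)"
    unfolding lborel_prod case_prod_unfold
    by (simp, intro borel_measurable_continuous_onI continuous_on_Complex continuous_intros)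
  have ind: "(\<lambda>p. indicator (cbox a b) (case p of (x, y) \<Rightarrow> Complex x y) *\<^sub>R f (case p of (x, y) \<Rightarrow> Complex x y)) = case_prod F"
    by (auto simp: fun_eq_iff F_def in_cbox_complex_iff indicator_def)
  have mf: "(\<lambda>w. indicator (cbox a b) w *\<^sub>R f w) \<in> borel_measurable borel"
    using borel_measurable_integrable[OF int] by simp
  have "integrable (distr (lborel \<Otimes>\<^sub>M lborel) borel (\<lambda>(x, y). Complex x y)) (\<lambda>w. indicator (cbox a b) w *\<^sub>R f w)"
    using int unfolding lborel_complex .
  then have integ: "integrable (lborel \<Otimes>\<^sub>M lborel) (case_prod F)"
    unfolding integrable_distr_eq[OF m mf] ind .
  have eq: "(LINT w:cbox a b|lborel. f w) = integral\<^sup>L (lborel \<Otimes>\<^sub>M lborel) (case_prod F)"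
    unfolding set_lebesgue_integral_def lborel_complex integral_distr[OF m mf] ind ..
  have "(\<integral>y. F x y \<partial>lborel) = indicator {Re a..Re b} x *\<^sub>R (LINT y:{Im a..Im b}|lborel. f (Complex x y))" for x
    by (cases "x \<in> {Re a..Re b}") (simp_all add: F_def set_lebesgue_integral_def)
  then show "(LINT w:cbox a b|lborel. f w) = (LINT x:{Re a..Re b}|lborel. LINT y:{Im a..Im b}|lborel. f (Complex x y))"
    unfolding eq lborel_pair.integral_fst[OF integ, symmetric] by (simp add: set_lebesgue_integral_def)
  have "(\<integral>x. F x y \<partial>lborel) = indicator {Im a..Im b} y *\<^sub>R (LINT x:{Re a..Re b}|lborel. f (Complex x y))" for y
    by (cases "y \<in> {Im a..Im b}") (simp_all add: F_def set_lebesgue_integral_def)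
  then show "(LINT w:cbox a b|lborel. f w) = (LINT y:{Im a..Im b}|lborel. LINT x:{Re a..Re b}|lborel. f (Complex x y))"
    unfolding eq lborel_pair.integral_snd[OF integ, symmetric] by (simp add: set_lebesgue_integral_def)
qed

definition log_sq :: "complex \<Rightarrow> complex" where
  "log_sq w = of_real (ln ((cmod w)\<^sup>2))"

lemma continuous_on_log_sq: "continuous_on (- {0}) log_sq"
  unfolding log_sq_def by (intro continuous_intros) auto

text \<open>Green's formula for ln |w|^2, whose d-bar derivative is 1/cnj w; hence the same value as
  for the potential. It is obtained by integrating the two partial derivatives one variable at a
  time.\<close>

lemma rect_int_log_sq:
  assumes ab: "Re a < Re b" "Im a < Im b" and nz: "0 \<notin> cbox a b"
  shows "rect_int log_sq a b = 2 * \<i> * (LINT w:cbox a b|lborel. 1 / cnj w)"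
proof -
  \<comment> \<open>\<open>p\<close> and \<open>q\<close> are half the partial derivatives of ln
    |w|^2 in the real and imaginary directions.\<close>
  define p q where "p = (\<lambda>w. of_real (Re w / (cmod w)\<^sup>2) :: complex)" and "q = (\<lambda>w. of_real (Im w / (cmod w)\<^sup>2) :: complex)"
  have cp: "continuous_on (cbox a b) p" "continuous_on (cbox a b) q"
    unfolding p_def q_def by (intro continuous_intros; use nz in force)+
  have g: "1 / cnj w = p w + \<i> * q w" for w :: complex
  proof -
    have "1 / cnj w = w / (of_real ((cmod w)\<^sup>2))"
      by (cases "w = 0") (simp_all add: complex_norm_square[symmetric] complex_mult_cnj field_simps flip: complex_norm_square)
    also have "\<dots> = p w + \<i> * q w"
      by (subst (1) complex_eq[of w]) (simp add: p_def q_def add_divide_distrib)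
    finally show ?thesis .
  qed
  have nzx: "x\<^sup>2 + y\<^sup>2 > 0" if "x \<in> {Re a..Re b}" "y \<in> {Im a..Im b}" for x y
  proof -
    have "\<not> (x = 0 \<and> y = 0)" using nz that by (auto simp: in_cbox_complex_iff)
    then show ?thesis by (simp add: sum_power2_gt_zero_iff)
  qed
  have ls: "log_sq (Complex x y) = of_real (ln (x\<^sup>2 + y\<^sup>2))" for x y by (simp add: log_sq_def cmod_power2)
  have P: "2 * (LINT x:{Re a..Re b}|lborel. p (Complex x y)) = log_sq (Complex (Re b) y) - log_sq (Complex (Re a) y)"
    if y: "y \<in> {Im a..Im b}" for y
  proof -
    have "(LINT x:{Re a..Re b}|lborel. 2 * p (Complex x y)) = log_sq (Complex (Re b) y) - log_sq (Complex (Re a) y)"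
      unfolding set_lebesgue_integral_def
    proof (rule integral_FTC_Icc)
      fix x assume x: "Re a \<le> x" "x \<le> Re b"
      have "((\<lambda>x. ln (x\<^sup>2 + y\<^sup>2)) has_real_derivative 2 * (x / (x\<^sup>2 + y\<^sup>2))) (at x within {Re a..Re b})"
        using nzx[of x y] x y by (auto intro!: derivative_eq_intros simp: field_simps)
      then have "((\<lambda>x. of_real (ln (x\<^sup>2 + y\<^sup>2)) :: complex) has_vector_derivative of_real (2 * (x / (x\<^sup>2 + y\<^sup>2)))) (at x within {Re a..Re b})"
        by (rule has_vector_derivative_of_real)
      then show "((\<lambda>x. log_sq (Complex x y)) has_vector_derivative 2 * p (Complex x y)) (at x within {Re a..Re b})"
        by (simp add: ls p_def cmod_power2)
    next
      show "continuous_on {Re a..Re b} (\<lambda>x. 2 * p (Complex x y))"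
        using y by (intro continuous_intros continuous_on_compose2[OF cp(1)] continuous_on_Complex) (auto simp: in_cbox_complex_iff)
    qed (use ab in simp)
    then show ?thesis by simp
  qed
  have Q: "2 * (LINT y:{Im a..Im b}|lborel. q (Complex x y)) = log_sq (Complex x (Im b)) - log_sq (Complex x (Im a))"
    if y: "x \<in> {Re a..Re b}" for x
  proof -
    have "(LINT y:{Im a..Im b}|lborel. 2 * q (Complex x y)) = log_sq (Complex x (Im b)) - log_sq (Complex x (Im a))"
      unfolding set_lebesgue_integral_def
    proof (rule integral_FTC_Icc)
      fix t assume x: "Im a \<le> t" "t \<le> Im b"
      have "((\<lambda>t. ln (x\<^sup>2 + t\<^sup>2)) has_real_derivative 2 * (t / (x\<^sup>2 + t\<^sup>2))) (at t within {Im a..Im b})"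
        using nzx[of x t] x y by (auto intro!: derivative_eq_intros simp: field_simps)
      then have "((\<lambda>t. of_real (ln (x\<^sup>2 + t\<^sup>2)) :: complex) has_vector_derivative of_real (2 * (t / (x\<^sup>2 + t\<^sup>2)))) (at t within {Im a..Im b})"
        by (rule has_vector_derivative_of_real)
      then show "((\<lambda>t. log_sq (Complex x t)) has_vector_derivative 2 * q (Complex x t)) (at t within {Im a..Im b})"
        by (simp add: ls q_def cmod_power2)
    next
      show "continuous_on {Im a..Im b} (\<lambda>t. 2 * q (Complex x t))"
        using y by (intro continuous_intros continuous_on_compose2[OF cp(2)] continuous_on_Complex) (auto simp: in_cbox_complex_iff)
    qed (use ab in simp)
    then show ?thesis by simp
  qed
  have c: "continuous_on (path_image (rectpath a b)) log_sq"
    using path_image_rectpath_subset_cbox[of a b] ab nz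
    by (intro continuous_on_subset[OF continuous_on_log_sq]) auto
  note ce = continuous_on_rect_edges[OF c less_imp_le[OF ab(1)] less_imp_le[OF ab(2)], THEN borel_integrable_atLeastAtMost']
  have "2 * (LINT w:cbox a b|lborel. p w) = (LINT y:{Im a..Im b}|lborel. 2 * (LINT x:{Re a..Re b}|lborel. p (Complex x y)))"
    unfolding set_integral_cbox_complex(1)[OF cp(1)] by simp
  also have "\<dots> = (LINT y:{Im a..Im b}|lborel. log_sq (Complex (Re b) y) - log_sq (Complex (Re a) y))"
    by (rule set_lebesgue_integral_cong) (use P in auto)
  finally have P': "2 * (LINT w:cbox a b|lborel. p w) = (LINT y:{Im a..Im b}|lborel. log_sq (Complex (Re b) y)) - (LINT y:{Im a..Im b}|lborel. log_sq (Complex (Re a) y))"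
    using ce by (simp add: set_integral_diff)
  have "2 * (LINT w:cbox a b|lborel. q w) = (LINT x:{Re a..Re b}|lborel. 2 * (LINT y:{Im a..Im b}|lborel. q (Complex x y)))"
    unfolding set_integral_cbox_complex(2)[OF cp(2)] by simp
  also have "\<dots> = (LINT x:{Re a..Re b}|lborel. log_sq (Complex x (Im b)) - log_sq (Complex x (Im a)))"
    by (rule set_lebesgue_integral_cong) (use Q in auto)
  finally have Q': "2 * (LINT w:cbox a b|lborel. q w) = (LINT x:{Re a..Re b}|lborel. log_sq (Complex x (Im b))) - (LINT x:{Re a..Re b}|lborel. log_sq (Complex x (Im a)))"
    using ce by (simp add: set_integral_diff)
  have i: "set_integrable lborel (cbox a b) p" "set_integrable lborel (cbox a b) q"
    unfolding set_integrable_def by (intro borel_integrable_compact compact_cbox cp)+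
  have "(LINT w:cbox a b|lborel. 1 / cnj w) = (LINT w:cbox a b|lborel. p w) + \<i> * (LINT w:cbox a b|lborel. q w)"
    unfolding g using i by (simp add: set_integral_add)
  then have "2 * \<i> * (LINT w:cbox a b|lborel. 1 / cnj w) = \<i> * (2 * (LINT w:cbox a b|lborel. p w)) - (2 * (LINT w:cbox a b|lborel. q w))"
    by (simp add: algebra_simps)
  then show ?thesis unfolding P' Q' by (simp add: rect_int_def algebra_simps)
qed

lemma holomorphic_log_sq_minus_potential:
  assumes S: "open S" and \<xi>': "\<xi>' \<noteq> 0"
  shows "(\<lambda>w. log_sq w - log_potential S \<xi>' w) holomorphic_on S - {0}"
proof (rule Morera_rectangle)
  have Sb: "S \<in> sets borel" using S by simp
  show "open (S - {0})" using S by (simp add: open_Diff)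
  show "continuous_on (S - {0}) (\<lambda>w. log_sq w - log_potential S \<xi>' w)"
    by (intro continuous_intros continuous_on_subset[OF continuous_on_log_sq]
        continuous_on_subset[OF continuous_on_log_potential[OF Sb \<xi>']]) auto
  fix a b assume ab: "Re a < Re b" "Im a < Im b" and sub: "cbox a b \<subseteq> S - {0}"
  have im: "path_image (rectpath a b) \<subseteq> - {0}" using path_image_rectpath_subset_cbox[of a b] ab sub by auto
  have "rect_int (\<lambda>w. log_sq w - log_potential S \<xi>' w) a b = rect_int log_sq a b - rect_int (log_potential S \<xi>') a b"
    by (rule rect_int_diff) (use ab in \<open>auto intro: continuous_on_subset[OF continuous_on_log_sq im]
        continuous_on_subset[OF continuous_on_log_potential[OF Sb \<xi>'] im]\<close>)
  also have "\<dots> = 0"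
    using rect_int_log_sq[OF ab] rect_int_log_potential[OF Sb \<xi>' ab sub] sub by auto
  finally show "rect_int (\<lambda>w. log_sq w - log_potential S \<xi>' w) a b = 0" .
qed

lemma removable_singularity_o:
  assumes f: "f holomorphic_on U - {a}" and U: "open U"
    and lim: "((\<lambda>z. (z - a) * f z) \<longlongrightarrow> 0) (at a)"
  obtains g where "g holomorphic_on U" "\<And>z. z \<in> U - {a} \<Longrightarrow> g z = f z"
proof -
  define G where "G = (\<lambda>z. if z = a then 0 else (z - a) * f z)"
  have G: "G holomorphic_on U"
    unfolding G_def by (rule removable_singularity[OF _ U lim]) (intro holomorphic_intros f)
  show ?thesis
  proof (rule that[OF pole_lemma_open[OF G U, of a]])
    fix z assume "z \<in> U - {a}"
    then show "(if z = a then deriv G a else (G z - G a) / (z - a)) = f z" by (simp add: G_def)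
  qed
qed

text \<open>The estimate is too weak for boundedness, but \<open>o(1/r)\<close> at 0 and \<open>o(r)\<close> at infinity suffice to remove the singularities.\<close>

definition potential_bound :: "complex \<Rightarrow> real \<Rightarrow> real" where
  "potential_bound \<xi>' r = \<bar>ln (r\<^sup>2)\<bar> + (r + cmod \<xi>') powr (1/4) * (2 * sing_mass * (1 + (r / 2) powr (-3/4)) + two_point_const \<xi>')"

lemma log_sq_minus_potential_le:
  assumes S: "open S" and \<xi>': "\<xi>' \<noteq> 0" and w: "w \<noteq> 0"
  shows "cmod (log_sq w - log_potential S \<xi>' w) \<le> potential_bound \<xi>' (cmod w)"
proof -
  have Sb: "S \<in> sets borel" using S by simp
  have "cmod (log_potential S \<xi>' w) \<le> cmod (w - \<xi>') powr (1/4) * (two_point_const w + two_point_const \<xi>')"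
    by (rule log_potential_le[OF Sb w \<xi>'])
  also have "\<dots> \<le> (cmod w + cmod \<xi>') powr (1/4) * (two_point_const w + two_point_const \<xi>')"
    by (intro mult_right_mono powr_mono2 norm_triangle_ineq4 add_nonneg_nonneg) auto
  finally show ?thesis
    using norm_triangle_ineq4[of "log_sq w" "log_potential S \<xi>' w"]
    by (simp add: potential_bound_def two_point_const_def log_sq_def)
qed

lemma log_sq_minus_potential_at_0:
  assumes S: "open S" and \<xi>': "\<xi>' \<noteq> 0"
  shows "((\<lambda>w. (w - 0) * (log_sq w - log_potential S \<xi>' w)) \<longlongrightarrow> 0) (at 0)"
proof (rule Lim_null_comparison)
  show "\<forall>\<^sub>F w in at 0. cmod ((w - 0) * (log_sq w - log_potential S \<xi>' w)) \<le> cmod w * potential_bound \<xi>' (cmod w)"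
    using log_sq_minus_potential_le[OF S \<xi>'] by (auto simp: eventually_at_filter norm_mult intro!: mult_left_mono)
  have R: "cmod \<xi>' > 0" using \<xi>' by simp
  \<comment> \<open>The constants are replaced by real variables to leave a purely asymptotic claim;
    its slowest term is of order r^(1 - 3/4) = r^(1/4).\<close>
  have "((\<lambda>r::real. r * (\<bar>ln (r\<^sup>2)\<bar> + (r + R) powr (1/4) * (2 * M * (1 + (r / 2) powr (-3/4)) + T))) \<longlongrightarrow> 0) (at_right 0)"
    if "R > 0" for R M T :: real
    using that by real_asymp
  from this[OF R] have "((\<lambda>r. r * potential_bound \<xi>' r) \<longlongrightarrow> 0) (at_right 0)" unfolding potential_bound_def .
  moreover have "filterlim cmod (at_right 0) (at 0)"
    by (auto simp: filterlim_at eventually_at_filter intro!: tendsto_norm_zero)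
  ultimately show "((\<lambda>w. cmod w * potential_bound \<xi>' (cmod w)) \<longlongrightarrow> 0) (at 0)"
    by (rule filterlim_compose)
qed

lemma log_sq_minus_potential_at_infinity:
  assumes S: "open S" and \<xi>': "\<xi>' \<noteq> 0"
  shows "((\<lambda>w. (log_sq w - log_potential S \<xi>' w) / w) \<longlongrightarrow> 0) at_infinity"
proof (rule Lim_null_comparison)
  show "\<forall>\<^sub>F w in at_infinity. cmod ((log_sq w - log_potential S \<xi>' w) / w) \<le> potential_bound \<xi>' (cmod w) / cmod w"
    using eventually_not_equal_at_infinity[of 0]
  proof eventually_elim
    case (elim w)
    then show ?case using log_sq_minus_potential_le[OF S \<xi>' elim] by (simp add: norm_divide divide_right_mono)
  qed
  have R: "cmod \<xi>' > 0" using \<xi>' by simp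
  have "((\<lambda>r::real. (\<bar>ln (r\<^sup>2)\<bar> + (r + R) powr (1/4) * (2 * M * (1 + (r / 2) powr (-3/4)) + T)) / r) \<longlongrightarrow> 0) at_top"
    if "R > 0" for R M T :: real
    using that by real_asymp
  from this[OF R] have "((\<lambda>r. potential_bound \<xi>' r / r) \<longlongrightarrow> 0) at_top" unfolding potential_bound_def .
  then show "((\<lambda>w. potential_bound \<xi>' (cmod w) / cmod w) \<longlongrightarrow> 0) at_infinity"
    by (rule filterlim_compose[OF _ filterlim_norm_at_top])
qed

lemma log_potential_holomorphic_part:
  assumes S: "open S" and \<xi>': "\<xi>' \<noteq> 0"
  obtains A where "A holomorphic_on S" "\<And>w. w \<in> S - {0} \<Longrightarrow> log_sq w = A w + log_potential S \<xi>' w"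
proof -
  obtain A where A: "A holomorphic_on S" "\<And>w. w \<in> S - {0} \<Longrightarrow> A w = log_sq w - log_potential S \<xi>' w"
    using removable_singularity_o[OF holomorphic_log_sq_minus_potential[OF S \<xi>'] S log_sq_minus_potential_at_0[OF S \<xi>']] by blast
  show ?thesis by (rule that[OF A(1)]) (simp add: A(2))
qed

section \<open>The quadrature identity on the boundary\<close>

lemma filterlim_diff_const_at_infinity: "filterlim (\<lambda>w::complex. w - \<xi>) at_infinity at_infinity"
  using tendsto_add_filterlim_at_infinity'[OF filterlim_ident tendsto_const, of "- \<xi>"] by simp

lemma tendsto_cauchy_kernel_at_infinity: "((\<lambda>w::complex. 1 / (\<xi> - w)) \<longlongrightarrow> 0) at_infinity"
proof -
  have "((\<lambda>w. inverse (w - \<xi>)) \<longlongrightarrow> 0) at_infinity"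
    by (rule filterlim_compose[OF tendsto_inverse_0 filterlim_diff_const_at_infinity])
  then have "((\<lambda>w. - inverse (w - \<xi>)) \<longlongrightarrow> - 0) at_infinity" by (rule tendsto_minus)
  then show ?thesis by (simp add: inverse_eq_divide minus_divide_right)
qed

text \<open>Written as \<xi>/(\<xi> - w) - \<xi>'/(\<xi>' - w), the function vanishes at infinity
  and is admissible for an unbounded \<open>S\<close> too. Its zero at the origin reduces the weight
  to 1/cnj w, so the weighted integral converges even if 0 lies in \<open>S\<close>, and it is the
  potential.\<close>

lemma cauchy_diff_test_function:
  assumes \<xi>: "\<xi> \<notin> closure S" "\<xi> \<noteq> 0" and \<xi>': "\<xi>' \<notin> closure S" "\<xi>' \<noteq> 0" and S: "open S"
  shows "L1a_rho0 S inO (\<lambda>w. w * cauchy_diff \<xi>' \<xi> w)"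
    and "weighted_area_int S (\<lambda>w. w * cauchy_diff \<xi>' \<xi> w) = log_potential S \<xi>' \<xi>"
proof -
  let ?f = "\<lambda>w. w * cauchy_diff \<xi>' \<xi> w"
  have Sb: "S \<in> sets borel" using S by simp
  have eq: "indicator S w *\<^sub>R (?f w / of_real ((cmod w)\<^sup>2)) = log_density S w * cauchy_diff \<xi>' \<xi> w" for w
  proof (cases "w = 0")
    case False
    then have "w / of_real ((cmod w)\<^sup>2) = 1 / cnj w" by (simp add: complex_norm_square del: of_real_power)
    then have "?f w / of_real ((cmod w)\<^sup>2) = 1 / cnj w * cauchy_diff \<xi>' \<xi> w"
      by (metis times_divide_eq_left)
    then show ?thesis by (simp add: log_density_def indicator_def)
  qed (simp add: log_density_def)
  have "set_integrable lborel S (\<lambda>w. ?f w / of_real ((cmod w)\<^sup>2))"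
    unfolding set_integrable_def eq by (rule integrable_log_density_cauchy_diff[OF Sb \<xi>(2) \<xi>'(2)])
  moreover have "in_A S inO ?f"
    unfolding in_A_def
  proof (intro conjI impI exI[of _ 0])
    have nz: "\<xi> \<noteq> w" "\<xi>' \<noteq> w" if "w \<in> closure S" for w using \<xi> \<xi>' that by auto
    show "?f holomorphic_on S"
      unfolding cauchy_diff_def using nz closure_subset[of S] by (intro holomorphic_intros) auto
    show "continuous_on (closure S) ?f"
      unfolding cauchy_diff_def using nz by (intro continuous_intros) auto
    have "((\<lambda>w. \<xi> * (1 / (\<xi> - w)) - \<xi>' * (1 / (\<xi>' - w))) \<longlongrightarrow> \<xi> * 0 - \<xi>' * 0) at_infinity"
      by (intro tendsto_intros tendsto_cauchy_kernel_at_infinity)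
    then have l: "((\<lambda>w. \<xi> * (1 / (\<xi> - w)) - \<xi>' * (1 / (\<xi>' - w))) \<longlongrightarrow> 0) at_infinity" by simp
    show "(?f \<longlongrightarrow> 0) at_infinity"
    proof (rule Lim_transform_eventually[OF l])
      show "\<forall>\<^sub>F w in at_infinity. \<xi> * (1 / (\<xi> - w)) - \<xi>' * (1 / (\<xi>' - w)) = ?f w"
        using eventually_not_equal_at_infinity[of \<xi>] eventually_not_equal_at_infinity[of \<xi>']
      proof eventually_elim
        case (elim w)
        have "\<xi> * (1 / (\<xi> - w)) = 1 + w * (1 / (\<xi> - w))" "\<xi>' * (1 / (\<xi>' - w)) = 1 + w * (1 / (\<xi>' - w))"
          using elim by (simp_all add: field_simps)
        then show ?case by (simp add: cauchy_diff_def algebra_simps)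
      qed
    qed
  qed
  ultimately show "L1a_rho0 S inO ?f" by (simp add: L1a_rho0_def)
  show "weighted_area_int S ?f = log_potential S \<xi>' \<xi>"
    unfolding weighted_area_int_def log_potential_def set_lebesgue_integral_def eq ..
qed

lemma pos_bdry_cycle_closed_lipschitz:
  assumes "pos_bdry_cycle S inO \<Gamma>" "g \<in> set \<Gamma>"
  shows "closed_lipschitz g" "path_image g \<subseteq> frontier S"
  using assms by (auto simp: pos_bdry_cycle_def closed_lipschitz_def)

lemma pos_bdry_cycle_winding:
  assumes "pos_bdry_cycle S inO \<Gamma>" "z \<notin> frontier S"
  shows "(\<Sum>g\<leftarrow>\<Gamma>. winding_number g z) = (if z \<in> S then 1 else 0) - (if inO then 1 else 0)"
  using assms by (simp add: pos_bdry_cycle_def)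

text \<open>\<open>bdry_int\<close> uses an unspecified cycle; the later arguments hold for
  whichever one was chosen, since they rely only on the properties recorded in
  \<open>pos_bdry_cycle\<close>.\<close>

lemma bdry_int_SOME:
  assumes "\<exists>\<Gamma>. pos_bdry_cycle S inO \<Gamma>"
  obtains \<Gamma> where "pos_bdry_cycle S inO \<Gamma>"
    "\<And>f. bdry_int S inO f = (\<Sum>g\<leftarrow>\<Gamma>. contour_integral g f) / (2 * of_real pi * \<i>)"
  using someI_ex[OF assms] by (auto simp: bdry_int_def)

text \<open>Cauchy's formula for exterior points: \<open>h\<close> is rational with poles in
  \<open>S\<close> only, so its Cauchy integral over the cycle at an exterior point \<open>z\<close>
  is - h z. The polynomial parts of w/(\<xi> - w) and w/(\<xi>' - w) are both -1 and cancel in the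
  difference.\<close>

lemma LQD_potential_outside:
  assumes QD: "LQD S inO h" and q: "q \<noteq> 0" "\<And>z. poly q z = 0 \<Longrightarrow> z \<in> S"
    and h: "\<And>z. poly q z \<noteq> 0 \<Longrightarrow> h z = poly p z / poly q z"
    and deg: "inO \<or> p = 0 \<or> degree p < degree q"
    and \<xi>: "\<xi> \<notin> closure S" "\<xi> \<noteq> 0" and \<xi>': "\<xi>' \<notin> closure S" "\<xi>' \<noteq> 0"
  shows "log_potential S \<xi>' \<xi> = \<xi> * h \<xi> - \<xi>' * h \<xi>'"
proof -
  have S: "open S" using QD by (simp add: LQD_def rectifiable_domain_def)
  have ex: "\<exists>\<Gamma>. pos_bdry_cycle S inO \<Gamma>" using QD by (simp add: LQD_def rectifiable_domain_def)
  obtain \<Gamma> where G: "pos_bdry_cycle S inO \<Gamma>"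
    "\<And>f. bdry_int S inO f = (\<Sum>g\<leftarrow>\<Gamma>. contour_integral g f) / (2 * of_real pi * \<i>)"
    using bdry_int_SOME[OF ex] by blast
  note cl = pos_bdry_cycle_closed_lipschitz[OF G(1)]
  \<comment> \<open>Winding numbers about the poles of \<open>h\<close>, which lie in
    \<open>S\<close>, and about exterior points: 1 and 0 for a bounded domain, 0 and -1 for an
    unbounded one. The difference is -1 in both cases, so one computation serves both.\<close>
  define n0 :: complex where "n0 = 1 - (if inO then 1 else 0)"
  define n1 :: complex where "n1 = 0 - (if inO then 1 else 0)"
  have n: "n1 - n0 = - 1" by (simp add: n0_def n1_def)
  have SF: "z \<notin> frontier S" if "z \<in> S" for z
    using that S by (simp add: frontier_def interior_open)
  have CF: "z \<notin> frontier S" "z \<notin> S" if "z \<notin> closure S" for z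
    using that closure_subset by (auto simp: frontier_def)
  have cauchy: "(\<Sum>g\<leftarrow>\<Gamma>. contour_integral g (\<lambda>w. poly p w / poly q w / (w - z))) = 2 * of_real pi * \<i> * (- h z)"
    "\<forall>g\<in>set \<Gamma>. (\<lambda>w. poly p w / poly q w / (w - z)) contour_integrable_on g" if z: "z \<notin> closure S" for z
  proof -
    have qz: "poly q z \<noteq> 0" using q(2) CF(2)[OF z] by blast
    have a1: "closed_lipschitz g" if "g \<in> set \<Gamma>" for g using cl(1)[OF that] .
    have a2: "w \<notin> path_image g" if "g \<in> set \<Gamma>" "poly q w = 0 \<or> w = z" for g w
      using cl(2)[OF that(1)] SF q(2) CF(1)[OF z] that(2) by blast
    have a3: "(\<Sum>g\<leftarrow>\<Gamma>. winding_number g a) = n0" if "poly q a = 0" for a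
      using pos_bdry_cycle_winding[OF G(1) SF[OF q(2)[OF that]]] q(2)[OF that] by (simp add: n0_def)
    have a4: "(\<Sum>g\<leftarrow>\<Gamma>. winding_number g z) = n1"
      using pos_bdry_cycle_winding[OF G(1) CF(1)[OF z]] CF(2)[OF z] by (simp add: n1_def)
    have a5: "n0 = 0 \<or> p = 0 \<or> degree p < degree q" using deg by (auto simp: n0_def)
    have "(\<Sum>g\<leftarrow>\<Gamma>. contour_integral g (\<lambda>w. poly p w / poly q w / (w - z))) = 2 * of_real pi * \<i> * ((n1 - n0) * (poly p z / poly q z))"
      "\<forall>g\<in>set \<Gamma>. (\<lambda>w. poly p w / poly q w / (w - z)) contour_integrable_on g"
      by (rule rational_cauchy_cycle[OF q(1) a1 a2 a3 a4 qz a5 refl]; assumption)+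
    then show "(\<Sum>g\<leftarrow>\<Gamma>. contour_integral g (\<lambda>w. poly p w / poly q w / (w - z))) = 2 * of_real pi * \<i> * (- h z)"
      "\<forall>g\<in>set \<Gamma>. (\<lambda>w. poly p w / poly q w / (w - z)) contour_integrable_on g"
      using n h[OF qz] by auto
  qed
  let ?K = "\<lambda>z w. poly p w / poly q w / (w - z)"
  have ci: "contour_integral g (\<lambda>w. w * cauchy_diff \<xi>' \<xi> w * h w) =
      \<xi>' * contour_integral g (?K \<xi>') - \<xi> * contour_integral g (?K \<xi>)" if g: "g \<in> set \<Gamma>" for g
  proof (rule contour_integral_unique)
    have "((\<lambda>w. \<xi>' * ?K \<xi>' w - \<xi> * ?K \<xi> w) has_contour_integral
        \<xi>' * contour_integral g (?K \<xi>') - \<xi> * contour_integral g (?K \<xi>)) g"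
      using cauchy(2)[OF \<xi>(1)] cauchy(2)[OF \<xi>'(1)] g
      by (intro has_contour_integral_diff has_contour_integral_lmul has_contour_integral_integral) auto
    then show "((\<lambda>w. w * cauchy_diff \<xi>' \<xi> w * h w) has_contour_integral
        \<xi>' * contour_integral g (?K \<xi>') - \<xi> * contour_integral g (?K \<xi>)) g"
    proof (rule has_contour_integral_eq)
      fix w assume "w \<in> path_image g"
      then have w: "w \<in> frontier S" using cl(2)[OF g] by blast
      then have nz: "poly q w \<noteq> 0" "w \<noteq> \<xi>" "w \<noteq> \<xi>'" using SF q(2) CF(1) \<xi> \<xi>' by blast+
      have "w / (\<xi> - w) - w / (\<xi>' - w) = \<xi>' / (w - \<xi>') - \<xi> / (w - \<xi>)"
      proof -
        have "w / (\<xi> - w) = - 1 - \<xi> / (w - \<xi>)" "w / (\<xi>' - w) = - 1 - \<xi>' / (w - \<xi>')"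
          using nz by (simp_all add: field_simps)
        then show ?thesis by simp
      qed
      then have "w * cauchy_diff \<xi>' \<xi> w * h w = (\<xi>' / (w - \<xi>') - \<xi> / (w - \<xi>)) * (poly p w / poly q w)"
        using h[OF nz(1)] by (simp add: cauchy_diff_def right_diff_distrib)
      moreover have "\<xi>' * ?K \<xi>' w - \<xi> * ?K \<xi> w = (\<xi>' / (w - \<xi>') - \<xi> / (w - \<xi>)) * (poly p w / poly q w)"
        by (simp add: divide_inverse algebra_simps)
      ultimately show "\<xi>' * ?K \<xi>' w - \<xi> * ?K \<xi> w = w * cauchy_diff \<xi>' \<xi> w * h w"
        by simp
    qed
  qed
  have "(\<Sum>g\<leftarrow>\<Gamma>. contour_integral g (\<lambda>w. w * cauchy_diff \<xi>' \<xi> w * h w)) =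
      (\<Sum>g\<leftarrow>\<Gamma>. \<xi>' * contour_integral g (?K \<xi>') - \<xi> * contour_integral g (?K \<xi>))"
    using ci by (intro arg_cong[of _ _ sum_list] map_cong) auto
  also have "\<dots> = \<xi>' * (\<Sum>g\<leftarrow>\<Gamma>. contour_integral g (?K \<xi>')) - \<xi> * (\<Sum>g\<leftarrow>\<Gamma>. contour_integral g (?K \<xi>))"
    by (simp add: sum_list_subtractf sum_list_const_mult)
  also have "\<dots> = 2 * of_real pi * \<i> * (\<xi> * h \<xi> - \<xi>' * h \<xi>')"
    unfolding cauchy(1)[OF \<xi>(1)] cauchy(1)[OF \<xi>'(1)] by (simp add: algebra_simps)
  finally have "bdry_int S inO (\<lambda>w. w * cauchy_diff \<xi>' \<xi> w * h w) = \<xi> * h \<xi> - \<xi>' * h \<xi>'"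
    unfolding G(2) by simp
  then show ?thesis
    using QD cauchy_diff_test_function(1)[OF \<xi> \<xi>' S, of inO] cauchy_diff_test_function(2)[OF \<xi> \<xi>' S] unfolding LQD_def by metis
qed

text \<open>The boundary statement is phrased with neighbourhoods of the frontier, as
  \<open>A\<close> is not claimed to have boundary values. The growth clause for \<open>A\<close>
  later removes the singularity at the centre of the disc for an exterior map.\<close>

lemma LQD_boundary_identity:
  assumes QD: "LQD S inO h" and nU: "closure S \<noteq> UNIV"
  obtains A p q where "A holomorphic_on S" "q \<noteq> 0" "\<And>z. poly q z = 0 \<Longrightarrow> z \<in> S"
    "\<And>z. poly q z \<noteq> 0 \<Longrightarrow> h z = poly p z / poly q z"
    "\<And>e. e > 0 \<Longrightarrow> \<exists>V. open V \<and> frontier S \<subseteq> V \<and>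
       (\<forall>w\<in>V \<inter> S. w \<noteq> 0 \<and> poly q w \<noteq> 0 \<and> cmod (log_sq w - A w - w * h w) < e)"
    "inO \<Longrightarrow> ((\<lambda>w. A w / w) \<longlongrightarrow> 0) at_infinity"
proof -
  have S: "open S" and F0: "0 \<notin> frontier S" and int: "interior (closure S) = S"
    and ext: "inO \<Longrightarrow> \<exists>R. {z. R < cmod z} \<subseteq> S"
    using QD by (auto simp: LQD_def rectifiable_domain_def)
  have "\<exists>p q. q \<noteq> 0 \<and> (\<forall>z. poly q z = 0 \<longrightarrow> z \<in> S) \<and> (inO \<or> p = 0 \<or> degree p < degree q) \<and>
       (\<forall>z. poly q z \<noteq> 0 \<longrightarrow> h z = poly p z / poly q z)"
  proof (cases inO)
    case True
    then have "rat_poles_in S h" using QD by (simp add: LQD_def)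
    then show ?thesis using True unfolding rat_poles_in_def by blast
  next
    case False
    then have "rat0_poles_in S h" using QD by (simp add: LQD_def)
    then show ?thesis unfolding rat0_poles_in_def by blast
  qed
  then obtain p q where q: "q \<noteq> 0" "\<And>z. poly q z = 0 \<Longrightarrow> z \<in> S"
    and deg: "inO \<or> p = 0 \<or> degree p < degree q" and h: "\<And>z. poly q z \<noteq> 0 \<Longrightarrow> h z = poly p z / poly q z"
    by blast
  \<comment> \<open>The origin is left out because the potential is controlled only away from 0;
    boundary points remain limits of \<open>T\<close>, as 0 is not on the frontier.\<close>
  define T where "T = - closure S - {0}"
  have oT: "open (- closure S)" by (rule open_Compl[OF closed_closure])
  have ne: "- closure S \<noteq> {}" using nU by auto
  have "\<not> finite (- closure S)" using oT ne finite_imp_not_open by blast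
  then obtain \<xi>' where "\<xi>' \<in> - closure S" "\<xi>' \<noteq> 0"
    by (metis finite.emptyI finite.insertI finite_subset insertI1 subsetI)
  then have \<xi>': "\<xi>' \<notin> closure S" "\<xi>' \<noteq> 0" by auto
  let ?u = "log_potential S \<xi>'"
  define P where "P = (\<lambda>w. w * (poly p w / poly q w))"
  define E where "E = (\<lambda>w. ?u w - (P w - P \<xi>'))"
  define O' where "O' = - ({0} \<union> {z. poly q z = 0})"
  have oO: "open O'" unfolding O'_def using poly_roots_finite[OF q(1)] by (intro open_Compl finite_imp_closed) auto
  have Sb: "S \<in> sets borel" using S by simp
  have cE: "continuous_on O' E"
    unfolding E_def P_def
    by (intro continuous_intros continuous_on_subset[OF continuous_on_log_potential[OF Sb \<xi>'(2)]])
       (auto simp: O'_def)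
  have CS: "z \<notin> S" if "z \<notin> closure S" for z using that closure_subset by blast
  have ET: "E \<xi> = 0" if "\<xi> \<in> T" for \<xi>
  proof -
    have \<xi>: "\<xi> \<notin> closure S" "\<xi> \<noteq> 0" using that by (auto simp: T_def)
    have "?u \<xi> = \<xi> * h \<xi> - \<xi>' * h \<xi>'" by (rule LQD_potential_outside[OF QD q h deg \<xi> \<xi>'])
    moreover have "h \<xi> = poly p \<xi> / poly q \<xi>" "h \<xi>' = poly p \<xi>' / poly q \<xi>'"
      using h q(2) CS \<xi> \<xi>' by blast+
    ultimately show ?thesis by (simp add: E_def P_def)
  qed
  have FO: "frontier S \<subseteq> O'"
    using F0 q(2) S by (auto simp: O'_def frontier_def interior_open)
  have EF: "E x = 0" if x: "x \<in> frontier S" for x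
  proof -
    \<comment> \<open>Regularity of the open set \<open>S\<close> makes every boundary point a limit
      of exterior points, where \<open>E\<close> vanishes.\<close>
    have "x \<notin> interior (closure S)" using x int S by (simp add: frontier_def interior_open)
    then have "x \<in> closure (- closure S)" by (simp add: closure_complement)
    moreover have "closure (- closure S) \<subseteq> closure T \<union> {0}"
    proof -
      have "- closure S \<subseteq> closure T \<union> {0}" using closure_subset[of T] by (auto simp: T_def)
      then show ?thesis by (intro closure_minimal closed_Un) auto
    qed
    moreover have "x \<noteq> 0" using x F0 by auto
    ultimately have "x \<in> closure T" by blast
    then obtain X where X: "\<And>n. X n \<in> T" "X \<longlonglongrightarrow> x" unfolding closure_sequential by blast
    have "isCont E x" using cE oO x FO by (simp add: continuous_on_eq_continuous_at subset_iff)
    then have "(\<lambda>n. E (X n)) \<longlonglongrightarrow> E x" using X(2) by (rule isCont_tendsto_compose)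
    then show ?thesis using ET X(1) by (simp add: LIMSEQ_const_iff)
  qed
  obtain A where A: "A holomorphic_on S" "\<And>w. w \<in> S - {0} \<Longrightarrow> log_sq w = A w + ?u w"
    using log_potential_holomorphic_part[OF S \<xi>'(2)] by blast
  show ?thesis
  \<comment> \<open>The constant by which the potential differs from w h(w) outside is absorbed into
    the holomorphic part.\<close>
  proof (rule that[of "\<lambda>w. A w - P \<xi>'" q p])
    show "(\<lambda>w. A w - P \<xi>') holomorphic_on S" by (intro holomorphic_intros A)
    fix e :: real assume e: "e > 0"
    define V where "V = O' \<inter> (\<lambda>w. cmod (E w)) -` {..<e}"
    have "open V" unfolding V_def
      by (intro continuous_open_preimage oO open_lessThan continuous_intros cE)
    moreover have "frontier S \<subseteq> V" using FO EF e by (auto simp: V_def)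
    moreover have "w \<noteq> 0 \<and> poly q w \<noteq> 0 \<and> cmod (log_sq w - (A w - P \<xi>') - w * h w) < e" if w: "w \<in> V \<inter> S" for w
    proof -
      have nz: "w \<noteq> 0" "poly q w \<noteq> 0" "cmod (E w) < e" using w by (auto simp: V_def O'_def)
      have "log_sq w - (A w - P \<xi>') - w * h w = E w"
        using A(2)[of w] w nz h[OF nz(2)] by (simp add: E_def P_def)
      then show ?thesis using nz by simp
    qed
    ultimately show "\<exists>V. open V \<and> frontier S \<subseteq> V \<and>
       (\<forall>w\<in>V \<inter> S. w \<noteq> 0 \<and> poly q w \<noteq> 0 \<and> cmod (log_sq w - (A w - P \<xi>') - w * h w) < e)" by blast
  next
    assume inO
    then obtain R where R: "{z. R < cmod z} \<subseteq> S" using ext by blast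
    have "((\<lambda>w. (log_sq w - ?u w) / w - P \<xi>' * inverse w) \<longlongrightarrow> 0 - P \<xi>' * 0) at_infinity"
      by (intro tendsto_intros log_sq_minus_potential_at_infinity[OF S \<xi>'(2)] tendsto_inverse_0)
    then have l: "((\<lambda>w. (log_sq w - ?u w) / w - P \<xi>' * inverse w) \<longlongrightarrow> 0) at_infinity" by simp
    show "((\<lambda>w. (A w - P \<xi>') / w) \<longlongrightarrow> 0) at_infinity"
    proof (rule Lim_transform_eventually[OF l])
      show "\<forall>\<^sub>F w in at_infinity. (log_sq w - ?u w) / w - P \<xi>' * inverse w = (A w - P \<xi>') / w"
        unfolding eventually_at_infinity
      proof (intro exI allI impI)
        fix w assume w: "\<bar>R\<bar> + 1 \<le> cmod w"
        then have "w \<in> S - {0}" using R by auto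
        then show "(log_sq w - ?u w) / w - P \<xi>' * inverse w = (A w - P \<xi>') / w"
          using A(2)[of w] by (simp add: divide_inverse left_diff_distrib)
      qed
    qed
  qed (use q h in auto)
qed

section \<open>Analysis near the unit circle\<close>

text \<open>Approach to the circle from inside, uniform in the angle: the mode of convergence that
  the maximum principle needs, and one that presupposes no individual boundary limits.\<close>

abbreviation circle_filter :: "complex filter" where
  "circle_filter \<equiv> filtercomap cmod (at_left 1)"

lemma eventually_circle_filter:
  "eventually P circle_filter \<longleftrightarrow> (\<exists>\<rho><1. \<forall>z. \<rho> < cmod z \<longrightarrow> cmod z < 1 \<longrightarrow> P z)"
proof
  assume "eventually P circle_filter"
  then obtain Q where "eventually Q (at_left (1::real))" "\<And>z. Q (cmod z) \<Longrightarrow> P z"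
    by (auto simp: eventually_filtercomap)
  then show "\<exists>\<rho><1. \<forall>z. \<rho> < cmod z \<longrightarrow> cmod z < 1 \<longrightarrow> P z"
    by (auto simp: eventually_at_left_field)
next
  assume "\<exists>\<rho><1. \<forall>z. \<rho> < cmod z \<longrightarrow> cmod z < 1 \<longrightarrow> P z"
  then obtain \<rho> where "\<rho> < 1" "\<forall>z. \<rho> < cmod z \<longrightarrow> cmod z < 1 \<longrightarrow> P z" by blast
  then show "eventually P circle_filter"
    unfolding eventually_filtercomap eventually_at_left_field
    by (intro exI[of _ "\<lambda>r. \<rho> < r \<and> r < 1"]) auto
qed

lemma circle_neighbourhood:
  assumes V: "open V" "sphere 0 1 \<subseteq> V"
  obtains \<delta> :: real where "0 < \<delta>" "\<delta> < 1" "\<And>z::complex. 1 - \<delta> < cmod z \<Longrightarrow> cmod z < 1 + \<delta> \<Longrightarrow> z \<in> V"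
proof -
  obtain e where e: "e > 0" "(\<Union>x\<in>sphere 0 1. ball x e) \<subseteq> V"
    using compact_subset_open_imp_ball_epsilon_subset[OF compact_sphere V] by blast
  show ?thesis
  proof (rule that[of "min e (1/2)"])
    fix z :: complex assume z: "1 - min e (1/2) < cmod z" "cmod z < 1 + min e (1/2)"
    then have z0: "cmod z > 0" by auto
    have "z - z / of_real (cmod z) = (z / of_real (cmod z)) * of_real (cmod z - 1)"
      using z0 by (simp add: right_diff_distrib)
    then have "cmod (z - z / of_real (cmod z)) = \<bar>cmod z - 1\<bar>"
      using z0 by (simp add: norm_mult norm_divide del: of_real_diff)
    then have "z \<in> ball (z / of_real (cmod z)) e" using z by (auto simp: dist_norm norm_minus_commute)
    moreover have "z / of_real (cmod z) \<in> sphere 0 1" using z0 by (simp add: norm_divide)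
    ultimately show "z \<in> V" using e by blast
  qed (use e in auto)
qed

lemma eventually_circle_filter_open:
  assumes "open V" "sphere 0 1 \<subseteq> V"
  shows "eventually (\<lambda>z. z \<in> V) circle_filter"
proof -
  obtain \<delta> where "0 < \<delta>" "\<And>z. 1 - \<delta> < cmod z \<Longrightarrow> cmod z < 1 + \<delta> \<Longrightarrow> z \<in> V"
    using circle_neighbourhood[OF assms] by metis
  then show ?thesis unfolding eventually_circle_filter by (intro exI[of _ "1 - \<delta>"]) auto
qed

lemma tendsto_circle_filter_zero:
  fixes k :: "complex \<Rightarrow> complex"
  assumes V: "open V" "sphere 0 1 \<subseteq> V" and k: "continuous_on V k" and z: "\<And>z. cmod z = 1 \<Longrightarrow> k z = 0"
  shows "(k \<longlongrightarrow> 0) circle_filter"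
proof (rule tendstoI)
  fix e :: real assume e: "e > 0"
  have "open (V \<inter> k -` ball 0 e)" by (rule continuous_open_preimage[OF k V(1) open_ball])
  moreover have "sphere 0 1 \<subseteq> V \<inter> k -` ball 0 e" using V(2) z e by auto
  ultimately have "eventually (\<lambda>z. z \<in> V \<inter> k -` ball 0 e) circle_filter"
    by (rule eventually_circle_filter_open)
  then show "eventually (\<lambda>z. dist (k z) 0 < e) circle_filter"
    by (rule eventually_mono) (simp add: dist_commute)
qed

lemma circle_filter_le_at:
  assumes "cmod \<xi> = 1"
  shows "at \<xi> within ball 0 1 \<le> circle_filter"
proof (rule filter_leI)
  fix P assume "eventually P circle_filter"
  then obtain \<rho> where r: "\<rho> < 1" "\<And>z. \<rho> < cmod z \<Longrightarrow> cmod z < 1 \<Longrightarrow> P z" by (auto simp: eventually_circle_filter)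
  show "eventually P (at \<xi> within ball 0 1)"
    unfolding eventually_at
  proof (intro exI[of _ "1 - \<rho>"] conjI ballI impI)
    fix x assume x: "x \<in> ball 0 1" "x \<noteq> \<xi> \<and> dist x \<xi> < 1 - \<rho>"
    have "cmod \<xi> \<le> cmod x + dist x \<xi>" using norm_triangle_sub[of \<xi> x] by (simp add: dist_norm norm_minus_commute)
    then show "P x" using x assms by (intro r) auto
  qed (use r in auto)
qed

lemma trivial_limit_at_within_disc:
  assumes "cmod \<xi> = 1"
  shows "at \<xi> within ball 0 1 \<noteq> bot"
proof -
  have "\<xi> islimpt ball 0 1"
    using islimpt_ball[of \<xi> 0 1] assms by simp
  then show ?thesis by (simp add: trivial_limit_within)
qed

text \<open>exp(a) and exp(-a) have modulus at most exp(e) on circles close to the unit circle,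
  hence inside by the maximum principle. Letting e tend to 0 gives Re a = 0 throughout, and the open
  mapping theorem makes \<open>a\<close> constant.\<close>

lemma constant_if_Re_vanishes_at_circle:
  assumes a: "a holomorphic_on ball 0 1" and lim: "((\<lambda>z. Re (a z)) \<longlongrightarrow> 0) circle_filter"
  shows "\<exists>c. \<forall>z\<in>ball 0 1. a z = c"
proof -
  have le: "Re (s * a z) \<le> e" if z: "z \<in> ball 0 1" and e: "e > 0" and s: "s = 1 \<or> s = - 1" for z :: complex and e :: real and s :: complex
  proof -
    have "eventually (\<lambda>z. \<bar>Re (a z)\<bar> < e) circle_filter" using tendstoD[OF lim e] by simp
    then obtain \<rho> where r: "\<rho> < 1" "\<And>z. \<rho> < cmod z \<Longrightarrow> cmod z < 1 \<Longrightarrow> \<bar>Re (a z)\<bar> < e"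
      by (auto simp: eventually_circle_filter)
    obtain r' where r': "max \<rho> (cmod z) < r'" "r' < 1"
      using dense[of "max \<rho> (cmod z)" 1] r z by auto
    have r'0: "r' > 0" using r' norm_ge_zero[of z] by linarith
    have "cmod (exp (s * a z)) \<le> exp e"
    proof (rule maximum_modulus_frontier[of "\<lambda>z. exp (s * a z)" "ball 0 r'"])
      show "(\<lambda>z. exp (s * a z)) holomorphic_on interior (ball 0 r')"
        using r' by (intro holomorphic_intros holomorphic_on_subset[OF a]) auto
      show "continuous_on (closure (ball 0 r')) (\<lambda>z. exp (s * a z))"
        using r' r'0 by (intro continuous_intros continuous_on_subset[OF holomorphic_on_imp_continuous_on[OF a]]) auto
      fix w :: complex assume "w \<in> frontier (ball 0 r')"
      then have "cmod w = r'" using r'0 by simp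
      then have "\<bar>Re (a w)\<bar> < e" using r' by (intro r) auto
      then show "cmod (exp (s * a w)) \<le> exp e" using s by auto
    qed (use r' in auto)
    then show ?thesis by simp
  qed
  have Re0: "Re (a z) = 0" if "z \<in> ball 0 1" for z
  proof -
    have "Re (a z) \<le> 0" by (rule field_le_epsilon) (use le[OF that, of _ 1] in simp)
    moreover have "- Re (a z) \<le> 0" by (rule field_le_epsilon) (use le[OF that, of _ "-1"] in simp)
    ultimately show ?thesis by simp
  qed
  have "a constant_on ball 0 1"
  proof (rule ccontr)
    assume "\<not> a constant_on ball 0 1"
    then have "open (a ` ball 0 1)" by (intro open_mapping_thm[OF a]) auto
    moreover have "a 0 \<in> a ` ball 0 1" by auto
    ultimately obtain e where e: "e > 0" "ball (a 0) e \<subseteq> a ` ball 0 1" by (meson open_contains_ball)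
    have "a 0 + of_real (e / 2) \<in> ball (a 0) e" using e by (simp add: dist_norm)
    then obtain w where "w \<in> ball 0 1" "a 0 + of_real (e / 2) = a w" using e by blast
    then have "Re (a 0 + of_real (e / 2)) = 0" using Re0 by simp
    then show False using e Re0[of 0] by simp
  qed
  then show ?thesis by (simp add: constant_on_def)
qed

text \<open>Both the real part of \<open>g - N + (g - k)\<close> and the imaginary part of \<open>g - N - (g - k)\<close>
  vanish on the circle, which makes both functions constant.\<close>

lemma constant_difference_from_circle_values:
  assumes g: "g holomorphic_on ball 0 1" and N: "N holomorphic_on ball 0 1" and k: "k holomorphic_on ball 0 1"
    and lim: "((\<lambda>z. of_real (2 * Re (g z)) - N z - cnj (k z)) \<longlongrightarrow> 0) circle_filter"
  shows "\<exists>c. \<forall>z\<in>ball 0 1. g z - k z = c"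
proof -
  let ?e = "\<lambda>z. of_real (2 * Re (g z)) - N z - cnj (k z)"
  have e: "?e z = (g z - N z) + cnj (g z - k z)" for z
    by (simp add: complex_eq_iff)
  have "((\<lambda>z. Re (?e z)) \<longlongrightarrow> Re 0) circle_filter" by (intro tendsto_intros lim)
  then have "((\<lambda>z. Re ((g z - N z) + (g z - k z))) \<longlongrightarrow> 0) circle_filter"
    unfolding e by simp
  then have "\<exists>c. \<forall>z\<in>ball 0 1. (g z - N z) + (g z - k z) = c"
    by (intro constant_if_Re_vanishes_at_circle holomorphic_intros g N k)
  then obtain c where c: "\<And>z. z \<in> ball 0 1 \<Longrightarrow> (g z - N z) + (g z - k z) = c" by blast
  have "((\<lambda>z. Im (?e z)) \<longlongrightarrow> Im 0) circle_filter" by (intro tendsto_intros lim)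
  then have "((\<lambda>z. Re (- \<i> * ((g z - N z) - (g z - k z)))) \<longlongrightarrow> 0) circle_filter"
    unfolding e by simp
  then have "\<exists>d. \<forall>z\<in>ball 0 1. - \<i> * ((g z - N z) - (g z - k z)) = d"
    by (intro constant_if_Re_vanishes_at_circle holomorphic_intros g N k)
  then obtain d where d: "\<And>z. z \<in> ball 0 1 \<Longrightarrow> - \<i> * ((g z - N z) - (g z - k z)) = d" by blast
  have "g z - k z = (c - \<i> * d) / 2" if "z \<in> ball 0 1" for z
    unfolding c[OF that, symmetric] d[OF that, symmetric] by (simp add: algebra_simps)
  then show ?thesis by blast
qed

text \<open>Substituting 1/z carries poles in the open disc to poles outside the closed disc. The
  numerator is reversed and multiplied by the power of z by which its degree falls short of that of
  \<open>q\<close>; properness makes this power positive, whence the zero at 0.\<close>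

lemma rational_inversion:
  fixes p q :: "complex poly"
  assumes q: "q \<noteq> 0" "\<And>z. poly q z = 0 \<Longrightarrow> z \<in> ball 0 1" and deg: "p = 0 \<or> degree p < degree q"
  obtains P Q where "\<And>z. cmod z \<le> 1 \<Longrightarrow> poly Q z \<noteq> 0" "poly P 0 = 0"
    "\<And>z. z \<noteq> 0 \<Longrightarrow> poly p (1 / z) / poly q (1 / z) = poly P z / poly Q z"
proof (cases "p = 0")
  case True
  show ?thesis by (rule that[of 1 0]) (auto simp: True)
next
  case False
  then have d: "degree p < degree q" using deg by blast
  let ?P = "monom 1 (degree q - degree p) * reflect_poly p"
  let ?Q = "reflect_poly q"
  have eq: "poly ?Q z = z ^ degree q * poly q (1 / z)" "poly ?P z = z ^ degree q * poly p (1 / z)" if "z \<noteq> 0" for z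
  proof -
    show "poly ?Q z = z ^ degree q * poly q (1 / z)" using poly_reflect_poly_nz[OF that, of q] by (simp add: inverse_eq_divide)
    have "poly ?P z = z ^ (degree q - degree p) * (z ^ degree p * poly p (1 / z))"
      using poly_reflect_poly_nz[OF that, of p] by (simp add: inverse_eq_divide poly_monom)
    also have "\<dots> = z ^ degree q * poly p (1 / z)" using d by (simp add: mult.assoc[symmetric] power_add[symmetric])
    finally show "poly ?P z = z ^ degree q * poly p (1 / z)" .
  qed
  show ?thesis
  proof (rule that[of ?Q ?P])
    fix z :: complex assume z: "cmod z \<le> 1"
    show "poly ?Q z \<noteq> 0"
    proof (cases "z = 0")
      case False
      then have "cmod (1 / z) \<ge> 1" using z by (simp add: norm_divide)
      then have "poly q (1 / z) \<noteq> 0" using q(2)[of "1 / z"] by (auto simp del: norm_divide)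
      then show ?thesis using eq(1)[OF False] False by simp
    qed (use q in simp)
  qed (use d eq in \<open>auto simp: poly_monom\<close>)
qed

text \<open>Meromorphic with finitely many poles in the disc, without any condition on the circle.
  \<open>D\<close> is the disc, or the punctured disc for a map with a pole at the centre. Values at
  the roots of \<open>q\<close> are left free, which makes the convention for division by zero
  harmless.\<close>

definition mero_disc :: "complex set \<Rightarrow> (complex \<Rightarrow> complex) \<Rightarrow> bool" where
  "mero_disc D f \<longleftrightarrow> (\<exists>F q. F holomorphic_on ball 0 1 \<and> q \<noteq> 0 \<and> (\<forall>z. poly q z = 0 \<longrightarrow> z \<in> ball 0 1) \<and>
     (\<forall>z\<in>D. poly q z \<noteq> 0 \<longrightarrow> f z = F z / poly q z))"

lemma mero_disc_const: "mero_disc D (\<lambda>_. c)"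
  unfolding mero_disc_def by (intro exI[of _ "\<lambda>_. c"] exI[of _ 1]) auto

lemma mero_disc_mult:
  assumes "mero_disc D f" "mero_disc D g"
  shows "mero_disc D (\<lambda>z. f z * g z)"
proof -
  obtain F q where 1: "F holomorphic_on ball 0 1" "q \<noteq> 0" "\<forall>z. poly q z = 0 \<longrightarrow> z \<in> ball 0 1"
     "\<forall>z\<in>D. poly q z \<noteq> 0 \<longrightarrow> f z = F z / poly q z" using assms(1) unfolding mero_disc_def by blast
  obtain G r where 2: "G holomorphic_on ball 0 1" "r \<noteq> 0" "\<forall>z. poly r z = 0 \<longrightarrow> z \<in> ball 0 1"
     "\<forall>z\<in>D. poly r z \<noteq> 0 \<longrightarrow> g z = G z / poly r z" using assms(2) unfolding mero_disc_def by blast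
  show ?thesis unfolding mero_disc_def
    by (rule exI[of _ "\<lambda>z. F z * G z"], rule exI[of _ "q * r"])
       (use 1 2 in \<open>auto intro!: holomorphic_intros\<close>)
qed

lemma mero_disc_add:
  assumes "mero_disc D f" "mero_disc D g"
  shows "mero_disc D (\<lambda>z. f z + g z)"
proof -
  obtain F q where 1: "F holomorphic_on ball 0 1" "q \<noteq> 0" "\<forall>z. poly q z = 0 \<longrightarrow> z \<in> ball 0 1"
     "\<forall>z\<in>D. poly q z \<noteq> 0 \<longrightarrow> f z = F z / poly q z" using assms(1) unfolding mero_disc_def by blast
  obtain G r where 2: "G holomorphic_on ball 0 1" "r \<noteq> 0" "\<forall>z. poly r z = 0 \<longrightarrow> z \<in> ball 0 1"
     "\<forall>z\<in>D. poly r z \<noteq> 0 \<longrightarrow> g z = G z / poly r z" using assms(2) unfolding mero_disc_def by blast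
  show ?thesis unfolding mero_disc_def
    by (rule exI[of _ "\<lambda>z. F z * poly r z + G z * poly q z"], rule exI[of _ "q * r"])
       (use 1 2 in \<open>auto intro!: holomorphic_intros simp: add_frac_eq\<close>)
qed

lemma mero_disc_poly:
  assumes "mero_disc D f"
  shows "mero_disc D (\<lambda>z. poly p (f z))"
  by (induction p) (auto intro!: mero_disc_add mero_disc_mult mero_disc_const assms)

text \<open>\<open>q\<close> splits into linear factors, each with a meromorphic reciprocal by
  hypothesis; induction on the degree multiplies them.\<close>

lemma mero_disc_inverse_poly:
  assumes a: "\<And>a. a \<in> S \<Longrightarrow> mero_disc D (\<lambda>z. inverse (f z - a))"
    and "q \<noteq> 0" "\<And>z. poly q z = 0 \<Longrightarrow> z \<in> S"
  shows "mero_disc D (\<lambda>z. inverse (poly q (f z)))"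
  using assms(2,3)
proof (induction "degree q" arbitrary: q)
  case 0
  then obtain b where "q = [:b:]" by (metis degree_eq_zeroE)
  then show ?case by (simp add: mero_disc_const)
next
  case (Suc n)
  then obtain b where b: "poly q b = 0"
    using alg_closed_imp_poly_has_root[of q] by auto
  then obtain r where r: "q = [:- b, 1:] * r" unfolding poly_eq_0_iff_dvd dvd_def by blast
  have r0: "r \<noteq> 0" using Suc.prems r by auto
  have "degree q = Suc (degree r)" unfolding r using r0 by (subst degree_mult_eq) auto
  then have "mero_disc D (\<lambda>z. inverse (poly r (f z)))"
    using Suc.hyps Suc.prems(2) r r0 by (intro Suc.hyps(1)) auto
  then have "mero_disc D (\<lambda>z. inverse (f z - b) * inverse (poly r (f z)))"
    using a Suc.prems(2)[OF b] by (intro mero_disc_mult)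
  moreover have "(\<lambda>z. inverse (f z - b) * inverse (poly r (f z))) = (\<lambda>z. inverse (poly q (f z)))"
    unfolding r by (simp add: fun_eq_iff algebra_simps flip: inverse_mult_distrib)
  ultimately show ?case by simp
qed

lemma holomorphic_zero_factor:
  assumes "f holomorphic_on U" "open U"
  obtains e where "e holomorphic_on U" "\<And>z. f z - f a = (z - a) * e z" "e a = deriv f a"
  using pole_lemma_open[OF assms, of a] by (rule that) auto

text \<open>One root \<open>b\<close> at a time: with N(z) = N(b) + (z - b) e(z), division by z - b
  keeps \<open>e\<close> as the holomorphic part and moves the constant N(b) into the principal
  part.\<close>

lemma principal_part_decomposition:
  assumes "q \<noteq> 0" "\<And>z. poly q z = 0 \<Longrightarrow> z \<in> ball 0 1" "F holomorphic_on ball 0 1"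
  shows "\<exists>N p. N holomorphic_on ball 0 1 \<and> (p = 0 \<or> degree p < degree q) \<and>
     (\<forall>z\<in>ball 0 1. poly q z \<noteq> 0 \<longrightarrow> F z / poly q z = N z + poly p z / poly q z)"
  using assms(1,2)
proof (induction "degree q" arbitrary: q)
  case 0
  then obtain b where "q = [:b:]" by (metis degree_eq_zeroE)
  then show ?case using assms(3) 0 by (intro exI[of _ "\<lambda>z. F z / b"] exI[of _ 0]) (auto intro!: holomorphic_intros)
next
  case (Suc n)
  then obtain b where b: "poly q b = 0"
    using alg_closed_imp_poly_has_root[of q] by auto
  then obtain r where r: "q = [:- b, 1:] * r" unfolding poly_eq_0_iff_dvd dvd_def by blast
  have r0: "r \<noteq> 0" using Suc.prems r by auto
  have dq: "degree q = Suc (degree r)" unfolding r using r0 by (subst degree_mult_eq) auto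
  have "\<exists>N p. N holomorphic_on ball 0 1 \<and> (p = 0 \<or> degree p < degree r) \<and>
     (\<forall>z\<in>ball 0 1. poly r z \<noteq> 0 \<longrightarrow> F z / poly r z = N z + poly p z / poly r z)"
    by (rule Suc.hyps(1)) (use dq Suc.hyps(2) Suc.prems(2) r r0 in auto)
  then obtain N p where N: "N holomorphic_on ball 0 1" "p = 0 \<or> degree p < degree r"
     "\<And>z. z \<in> ball 0 1 \<Longrightarrow> poly r z \<noteq> 0 \<Longrightarrow> F z / poly r z = N z + poly p z / poly r z" by blast
  obtain e where e: "e holomorphic_on ball 0 1" "\<And>z. N z - N b = (z - b) * e z"
    using holomorphic_zero_factor[OF N(1) open_ball] by blast
  define s where "s = smult (N b) r + p"
  have "degree s \<le> degree r" unfolding s_def using N(2)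
    by (intro degree_add_le) (auto intro: degree_smult_le)
  then have "degree s < degree q" using dq by simp
  moreover have "F z / poly q z = e z + poly s z / poly q z" if z: "z \<in> ball 0 1" "poly q z \<noteq> 0" for z
  proof -
    have nz: "z - b \<noteq> 0" "poly r z \<noteq> 0" using z(2) by (auto simp: r)
    have qz: "poly q z = (z - b) * poly r z" by (simp add: r algebra_simps)
    have "F z / poly q z = (F z / poly r z) / (z - b)" using nz by (simp add: qz)
    also have "\<dots> = (N b + (z - b) * e z + poly p z / poly r z) / (z - b)"
      using N(3)[OF z(1) nz(2)] e(2)[of z] by (simp add: algebra_simps)
    also have "\<dots> = e z + (N b * poly r z + poly p z) / poly q z"
      using nz by (simp add: qz field_simps)
    finally show ?thesis by (simp add: s_def)
  qed
  ultimately show ?case using e(1) by blast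
qed

section \<open>Cauchy projections of the disc and of its exterior\<close>

lemma frontier_Dstar: "frontier Dstar = sphere 0 1"
proof -
  have "Dstar = - cball 0 1" by (auto simp: Dstar_def)
  then have "frontier Dstar = frontier (cball 0 1)" using frontier_complement by metis
  then show ?thesis by simp
qed

lemma lipschitz_circlepath: "(2 * pi)-lipschitz_on {0..1} (circlepath 0 1)"
proof (rule lipschitz_onI)
  fix x y :: real
  show "dist (circlepath 0 1 x) (circlepath 0 1 y) \<le> 2 * pi * dist x y"
  proof (cases "x = y")
    case False
    have "norm (circlepath 0 1 x - circlepath 0 1 y) \<le> (2 * pi) * norm (x - y)"
    proof (rule differentiable_bound[of UNIV "circlepath 0 1" "\<lambda>t h. h *\<^sub>R (2 * of_real pi * \<i> * exp (2 * of_real pi * \<i> * of_real t))"])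
      fix t :: real
      have "((\<lambda>t. exp (2 * of_real pi * \<i> * of_real t)) has_vector_derivative (2 * of_real pi * \<i> * exp (2 * of_real pi * \<i> * of_real t))) (at t)"
        by (rule has_vector_derivative_real_field) (auto intro!: derivative_eq_intros)
      then show "(circlepath 0 1 has_derivative (\<lambda>h. h *\<^sub>R (2 * of_real pi * \<i> * exp (2 * of_real pi * \<i> * of_real t)))) (at t within UNIV)"
        by (simp add: has_vector_derivative_def circlepath[abs_def])
      show "onorm (\<lambda>h. h *\<^sub>R (2 * of_real pi * \<i> * exp (2 * of_real pi * \<i> * of_real t))) \<le> 2 * pi"
        by (rule onorm_le) (simp add: norm_mult mult.commute)
    qed auto
    then show ?thesis by (simp add: dist_norm)
  qed simp
qed simp

text \<open>Exhibits a cycle, so that the one chosen in \<open>bdry_int\<close> for the disc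
  satisfies its specification.\<close>

lemma pos_bdry_cycle_disc: "pos_bdry_cycle (ball 0 1) False [circlepath 0 1]"
  unfolding pos_bdry_cycle_def
proof (intro conjI allI impI)
  show "\<forall>g\<in>set [circlepath 0 1]. simple_path g \<and> pathfinish g = pathstart g \<and> (\<exists>L. L-lipschitz_on {0..1} g)"
    using lipschitz_circlepath by (auto simp: simple_path_circlepath)
  fix z :: complex assume "z \<notin> frontier (ball 0 1)"
  then have "cmod z < 1 \<or> 1 < cmod z" by auto
  moreover have "winding_number (circlepath 0 1) z = 0" if "1 < cmod z"
    by (rule winding_number_zero_outside[of _ "cball 0 1"]) (use that in auto)
  moreover have "winding_number (circlepath 0 1) z = 1" if "cmod z < 1"
    using winding_number_circlepath[of z 0 1] that by simp
  ultimately show "(\<Sum>g\<leftarrow>[circlepath 0 1]. winding_number g z) = (if z \<in> ball 0 1 then 1 else 0) - (if False then 1 else 0)"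
    by auto
qed (auto simp: path_image_circlepath)

lemma pos_bdry_cycle_Dstar: "pos_bdry_cycle Dstar True [reversepath (circlepath 0 1)]"
  unfolding pos_bdry_cycle_def
proof (intro conjI allI impI)
  have "(2 * pi)-lipschitz_on {0..1} (reversepath (circlepath 0 1))"
  proof (rule lipschitz_onI)
    fix x y :: real assume "x \<in> {0..1}" "y \<in> {0..1}"
    then show "dist (reversepath (circlepath 0 1) x) (reversepath (circlepath 0 1) y) \<le> 2 * pi * dist x y"
      using lipschitz_onD[OF lipschitz_circlepath, of "1 - x" "1 - y"]
      by (simp add: reversepath_def dist_real_def abs_minus_commute)
  qed simp
  then show "\<forall>g\<in>set [reversepath (circlepath 0 1)]. simple_path g \<and> pathfinish g = pathstart g \<and> (\<exists>L. L-lipschitz_on {0..1} g)"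
    by (auto simp: simple_path_circlepath simple_path_reversepath)
  fix z :: complex assume "z \<notin> frontier Dstar"
  then have z: "cmod z < 1 \<or> 1 < cmod z" by (auto simp: frontier_Dstar)
  then have "z \<notin> path_image (circlepath 0 1)" by (auto simp: path_image_circlepath)
  then have rev: "winding_number (reversepath (circlepath 0 1)) z = - winding_number (circlepath 0 1) z"
    by (intro winding_number_reversepath) auto
  moreover have "winding_number (circlepath 0 1) z = 0" if "1 < cmod z"
    by (rule winding_number_zero_outside[of _ "cball 0 1"]) (use that in auto)
  moreover have "winding_number (circlepath 0 1) z = 1" if "cmod z < 1"
    using winding_number_circlepath[of z 0 1] that by simp
  ultimately show "(\<Sum>g\<leftarrow>[reversepath (circlepath 0 1)]. winding_number g z) = (if z \<in> Dstar then 1 else 0) - (if True then 1 else 0)"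
    using z by (auto simp: Dstar_def)
qed (auto simp: path_image_circlepath frontier_Dstar)

text \<open>The function N(\<xi>)/(\<xi> - z) is holomorphic on a disc containing the circle but not
  \<open>z\<close>, so it integrates to zero. The principal part is proper, with poles surrounded -1
  times and \<open>z\<close> surrounded 0 times, and is reproduced.\<close>

lemma cauchy_proj_Dstar:
  fixes p q :: "complex poly"
  assumes q: "q \<noteq> 0" "\<And>z. poly q z = 0 \<Longrightarrow> z \<in> ball 0 1" and deg: "p = 0 \<or> degree p < degree q"
    and \<delta>: "\<delta> > 0" and N: "N holomorphic_on ball 0 (1 + \<delta>)"
    and f: "\<And>\<xi>. cmod \<xi> = 1 \<Longrightarrow> f \<xi> = N \<xi> + poly p \<xi> / poly q \<xi>" and z: "1 < cmod z"
  shows "cauchy_proj Dstar True f z = poly p z / poly q z"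
proof -
  obtain \<Gamma> where G: "pos_bdry_cycle Dstar True \<Gamma>"
    "\<And>f. bdry_int Dstar True f = (\<Sum>g\<leftarrow>\<Gamma>. contour_integral g f) / (2 * of_real pi * \<i>)"
    using bdry_int_SOME[of Dstar True] pos_bdry_cycle_Dstar by blast
  have cl: "closed_lipschitz g" "path_image g \<subseteq> sphere 0 1" if "g \<in> set \<Gamma>" for g
    using pos_bdry_cycle_closed_lipschitz[OF G(1) that] by (auto simp: frontier_Dstar)
  let ?R = "\<lambda>\<xi>. poly p \<xi> / poly q \<xi> / (\<xi> - z)"
  have qz: "poly q z \<noteq> 0" using q(2)[of z] z by auto
  have a2: "w \<notin> path_image g" if "g \<in> set \<Gamma>" "poly q w = 0 \<or> w = z" for g w
    using cl(2)[OF that(1)] q(2)[of w] that(2) z by force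
  have a3: "(\<Sum>g\<leftarrow>\<Gamma>. winding_number g a) = - 1" if "poly q a = 0" for a
  proof -
    have "a \<notin> frontier Dstar" "a \<notin> Dstar" using q(2)[OF that] unfolding frontier_Dstar by (auto simp: Dstar_def)
    then show ?thesis using pos_bdry_cycle_winding[OF G(1), of a] by simp
  qed
  have a4: "(\<Sum>g\<leftarrow>\<Gamma>. winding_number g z) = 0"
  proof -
    have "z \<notin> frontier Dstar" "z \<in> Dstar" using z unfolding frontier_Dstar by (auto simp: Dstar_def)
    then show ?thesis using pos_bdry_cycle_winding[OF G(1), of z] by simp
  qed
  have a5: "(- 1 :: complex) = 0 \<or> p = 0 \<or> degree p < degree q" using deg by auto
  have R: "(\<Sum>g\<leftarrow>\<Gamma>. contour_integral g ?R) = 2 * of_real pi * \<i> * ((0 - (- 1)) * (poly p z / poly q z))"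
     "\<forall>g\<in>set \<Gamma>. ?R contour_integrable_on g"
    by (rule rational_cauchy_cycle[OF q(1) cl(1) a2 a3 a4 qz a5 refl]; assumption)+
  have "contour_integral g (\<lambda>\<xi>. f \<xi> / (\<xi> - z)) = contour_integral g ?R" if g: "g \<in> set \<Gamma>" for g
  proof (rule contour_integral_unique)
    have "((\<lambda>\<xi>. N \<xi> / (\<xi> - z)) has_contour_integral 0) g"
    proof (rule closed_lipschitz_Cauchy_convex[OF cl(1)[OF g], of "ball 0 (min (1 + \<delta>) (cmod z))"])
      show "(\<lambda>\<xi>. N \<xi> / (\<xi> - z)) holomorphic_on ball 0 (min (1 + \<delta>) (cmod z))"
        by (intro holomorphic_intros holomorphic_on_subset[OF N]) auto
    qed (use cl(2)[OF g] \<delta> z in auto)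
    from has_contour_integral_add[OF this has_contour_integral_integral[OF bspec[OF R(2) g]]]
    have "((\<lambda>\<xi>. N \<xi> / (\<xi> - z) + ?R \<xi>) has_contour_integral contour_integral g ?R) g" by simp
    then show "((\<lambda>\<xi>. f \<xi> / (\<xi> - z)) has_contour_integral contour_integral g ?R) g"
    proof (rule has_contour_integral_eq)
      fix w assume "w \<in> path_image g"
      then show "N w / (w - z) + ?R w = f w / (w - z)" using cl(2)[OF g] f[of w] by (auto simp: add_divide_distrib)
    qed
  qed
  then have "(\<Sum>g\<leftarrow>\<Gamma>. contour_integral g (\<lambda>\<xi>. f \<xi> / (\<xi> - z))) = (\<Sum>g\<leftarrow>\<Gamma>. contour_integral g ?R)"
    by (intro arg_cong[of _ _ sum_list] map_cong) auto
  then show ?thesis unfolding cauchy_proj_def G(2) R(1) by simp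
qed

lemma closed_lipschitz_Cauchy_formula:
  assumes "closed_lipschitz g" "path_image g \<subseteq> U" "open U" "convex U" "f holomorphic_on U" "z \<in> U" "z \<notin> path_image g"
  shows "((\<lambda>\<xi>. f \<xi> / (\<xi> - z)) has_contour_integral (2 * of_real pi * \<i> * (f z * winding_number g z))) g"
proof -
  obtain e where e: "e holomorphic_on U" "\<And>w. f w - f z = (w - z) * e w"
    using holomorphic_zero_factor[OF assms(5,3)] by blast
  have "(e has_contour_integral 0) g"
    by (rule closed_lipschitz_Cauchy_convex[OF assms(1-4) e(1)])
  from has_contour_integral_add[OF this closed_lipschitz_winding[OF assms(1,7), of "f z"]]
  have "((\<lambda>\<xi>. e \<xi> + f z / (\<xi> - z)) has_contour_integral (2 * of_real pi * \<i> * (f z * winding_number g z))) g" by simp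
  then show ?thesis
  proof (rule has_contour_integral_eq)
    fix w assume "w \<in> path_image g"
    then have "w - z \<noteq> 0" using assms(7) by auto
    then have "e w = (f w - f z) / (w - z)" using e(2)[of w] by simp
    then show "e w + f z / (w - z) = f w / (w - z)" by (simp add: diff_divide_distrib)
  qed
qed

text \<open>\<open>H\<close> is the part analytic in the disc, reproduced by Cauchy's formula.
  N(1/\<xi>) is the part analytic outside, of which only the value N(0) at infinity survives: the
  remainder (N(1/\<xi>) - N(0))/(\<xi> - z) is the derivative of -Q(1/\<xi>) near the
  circle.\<close>

lemma cauchy_proj_disc:
  assumes \<delta>: "\<delta> > 0" and N: "N holomorphic_on ball 0 (1 + \<delta>)" and H: "H holomorphic_on ball 0 (1 + \<delta>)"
    and f: "\<And>\<xi>. cmod \<xi> = 1 \<Longrightarrow> f \<xi> = N (1 / \<xi>) + H \<xi>" and z: "cmod z < 1"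
  shows "cauchy_proj (ball 0 1) False f z = N 0 + H z"
proof -
  obtain \<Gamma> where G: "pos_bdry_cycle (ball 0 1) False \<Gamma>"
    "\<And>f. bdry_int (ball 0 1) False f = (\<Sum>g\<leftarrow>\<Gamma>. contour_integral g f) / (2 * of_real pi * \<i>)"
    using bdry_int_SOME[of "ball 0 1" False] pos_bdry_cycle_disc by blast
  have cl: "closed_lipschitz g" "path_image g \<subseteq> sphere 0 1" if "g \<in> set \<Gamma>" for g
    using pos_bdry_cycle_closed_lipschitz[OF G(1) that] by auto
  have w1: "(\<Sum>g\<leftarrow>\<Gamma>. winding_number g z) = 1"
    using pos_bdry_cycle_winding[OF G(1), of z] z by simp
  obtain k where k: "k holomorphic_on ball 0 (1 + \<delta>)" "\<And>\<eta>. N \<eta> - N 0 = (\<eta> - 0) * k \<eta>"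
    using holomorphic_zero_factor[OF N open_ball] by blast
  \<comment> \<open>In the variable \<eta> = 1/\<xi> the kernel 1/(\<xi> - z) becomes \<eta>/(1 - z
    \<eta>); \<open>B\<close> is a disc on which this has no pole.\<close>
  define B where "B = ball 0 (1 + \<delta>) \<inter> {\<eta>. cmod (z * \<eta>) < 1}"
  have B: "B = (if z = 0 then ball 0 (1 + \<delta>) else ball 0 (min (1 + \<delta>) (1 / cmod z)))"
    by (auto simp: B_def norm_mult field_simps)
  have oB: "open B" "convex B" unfolding B by auto
  have nz: "1 - z * \<eta> \<noteq> 0" if "\<eta> \<in> B" for \<eta> using that by (auto simp: B_def)
  have "(\<lambda>\<eta>. k \<eta> / (1 - z * \<eta>)) holomorphic_on B"
    using nz by (intro holomorphic_intros holomorphic_on_subset[OF k(1)]) (auto simp: B_def)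
  from holomorphic_convex_primitive'[OF oB(2,1) this]
  obtain Q where Q: "\<And>\<eta>. \<eta> \<in> B \<Longrightarrow> (Q has_field_derivative k \<eta> / (1 - z * \<eta>)) (at \<eta> within B)" by blast
  have Q': "(Q has_field_derivative k \<eta> / (1 - z * \<eta>)) (at \<eta>)" if "\<eta> \<in> B" for \<eta>
    using Q[OF that] at_within_open[OF that oB(1)] by simp
  define V where "V = {\<xi>. \<xi> \<noteq> 0 \<and> 1 / \<xi> \<in> B}"
  have oV: "open V"
  proof -
    have "open ((- {0}) \<inter> (\<lambda>\<xi>. 1 / \<xi>) -` B)"
      by (rule continuous_open_preimage) (auto intro!: continuous_intros oB)
    moreover have "V = (- {0}) \<inter> (\<lambda>\<xi>. 1 / \<xi>) -` B" by (auto simp: V_def)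
    ultimately show ?thesis by simp
  qed
  have VS: "sphere 0 1 \<subseteq> V" using \<delta> z by (auto simp: V_def B_def norm_divide norm_mult)
  have K: "((\<lambda>\<xi>. (N (1 / \<xi>) - N 0) / (\<xi> - z)) has_contour_integral 0) g" if g: "g \<in> set \<Gamma>" for g
  proof (rule closed_lipschitz_contour_primitive[OF cl(1)[OF g] _ oV, of "\<lambda>\<xi>. - Q (1 / \<xi>)"])
    show "path_image g \<subseteq> V" using cl(2)[OF g] VS by blast
    fix \<xi> assume \<xi>: "\<xi> \<in> V"
    then have \<xi>0: "\<xi> \<noteq> 0" "1 / \<xi> \<in> B" by (auto simp: V_def)
    have \<xi>z: "\<xi> - z \<noteq> 0" using nz[OF \<xi>0(2)] \<xi>0(1) by auto
    have d: "((\<lambda>\<xi>. 1 / \<xi>) has_field_derivative (- 1 / \<xi>\<^sup>2)) (at \<xi>)"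
      using \<xi>0 by (auto intro!: derivative_eq_intros simp: power2_eq_square)
    have "((\<lambda>\<xi>. - Q (1 / \<xi>)) has_field_derivative - (k (1 / \<xi>) / (1 - z * (1 / \<xi>)) * (- 1 / \<xi>\<^sup>2))) (at \<xi>)"
      using DERIV_minus[OF DERIV_chain2[OF Q'[OF \<xi>0(2)] d]] .
    moreover have "- (k (1 / \<xi>) / (1 - z * (1 / \<xi>)) * (- 1 / \<xi>\<^sup>2)) = (N (1 / \<xi>) - N 0) / (\<xi> - z)"
    proof -
      have "1 - z * (1 / \<xi>) = (\<xi> - z) / \<xi>" using \<xi>0 by (simp add: field_simps)
      then show ?thesis unfolding k(2) using \<xi>0 \<xi>z by (simp add: power2_eq_square)
    qed
    ultimately show "((\<lambda>\<xi>. - Q (1 / \<xi>)) has_field_derivative (N (1 / \<xi>) - N 0) / (\<xi> - z)) (at \<xi>)" by simp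
  qed
  have "contour_integral g (\<lambda>\<xi>. f \<xi> / (\<xi> - z)) = 2 * of_real pi * \<i> * (N 0 + H z) * winding_number g z" if g: "g \<in> set \<Gamma>" for g
  proof (rule contour_integral_unique)
    have zg: "z \<notin> path_image g" using cl(2)[OF g] z by auto
    have h: "((\<lambda>\<xi>. H \<xi> / (\<xi> - z)) has_contour_integral (2 * of_real pi * \<i> * (H z * winding_number g z))) g"
      by (rule closed_lipschitz_Cauchy_formula[OF cl(1)[OF g] _ open_ball convex_ball H _ zg]) (use cl(2)[OF g] \<delta> z in auto)
    have "((\<lambda>\<xi>. (N (1 / \<xi>) - N 0) / (\<xi> - z) + N 0 / (\<xi> - z) + H \<xi> / (\<xi> - z)) has_contour_integral
        (0 + 2 * of_real pi * \<i> * (N 0 * winding_number g z) + 2 * of_real pi * \<i> * (H z * winding_number g z))) g"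
      by (intro has_contour_integral_add K[OF g] h closed_lipschitz_winding[OF cl(1)[OF g] zg])
    then have "((\<lambda>\<xi>. f \<xi> / (\<xi> - z)) has_contour_integral
        (0 + 2 * of_real pi * \<i> * (N 0 * winding_number g z) + 2 * of_real pi * \<i> * (H z * winding_number g z))) g"
    proof (rule has_contour_integral_eq)
      fix w assume "w \<in> path_image g"
      then show "(N (1 / w) - N 0) / (w - z) + N 0 / (w - z) + H w / (w - z) = f w / (w - z)"
        using cl(2)[OF g] f[of w] by (auto simp: add_divide_distrib diff_divide_distrib)
    qed
    then show "((\<lambda>\<xi>. f \<xi> / (\<xi> - z)) has_contour_integral 2 * of_real pi * \<i> * (N 0 + H z) * winding_number g z) g"
      by (simp add: algebra_simps)
  qed
  then have "(\<Sum>g\<leftarrow>\<Gamma>. contour_integral g (\<lambda>\<xi>. f \<xi> / (\<xi> - z))) = (\<Sum>g\<leftarrow>\<Gamma>. 2 * of_real pi * \<i> * (N 0 + H z) * winding_number g z)"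
    by (intro arg_cong[of _ _ sum_list] map_cong) auto
  also have "\<dots> = 2 * of_real pi * \<i> * (N 0 + H z)" by (simp add: sum_list_const_mult w1)
  finally show ?thesis unfolding cauchy_proj_def G(2) by simp
qed

section \<open>Representation of the Riemann map\<close>

lemma log_sq_factor:
  assumes "\<kappa> \<noteq> 0" "k \<noteq> 0"
  shows "log_sq (\<kappa> * k * exp g) = of_real (ln ((cmod \<kappa>)\<^sup>2)) + of_real (ln ((cmod k)\<^sup>2)) + of_real (2 * Re g)"
  using assms by (simp add: log_sq_def norm_mult power_mult_distrib ln_mult_pos ln_realpow)

lemma open_poly_nonzero:
  fixes f :: "complex \<Rightarrow> complex" and q :: "complex poly"
  assumes "continuous_on UNIV f"
  shows "open {z. poly q (f z) \<noteq> 0}"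
proof -
  have "continuous_on UNIV (\<lambda>z. poly q (f z))" by (rule continuous_on_poly[OF assms])
  then have "closed {z. poly q (f z) = 0}" by (rule closed_Collect_eq[OF _ continuous_on_const])
  then show ?thesis by (simp add: open_Compl Collect_neg_eq)
qed

text \<open>Serves the bounded map with X = {} and the exterior map, in the coordinate 1/z, with X =
  {0}. The factor \<open>k\<close> takes up the zero or pole of the map and drops out on the circle,
  where its modulus is one; g(0) = 0 fixes the additive constant that the circle values leave open.
  \<open>W\<close> need only surround the circle, so \<open>k\<close> may have a pole at the
  centre.\<close>

lemma disc_representation:
  assumes S: "open S" and X: "X \<subseteq> {0}" and q: "\<And>z. poly q z = 0 \<Longrightarrow> z \<in> S"
    and h: "\<And>z. poly q z \<noteq> 0 \<Longrightarrow> h z = poly p z / poly q z"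
    and bd: "\<And>e. e > 0 \<Longrightarrow> \<exists>V. open V \<and> frontier S \<subseteq> V \<and>
       (\<forall>w\<in>V \<inter> S. w \<noteq> 0 \<and> poly q w \<noteq> 0 \<and> cmod (log_sq w - A w - w * h w) < e)"
    and \<Phi>S: "\<And>z. z \<in> ball 0 1 - X \<Longrightarrow> \<Phi> z \<in> S"
    and \<Phi>V: "\<And>V. open V \<Longrightarrow> frontier S \<subseteq> V \<Longrightarrow> eventually (\<lambda>z. \<Phi> z \<in> V) circle_filter"
    and B: "B holomorphic_on ball 0 1" "\<And>z. z \<in> ball 0 1 - X \<Longrightarrow> B z = A (\<Phi> z)"
    and mer: "mero_disc (ball 0 1 - X) (\<lambda>z. \<Phi> z * (poly p (\<Phi> z) * inverse (poly q (\<Phi> z))))"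
    and W: "open W" "sphere 0 1 \<subseteq> W" and k: "k holomorphic_on W" "\<And>z. cmod z = 1 \<Longrightarrow> cmod (k z) = 1"
    and \<kappa>: "\<kappa> \<noteq> 0" and g: "g holomorphic_on ball 0 1" "g 0 = 0"
    and fac: "\<And>z. z \<in> W \<Longrightarrow> z \<in> ball 0 1 - X \<Longrightarrow> \<Phi> z = \<kappa> * k z * exp (g z)"
  obtains P Q \<delta> N \<Phi>' where "Q \<noteq> 0" "\<And>z. poly Q z = 0 \<Longrightarrow> z \<in> ball 0 1" "P = 0 \<or> degree P < degree Q"
    "\<And>z. z \<in> ball 0 1 - {0} \<Longrightarrow> g z = cnj (poly P (1 / cnj z) / poly Q (1 / cnj z))"
    "\<delta> > 0" "N holomorphic_on ball 0 (1 + \<delta>)"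
    "\<And>\<xi>. cmod \<xi> = 1 \<Longrightarrow> (\<Phi> \<longlongrightarrow> \<Phi>' \<xi>) (at \<xi> within ball 0 1)"
    "\<And>\<xi>. cmod \<xi> = 1 \<Longrightarrow> \<Phi>' \<xi> * h (\<Phi>' \<xi>) = N \<xi> + poly P \<xi> / poly Q \<xi>"
proof -
  let ?D = "ball 0 1 - X"
  let ?P = "\<lambda>w. w * (poly p w * inverse (poly q w))"
  have evD: "eventually (\<lambda>z. z \<in> ?D) circle_filter"
    unfolding eventually_circle_filter using X by (intro exI[of _ 0]) auto
  obtain F Q where F: "F holomorphic_on ball 0 1" and Q: "Q \<noteq> 0" "\<And>z. poly Q z = 0 \<Longrightarrow> z \<in> ball 0 1"
    and FQ: "\<And>z. z \<in> ?D \<Longrightarrow> poly Q z \<noteq> 0 \<Longrightarrow> ?P (\<Phi> z) = F z / poly Q z"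
    using mer unfolding mero_disc_def by blast
  obtain N0 P where N0: "N0 holomorphic_on ball 0 1" and deg: "P = 0 \<or> degree P < degree Q"
    and NP: "\<And>z. z \<in> ball 0 1 \<Longrightarrow> poly Q z \<noteq> 0 \<Longrightarrow> F z / poly Q z = N0 z + poly P z / poly Q z"
    using principal_part_decomposition[OF Q F] by blast
  obtain P1 Q1 where PQ1: "\<And>z. cmod z \<le> 1 \<Longrightarrow> poly Q1 z \<noteq> 0" "poly P1 0 = 0"
    "\<And>z. z \<noteq> 0 \<Longrightarrow> poly P (1 / z) / poly Q (1 / z) = poly P1 z / poly Q1 z"
    by (rule rational_inversion[OF Q deg], assumption, rule that)
  \<comment> \<open>The reflection of P/Q: holomorphic on a neighbourhood of the closed disc, zero
    at 0, and with conjugate equal to P/Q on the circle.\<close>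
  define R where "R = (\<lambda>z. cnj (poly P1 (cnj z) / poly Q1 (cnj z)))"
  have R_eq: "R = (\<lambda>z. poly (map_poly cnj P1) z / poly (map_poly cnj Q1) z)"
    by (simp add: R_def fun_eq_iff)
  define WR where "WR = {z. poly Q1 (cnj z) \<noteq> 0}"
  have WR: "open WR" unfolding WR_def by (rule open_poly_nonzero) (intro continuous_intros)
  have cWR: "z \<in> WR" if "cmod z \<le> 1" for z using PQ1(1)[of "cnj z"] that by (simp add: WR_def)
  have holR: "R holomorphic_on WR"
    unfolding R_eq by (intro holomorphic_intros) (simp add: WR_def)
  have holR1: "R holomorphic_on ball 0 1" by (rule holomorphic_on_subset[OF holR]) (use cWR in auto)
  have R0: "R 0 = 0" using PQ1(2) by (simp add: R_def)
  define WQ where "WQ = {z. poly Q z \<noteq> 0}"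
  have WQ: "open WQ" unfolding WQ_def using open_poly_nonzero[of "\<lambda>z. z" Q] by (simp add: continuous_on_id)
  have sWQ: "sphere 0 1 \<subseteq> WQ" using Q(2) by (force simp: WQ_def)
  have k0: "k z \<noteq> 0" if "cmod z = 1" for z using k(2)[OF that] by auto
  define Wk where "Wk = W \<inter> k -` (- {0})"
  have Wk: "open Wk" unfolding Wk_def
    by (rule continuous_open_preimage[OF holomorphic_on_imp_continuous_on[OF k(1)] W(1)]) auto
  have sWk: "sphere 0 1 \<subseteq> Wk" using W(2) k0 by (auto simp: Wk_def subset_iff)
  have l0: "((\<lambda>z. log_sq (\<Phi> z) - A (\<Phi> z) - \<Phi> z * h (\<Phi> z)) \<longlongrightarrow> 0) circle_filter"
  proof (rule tendstoI)
    fix e :: real assume e: "e > 0"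
    obtain V where V: "open V" "frontier S \<subseteq> V"
      "\<And>w. w \<in> V \<inter> S \<Longrightarrow> cmod (log_sq w - A w - w * h w) < e" using bd[OF e] by metis
    show "eventually (\<lambda>z. dist (log_sq (\<Phi> z) - A (\<Phi> z) - \<Phi> z * h (\<Phi> z)) 0 < e) circle_filter"
      using \<Phi>V[OF V(1,2)] evD by eventually_elim (use V(3) \<Phi>S in auto)
  qed
  obtain V1 where V1: "open V1" "frontier S \<subseteq> V1" "\<And>w. w \<in> V1 \<inter> S \<Longrightarrow> poly q w \<noteq> 0"
    using bd[OF zero_less_one] by metis
  have l1: "((\<lambda>z. log_sq (\<Phi> z) - B z - (N0 z + poly P z / poly Q z)) \<longlongrightarrow> 0) circle_filter"
  proof (rule Lim_transform_eventually[OF l0])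
    show "eventually (\<lambda>z. log_sq (\<Phi> z) - A (\<Phi> z) - \<Phi> z * h (\<Phi> z) = log_sq (\<Phi> z) - B z - (N0 z + poly P z / poly Q z)) circle_filter"
      using \<Phi>V[OF V1(1,2)] evD eventually_circle_filter_open[OF WQ sWQ]
    proof eventually_elim
      case (elim z)
      then have "poly q (\<Phi> z) \<noteq> 0" using V1(3) \<Phi>S by auto
      then have "\<Phi> z * h (\<Phi> z) = ?P (\<Phi> z)" using h by (simp add: divide_inverse)
      also have "\<dots> = N0 z + poly P z / poly Q z" using FQ[OF elim(2)] NP[of z] elim by (auto simp: WQ_def)
      finally show ?case using B(2)[OF elim(2)] by simp
    qed
  qed
  have l2: "((\<lambda>z. complex_of_real (ln ((cmod (k z))\<^sup>2))) \<longlongrightarrow> 0) circle_filter"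
  proof (rule tendsto_circle_filter_zero[OF Wk sWk])
    show "continuous_on Wk (\<lambda>z. complex_of_real (ln ((cmod (k z))\<^sup>2)))"
      using holomorphic_on_imp_continuous_on[OF k(1)]
      by (intro continuous_intros) (auto simp: Wk_def elim: continuous_on_subset)
  qed (use k(2) in simp)
  have l3: "((\<lambda>z. poly P z / poly Q z - poly P1 (cnj z) / poly Q1 (cnj z)) \<longlongrightarrow> 0) circle_filter"
  proof (rule tendsto_circle_filter_zero[of "WQ \<inter> WR"])
    show "open (WQ \<inter> WR)" by (rule open_Int[OF WQ WR])
    show "sphere 0 1 \<subseteq> WQ \<inter> WR" using sWQ cWR by (auto simp: subset_iff)
    show "continuous_on (WQ \<inter> WR) (\<lambda>z. poly P z / poly Q z - poly P1 (cnj z) / poly Q1 (cnj z))"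
      by (intro continuous_intros) (auto simp: WQ_def WR_def)
    fix z :: complex assume z: "cmod z = 1"
    then have "z \<noteq> 0" by auto
    have "1 / cnj z = z"
      using z by (simp add: divide_eq_eq complex_norm_square[symmetric] mult.commute)
    then show "poly P z / poly Q z - poly P1 (cnj z) / poly Q1 (cnj z) = 0"
      using PQ1(3)[of "cnj z"] \<open>z \<noteq> 0\<close> by simp
  qed
  \<comment> \<open>Collects everything that is holomorphic in the whole disc; the comparison of
    circle values accepts any such function.\<close>
  define N1 where "N1 = (\<lambda>z. B z + N0 z - of_real (ln ((cmod \<kappa>)\<^sup>2)))"
  have "((\<lambda>z. (log_sq (\<Phi> z) - B z - (N0 z + poly P z / poly Q z)) - of_real (ln ((cmod (k z))\<^sup>2))
      + (poly P z / poly Q z - poly P1 (cnj z) / poly Q1 (cnj z))) \<longlongrightarrow> 0 - 0 + 0) circle_filter"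
    by (intro tendsto_intros l1 l2 l3)
  then have "((\<lambda>z. (log_sq (\<Phi> z) - B z - (N0 z + poly P z / poly Q z)) - of_real (ln ((cmod (k z))\<^sup>2))
      + (poly P z / poly Q z - poly P1 (cnj z) / poly Q1 (cnj z))) \<longlongrightarrow> 0) circle_filter" by simp
  then have "((\<lambda>z. of_real (2 * Re (g z)) - N1 z - cnj (R z)) \<longlongrightarrow> 0) circle_filter"
  proof (rule Lim_transform_eventually)
    show "eventually (\<lambda>z. (log_sq (\<Phi> z) - B z - (N0 z + poly P z / poly Q z)) - of_real (ln ((cmod (k z))\<^sup>2))
      + (poly P z / poly Q z - poly P1 (cnj z) / poly Q1 (cnj z)) = of_real (2 * Re (g z)) - N1 z - cnj (R z)) circle_filter"
      using evD eventually_circle_filter_open[OF Wk sWk]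
    proof eventually_elim
      case (elim z)
      then have "log_sq (\<Phi> z) = of_real (ln ((cmod \<kappa>)\<^sup>2)) + of_real (ln ((cmod (k z))\<^sup>2)) + of_real (2 * Re (g z))"
        using fac[of z] log_sq_factor[OF \<kappa>, of "k z" "g z"] by (auto simp: Wk_def)
      then show ?case by (simp add: N1_def R_def)
    qed
  qed
  moreover have "N1 holomorphic_on ball 0 1" unfolding N1_def by (intro holomorphic_intros B(1) N0)
  ultimately have "\<exists>c. \<forall>z\<in>ball 0 1. g z - R z = c"
    using constant_difference_from_circle_values[OF g(1) _ holR1] by blast
  then obtain c where c: "\<And>z. z \<in> ball 0 1 \<Longrightarrow> g z - R z = c" by blast
  have "c = 0" using c[of 0] g(2) R0 by simp
  then have gR: "g z = R z" if "z \<in> ball 0 1" for z using c[OF that] by simp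
  \<comment> \<open>A neighbourhood of the circle on which all ingredients of the continued map are
    holomorphic and, inside the disc, the factorisation is valid.\<close>
  define W1 where "W1 = W \<inter> WR \<inter> WQ \<inter> - {0}"
  have oW1: "open W1" unfolding W1_def by (intro open_Int open_Compl closed_singleton W WR WQ)
  have sW1: "sphere 0 1 \<subseteq> W1" using W(2) sWQ cWR by (auto simp: W1_def subset_iff)
  note W1 = oW1 sW1
  define \<Phi>' where "\<Phi>' = (\<lambda>z. \<kappa> * k z * exp (R z))"
  have hol': "\<Phi>' holomorphic_on W1"
    unfolding \<Phi>'_def by (intro holomorphic_intros holomorphic_on_subset[OF k(1)] holomorphic_on_subset[OF holR]) (auto simp: W1_def)
  have eq': "\<Phi>' z = \<Phi> z" if "z \<in> W1" "z \<in> ball 0 1" for z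
  proof -
    have "z \<in> W" "z \<in> ?D" using that X by (auto simp: W1_def)
    then show ?thesis using fac gR[OF that(2)] by (simp add: \<Phi>'_def)
  qed
  have lim': "(\<Phi> \<longlongrightarrow> \<Phi>' \<xi>) (at \<xi> within ball 0 1)" if \<xi>: "cmod \<xi> = 1" for \<xi>
  proof -
    have xW: "\<xi> \<in> W1" using W1(2) \<xi> by (auto simp: subset_iff)
    have "(\<Phi>' \<longlongrightarrow> \<Phi>' \<xi>) (at \<xi>)"
      using holomorphic_on_imp_continuous_on[OF hol'] W1(1) xW by (simp add: continuous_on_eq_continuous_at isCont_def)
    then have "(\<Phi>' \<longlongrightarrow> \<Phi>' \<xi>) (at \<xi> within ball 0 1)" by (rule tendsto_within_subset) simp
    then show ?thesis
    proof (rule Lim_transform_eventually)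
      have "eventually (\<lambda>z. z \<in> W1) (at \<xi> within ball 0 1)"
        using eventually_at_topological W1(1) xW by blast
      moreover have "eventually (\<lambda>z. z \<in> ball 0 1) (at \<xi> within ball 0 1)" by (simp add: eventually_at_filter)
      ultimately show "eventually (\<lambda>z. \<Phi>' z = \<Phi> z) (at \<xi> within ball 0 1)"
        by eventually_elim (rule eq')
    qed
  qed
  \<comment> \<open>If the boundary value had positive distance from the frontier, the complement of
    a small ball about it would be a neighbourhood of the frontier, which \<Phi> must enter near the
    circle, contradicting convergence. Consequently \<open>h\<close> has no pole at the boundary
    values.\<close>
  have fr: "\<Phi>' \<xi> \<in> frontier S" if \<xi>: "cmod \<xi> = 1" for \<xi>
  proof (rule ccontr)
    assume n: "\<Phi>' \<xi> \<notin> frontier S"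
    then obtain e where e: "e > 0" "\<forall>w\<in>frontier S. e \<le> dist (\<Phi>' \<xi>) w"
      using separate_point_closed[of "frontier S" "\<Phi>' \<xi>"] by auto
    have "eventually (\<lambda>z. \<Phi> z \<in> - cball (\<Phi>' \<xi>) (e/2)) circle_filter"
      by (rule \<Phi>V) (use e in \<open>force intro!: open_Compl\<close>)+
    then have "eventually (\<lambda>z. \<Phi> z \<in> - cball (\<Phi>' \<xi>) (e/2)) (at \<xi> within ball 0 1)"
      using circle_filter_le_at[OF \<xi>] by (simp add: le_filter_def)
    moreover have "eventually (\<lambda>z. dist (\<Phi> z) (\<Phi>' \<xi>) < e/2) (at \<xi> within ball 0 1)"
      by (rule tendstoD[OF lim'[OF \<xi>]]) (use e in simp)
    ultimately have "eventually (\<lambda>z. False) (at \<xi> within ball 0 1)"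
      by eventually_elim (simp add: dist_commute)
    then show False using trivial_limit_at_within_disc[OF \<xi>] by (simp add: trivial_limit_def)
  qed
  have qfr: "poly q w \<noteq> 0" if "w \<in> frontier S" for w
    using q[of w] that S by (auto simp: frontier_def interior_open)
  define W2 where "W2 = W1 \<inter> \<Phi>' -` {w. poly q w \<noteq> 0}"
  have W2: "open W2" unfolding W2_def
    using open_poly_nonzero[of "\<lambda>z. z" q]
    by (intro continuous_open_preimage[OF holomorphic_on_imp_continuous_on[OF hol'] W1(1)]) (simp add: continuous_on_id)
  have sW2: "sphere 0 1 \<subseteq> W2" using W1(2) fr qfr by (auto simp: W2_def subset_iff)
  \<comment> \<open>Inside, \<open>N\<close> is the old analytic part; outside it is defined through
    the continued map. The two agree on the overlap near the circle, so \<open>N\<close> is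
    holomorphic on a larger disc.\<close>
  define N where "N = (\<lambda>z. if z \<in> ball 0 1 then N0 z else ?P (\<Phi>' z) - poly P z / poly Q z)"
  have N1': "N holomorphic_on ball 0 1"
    by (rule holomorphic_transform[OF N0]) (simp add: N_def)
  have "(\<lambda>z. ?P (\<Phi>' z) - poly P z / poly Q z) holomorphic_on W2"
    by (intro holomorphic_intros holomorphic_on_compose_gen[of \<Phi>' W2 "poly _" UNIV, unfolded o_def] holomorphic_on_subset[OF hol'])
       (auto simp: W2_def W1_def WQ_def)
  then have N2': "N holomorphic_on W2"
  proof (rule holomorphic_transform)
    fix z assume z: "z \<in> W2"
    show "?P (\<Phi>' z) - poly P z / poly Q z = N z"
    proof (cases "z \<in> ball 0 1")
      case True
      have zD: "z \<in> ?D" "poly Q z \<noteq> 0" using z True X by (auto simp: W2_def W1_def WQ_def)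
      have "?P (\<Phi>' z) = ?P (\<Phi> z)" using eq'[OF _ True] z by (simp add: W2_def)
      also have "\<dots> = N0 z + poly P z / poly Q z" using FQ[OF zD] NP[OF True zD(2)] by simp
      finally show ?thesis using True by (simp add: N_def)
    qed (simp add: N_def)
  qed
  have holN: "N holomorphic_on ball 0 1 \<union> W2"
    by (rule holomorphic_on_Un[OF N1' N2' open_ball W2])
  obtain \<delta> where \<delta>: "0 < \<delta>" "\<delta> < 1" "\<And>z::complex. 1 - \<delta> < cmod z \<Longrightarrow> cmod z < 1 + \<delta> \<Longrightarrow> z \<in> W2"
    using circle_neighbourhood[OF W2 sW2] by metis
  show ?thesis
  proof (rule that[OF Q deg _ \<delta>(1), of N \<Phi>'])
    fix z :: complex assume z: "z \<in> ball 0 1 - {0}"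
    then show "g z = cnj (poly P (1 / cnj z) / poly Q (1 / cnj z))"
      using gR[of z] PQ1(3)[of "cnj z"] by (simp add: R_def)
  next
    show "N holomorphic_on ball 0 (1 + \<delta>)"
      by (rule holomorphic_on_subset[OF holN]) (use \<delta> in force)
    fix \<xi> :: complex assume \<xi>: "cmod \<xi> = 1"
    show "(\<Phi> \<longlongrightarrow> \<Phi>' \<xi>) (at \<xi> within ball 0 1)" by (rule lim'[OF \<xi>])
    show "\<Phi>' \<xi> * h (\<Phi>' \<xi>) = N \<xi> + poly P \<xi> / poly Q \<xi>"
      using h[OF qfr[OF fr[OF \<xi>]]] \<xi> by (simp add: N_def divide_inverse)
  qed
qed

lemma proper_rational_tendsto_0:
  fixes P Q :: "complex poly"
  assumes "P = 0 \<or> degree P < degree Q"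
  shows "((\<lambda>z. poly P z / poly Q z) \<longlongrightarrow> 0) at_infinity"
  using assms poly_divide_tendsto_0_at_infinity[of P Q] by auto

lemma closure_Dstar_subset: "closure Dstar \<subseteq> {z. 1 \<le> cmod z}"
  by (rule closure_minimal) (auto simp: Dstar_def intro!: closed_Collect_le continuous_intros)

lemma compact_subset_disc:
  assumes "compact K" "K \<subseteq> ball (0::complex) 1"
  shows "\<exists>\<rho><1. \<forall>z\<in>K. cmod z \<le> \<rho>"
proof (cases "K = {}")
  case True
  then show ?thesis by (intro exI[of _ 0]) simp
next
  case False
  have "continuous_on K cmod" by (intro continuous_intros)
  then obtain x where "x \<in> K" "\<forall>y\<in>K. cmod y \<le> cmod x"
    using continuous_attains_sup[OF assms(1) False] by blast
  then show ?thesis using assms(2) by (intro exI[of _ "cmod x"]) auto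
qed

text \<open>Properness of a conformal map. The part of the closure of \<open>S\<close> outside
  \<open>V\<close> and of modulus at most \<open>M\<close> is a compact subset of \<open>S\<close>,
  so its preimage stays away from the circle; values larger than \<open>M\<close> occur only for |z|
  \<le> 1/2.\<close>

lemma boundary_approach:
  assumes S: "open S" and X: "X \<subseteq> {0}"
    and \<Phi>: "\<Phi> holomorphic_on ball 0 1 - X" "inj_on \<Phi> (ball 0 1 - X)" "\<Phi> ` (ball 0 1 - X) = S"
    and big: "\<And>z. z \<in> ball 0 1 - X \<Longrightarrow> cmod (\<Phi> z) > M \<Longrightarrow> cmod z \<le> 1/2"
    and V: "open V" "frontier S \<subseteq> V"
  shows "eventually (\<lambda>z. \<Phi> z \<in> V) circle_filter"
proof -
  let ?D = "ball 0 1 - X"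
  have oD: "open ?D" using X finite_subset[OF X] by (intro open_Diff finite_imp_closed) auto
  obtain g where "g holomorphic_on \<Phi> ` ?D" and g2: "\<And>z. z \<in> ?D \<Longrightarrow> g (\<Phi> z) = z"
    by (rule holomorphic_has_inverse[OF \<Phi>(1) oD \<Phi>(2)]) (rule that)
  then have g: "g holomorphic_on S" "\<And>z. z \<in> ?D \<Longrightarrow> g (\<Phi> z) = z" using \<Phi>(3) by auto
  define C where "C = closure S \<inter> cball 0 M - V"
  have "compact (closure S \<inter> cball 0 M)" by (intro closed_Int_compact) auto
  then have C: "compact C" unfolding C_def by (intro compact_diff V)
  have CS: "C \<subseteq> S"
    using V(2) S by (auto simp: C_def frontier_def interior_open)
  have "compact (g ` C)"
    by (rule compact_continuous_image[OF continuous_on_subset[OF holomorphic_on_imp_continuous_on[OF g(1)] CS] C])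
  moreover have "g ` C \<subseteq> ball 0 1"
  proof
    fix y assume "y \<in> g ` C"
    then obtain w where "w \<in> C" "y = g w" by blast
    moreover from this have "w \<in> \<Phi> ` ?D" using CS unfolding \<Phi>(3) by blast
    then obtain z where "z \<in> ?D" "w = \<Phi> z" by (rule imageE)
    ultimately show "y \<in> ball 0 1" using g2 by auto
  qed
  ultimately have "\<exists>\<rho><1. \<forall>z\<in>g ` C. cmod z \<le> \<rho>" by (rule compact_subset_disc)
  then obtain \<rho> where \<rho>: "\<rho> < 1" "\<And>z. z \<in> g ` C \<Longrightarrow> cmod z \<le> \<rho>" by blast
  show ?thesis
    unfolding eventually_circle_filter
  proof (intro exI[of _ "max \<rho> (1/2)"] conjI allI impI)
    fix z assume z: "max \<rho> (1/2) < cmod z" "cmod z < 1"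
    then have zD: "z \<in> ?D" using X by auto
    have "\<not> cmod (\<Phi> z) > M" using big[OF zD] z by auto
    moreover have "\<Phi> z \<in> closure S"
      using imageI[OF zD, of \<Phi>] closure_subset[of S] unfolding \<Phi>(3) by (rule subsetD[rotated])
    moreover have "\<Phi> z \<notin> C"
    proof
      assume "\<Phi> z \<in> C"
      then have "cmod (g (\<Phi> z)) \<le> \<rho>" by (intro \<rho>(2) imageI)
      then show False using g2[OF zD] z by simp
    qed
    ultimately show "\<Phi> z \<in> V" by (auto simp: C_def)
  qed (use \<rho> in auto)
qed

section \<open>Zero-free factors, logarithms, and the bounded map\<close>

lemma injective_zero_factor:
  assumes f: "f holomorphic_on U" "open U" "inj_on f U" and a: "a \<in> U"
  obtains e where "e holomorphic_on U" "\<And>z. z \<in> U \<Longrightarrow> e z \<noteq> 0" "\<And>z. f z - f a = (z - a) * e z" "e a = deriv f a"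
proof -
  obtain e where e: "e holomorphic_on U" "\<And>z. f z - f a = (z - a) * e z" "e a = deriv f a"
    by (rule holomorphic_zero_factor[OF f(1,2), of a]) (rule that)
  have "e z \<noteq> 0" if z: "z \<in> U" for z
  proof (cases "z = a")
    case True
    then show ?thesis using e(3) holomorphic_injective_imp_regular[OF f a] by simp
  next
    case False
    then have "f z - f a \<noteq> 0" using f(3) z a by (auto simp: inj_on_def)
    then show ?thesis using e(2)[of z] by auto
  qed
  then show ?thesis using e that by blast
qed

lemma normalized_log:
  assumes f: "f holomorphic_on ball 0 1" "\<And>z. z \<in> ball 0 1 \<Longrightarrow> f z \<noteq> 0"
  obtains g where "g holomorphic_on ball 0 1" "g 0 = 0" "\<And>z. z \<in> ball 0 1 \<Longrightarrow> f z = f 0 * exp (g z)"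
proof -
  obtain g where g: "g holomorphic_on ball 0 1" "\<And>z. z \<in> ball 0 1 \<Longrightarrow> exp (g z) = f z"
    using holomorphic_logarithm_exists[OF convex_ball open_ball f, of 0] by auto
  show ?thesis
  proof (rule that[of "\<lambda>z. g z - g 0"])
    show "(\<lambda>z. g z - g 0) holomorphic_on ball 0 1" by (intro holomorphic_intros g)
    fix z :: complex assume z: "z \<in> ball 0 1"
    show "f z = f 0 * exp (g z - g 0)"
      using g(2)[OF z] g(2)[of 0] f(2)[of 0] by (simp add: exp_diff)
  qed simp
qed

lemma norm_blaschke:
  assumes "l \<noteq> 0" "cmod l \<noteq> 1" "cmod z = 1"
  shows "cmod (blaschke l z) = 1"
proof -
  have zz: "z * cnj z = 1" using assms(3) by (simp add: complex_norm_square[symmetric])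
  have "cnj l * z - 1 = z * cnj (l - z)" using zz by (simp add: algebra_simps)
  then have "cmod (cnj l * z - 1) = cmod (cnj (l - z))" using assms(3) by (simp only: norm_mult)
  then have "cmod (cnj l * z - 1) = cmod (z - l)" by (simp only: complex_mod_cnj norm_minus_commute)
  moreover have "z \<noteq> l" using assms by auto
  ultimately show ?thesis using assms(1) by (simp add: blaschke_def norm_mult norm_divide)
qed

text \<open>The constant \<open>res_inf h\<close> joins the part analytic in the disc, which the
  projection to the exterior annihilates; so the projection of the boundary values is exactly the
  principal part P/Q from \<open>disc_representation\<close>.\<close>

lemma disc_map_representation:
  assumes QD: "LQD S False h" and R: "riemann_map_bdd S \<phi>"
    and W: "open W" "cball 0 1 \<subseteq> W" and k: "k holomorphic_on W" "\<And>z. cmod z = 1 \<Longrightarrow> cmod (k z) = 1"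
    and \<kappa>: "\<kappa> \<noteq> 0" and g: "g holomorphic_on ball 0 1" "g 0 = 0"
    and fac: "\<And>z. z \<in> ball 0 1 \<Longrightarrow> \<phi> z = \<kappa> * k z * exp (g z)"
  defines "r \<equiv> faber_inv_bdd \<phi> (\<lambda>w. w * h w + res_inf h)"
  shows "rational_on Dstar r" "\<exists>G. in_A0 Dstar G \<and> (\<forall>z\<in>Dstar. G z = r z)"
    "\<And>z. z \<in> ball 0 1 \<Longrightarrow> \<phi> z = \<kappa> * k z * exp (reflect r z)"
proof -
  have S: "open S" "bounded S" using QD by (auto simp: LQD_def rectifiable_domain_def)
  have \<phi>: "\<phi> holomorphic_on ball 0 1" "inj_on \<phi> (ball 0 1)" "\<phi> ` ball 0 1 = S"
    using R by (auto simp: riemann_map_bdd_def)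
  have nU: "closure S \<noteq> UNIV" using bounded_closure[OF S(2)] not_bounded_UNIV by metis
  obtain A p q where A: "A holomorphic_on S" and q: "q \<noteq> 0" "\<And>z. poly q z = 0 \<Longrightarrow> z \<in> S"
    and h: "\<And>z. poly q z \<noteq> 0 \<Longrightarrow> h z = poly p z / poly q z"
    and bd: "\<And>e. e > 0 \<Longrightarrow> \<exists>V. open V \<and> frontier S \<subseteq> V \<and>
       (\<forall>w\<in>V \<inter> S. w \<noteq> 0 \<and> poly q w \<noteq> 0 \<and> cmod (log_sq w - A w - w * h w) < e)"
    by (rule LQD_boundary_identity[OF QD nU]) (rule that)
  obtain M where M: "\<And>w. w \<in> S \<Longrightarrow> cmod w \<le> M" using S(2) by (auto simp: bounded_iff)
  have m\<phi>: "mero_disc (ball 0 1) \<phi>"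
    unfolding mero_disc_def by (intro exI[of _ \<phi>] exI[of _ 1]) (use \<phi> in auto)
  \<comment> \<open>Injectivity makes the preimage of \<open>a\<close> the only pole of 1/(\<phi> -
    a), and a simple one.\<close>
  have inv: "mero_disc (ball 0 1) (\<lambda>z. inverse (\<phi> z - a))" if a: "a \<in> S" for a
  proof -
    obtain \<alpha> where \<alpha>: "\<alpha> \<in> ball 0 1" "\<phi> \<alpha> = a" using a \<phi>(3) by blast
    obtain e where e: "e holomorphic_on ball 0 1" "\<And>z. z \<in> ball 0 1 \<Longrightarrow> e z \<noteq> 0" "\<And>z. \<phi> z - \<phi> \<alpha> = (z - \<alpha>) * e z"
      by (rule injective_zero_factor[OF \<phi>(1) open_ball \<phi>(2) \<alpha>(1)]) (rule that)
    show ?thesis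
      unfolding mero_disc_def
    proof (intro exI[of _ "\<lambda>z. 1 / e z"] exI[of _ "[:- \<alpha>, 1:]"] conjI allI ballI impI)
      show "(\<lambda>z. 1 / e z) holomorphic_on ball 0 1" using e by (intro holomorphic_intros) auto
      fix z assume "z \<in> ball (0::complex) 1"
      show "inverse (\<phi> z - a) = 1 / e z / poly [:- \<alpha>, 1:] z" using e(3)[of z] \<alpha>(2) by (simp add: divide_inverse)
    qed (use \<alpha> in \<open>auto simp: eq_neg_iff_add_eq_0\<close>)
  qed
  have mer: "mero_disc (ball 0 1) (\<lambda>z. \<phi> z * (poly p (\<phi> z) * inverse (poly q (\<phi> z))))"
    by (rule mero_disc_mult[OF m\<phi> mero_disc_mult[OF mero_disc_poly[OF m\<phi>] mero_disc_inverse_poly[OF inv q]]])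
  have \<phi>V: "eventually (\<lambda>z. \<phi> z \<in> V) circle_filter" if "open V" "frontier S \<subseteq> V" for V
    by (rule boundary_approach[OF S(1), of "{}" \<phi> M]) (use \<phi> M that in \<open>auto simp: not_less[symmetric]\<close>)
  have B: "(\<lambda>z. A (\<phi> z)) holomorphic_on ball 0 1"
    using holomorphic_on_compose_gen[OF \<phi>(1) A] \<phi>(3) by (simp add: o_def)
  have sW: "sphere 0 1 \<subseteq> W" using W(2) by (auto simp: subset_iff)
  have \<phi>S: "\<phi> z \<in> S" if "z \<in> ball 0 1 - {}" for z using that \<phi>(3) by blast
  have B2: "(\<lambda>z. A (\<phi> z)) z = A (\<phi> z)" if "z \<in> ball 0 1 - {}" for z by simp
  have mer': "mero_disc (ball 0 1 - {}) (\<lambda>z. \<phi> z * (poly p (\<phi> z) * inverse (poly q (\<phi> z))))" using mer by simp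
  have fac': "\<phi> z = \<kappa> * k z * exp (g z)" if "z \<in> W" "z \<in> ball 0 1 - {}" for z using fac that by simp
  obtain P Q \<delta> N \<Phi>' where Q: "Q \<noteq> 0" "\<And>z. poly Q z = 0 \<Longrightarrow> z \<in> ball 0 1" and deg: "P = 0 \<or> degree P < degree Q"
    and gPQ: "\<And>z. z \<in> ball 0 1 - {0} \<Longrightarrow> g z = cnj (poly P (1 / cnj z) / poly Q (1 / cnj z))"
    and \<delta>: "\<delta> > 0" and N: "N holomorphic_on ball 0 (1 + \<delta>)"
    and lim: "\<And>\<xi>. cmod \<xi> = 1 \<Longrightarrow> (\<phi> \<longlongrightarrow> \<Phi>' \<xi>) (at \<xi> within ball 0 1)"
    and NPQ: "\<And>\<xi>. cmod \<xi> = 1 \<Longrightarrow> \<Phi>' \<xi> * h (\<Phi>' \<xi>) = N \<xi> + poly P \<xi> / poly Q \<xi>"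
    by (rule disc_representation[OF S(1) empty_subsetI q(2) h bd \<phi>S \<phi>V B B2 mer' W(1) sW k \<kappa> g fac'];
        (assumption | rule that)+)
  have r: "r z = poly P z / poly Q z" if z: "z \<in> Dstar" for z
    unfolding r_def faber_inv_bdd_def
  proof (rule cauchy_proj_Dstar[OF Q deg \<delta>])
    show "(\<lambda>\<xi>. N \<xi> + res_inf h) holomorphic_on ball 0 (1 + \<delta>)" by (intro holomorphic_intros N)
    fix \<xi> :: complex assume \<xi>: "cmod \<xi> = 1"
    have "bdry_ext (ball 0 1) \<phi> \<xi> = \<Phi>' \<xi>"
      unfolding bdry_ext_def by (rule tendsto_Lim[OF trivial_limit_at_within_disc[OF \<xi>] lim[OF \<xi>]])
    then show "((\<lambda>w. w * h w + res_inf h) \<circ> bdry_ext (ball 0 1) \<phi>) \<xi> = N \<xi> + res_inf h + poly P \<xi> / poly Q \<xi>"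
      using NPQ[OF \<xi>] by simp
  qed (use z in \<open>auto simp: Dstar_def\<close>)
  have Qnz: "poly Q z \<noteq> 0" if "1 \<le> cmod z" for z using Q(2)[of z] that by auto
  show "rational_on Dstar r"
    unfolding rational_on_def using Q(1) r Qnz by (intro exI[of _ P] exI[of _ Q]) (auto simp: Dstar_def)
  note lim0 = proper_rational_tendsto_0[OF deg]
  show "\<exists>G. in_A0 Dstar G \<and> (\<forall>z\<in>Dstar. G z = r z)"
  \<comment> \<open>On the circle itself \<open>r\<close> is an integral with a singular kernel, so
    P/Q supplies the continuous extension.\<close>
  proof (intro exI[of _ "\<lambda>z. poly P z / poly Q z"] conjI)
    have "(\<lambda>z. poly P z / poly Q z) holomorphic_on Dstar"
      using Qnz by (intro holomorphic_intros) (auto simp: Dstar_def)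
    moreover have "continuous_on (closure Dstar) (\<lambda>z. poly P z / poly Q z)"
      using Qnz closure_Dstar_subset by (intro continuous_intros) auto
    ultimately show "in_A0 Dstar (\<lambda>z. poly P z / poly Q z)"
      using lim0 by (auto simp: in_A0_def in_A_def)
  qed (use r in auto)
  \<comment> \<open>Required for \<open>reflect r\<close> at 0, which is defined through the limit
    at infinity.\<close>
  have "(r \<longlongrightarrow> 0) at_infinity"
  proof (rule Lim_transform_eventually[OF lim0])
    show "\<forall>\<^sub>F z in at_infinity. poly P z / poly Q z = r z"
      unfolding eventually_at_infinity using r by (intro exI[of _ 2]) (auto simp: Dstar_def)
  qed
  then have L: "Lim at_infinity r = 0" by (rule tendsto_Lim[OF trivial_limit_at_infinity])
  have "g z = reflect r z" if z: "z \<in> ball 0 1" for z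
  proof (cases "z = 0")
    case True
    then show ?thesis using g(2) L by (simp add: reflect_def)
  next
    case False
    then have "1 / cnj z \<in> Dstar" using z by (simp add: Dstar_def norm_divide)
    then show ?thesis using gPQ[of z] r z False by (simp add: reflect_def)
  qed
  then show "\<phi> z = \<kappa> * k z * exp (reflect r z)" if "z \<in> ball 0 1" for z
    using fac[OF that] that by simp
qed

section \<open>The exterior map in the inverted coordinate\<close>

lemma tendsto_bdry_Dstar:
  assumes \<xi>: "cmod \<xi> = 1" and lim: "((\<lambda>z. \<phi> (1 / z)) \<longlongrightarrow> L) (at (1 / \<xi>) within ball 0 1)"
  shows "bdry_ext Dstar \<phi> \<xi> = L"
proof -
  have \<xi>0: "\<xi> \<noteq> 0" using \<xi> by auto
  have nz: "x \<noteq> 0" if "x \<in> Dstar" for x using that by (auto simp: Dstar_def)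
  have "filterlim (\<lambda>z. 1 / z) (at (1 / \<xi>) within ball 0 1) (at \<xi> within Dstar)"
    unfolding filterlim_at
  proof
    show "((\<lambda>z. 1 / z) \<longlongrightarrow> 1 / \<xi>) (at \<xi> within Dstar)" using \<xi>0 by (intro tendsto_intros)
    have "eventually (\<lambda>z. z \<in> Dstar \<and> z \<noteq> \<xi>) (at \<xi> within Dstar)" by (simp add: eventually_at_filter)
    then show "\<forall>\<^sub>F z in at \<xi> within Dstar. 1 / z \<in> ball 0 1 \<and> 1 / z \<noteq> 1 / \<xi>"
      by eventually_elim (auto simp: Dstar_def norm_divide divide_less_eq)
  qed
  from filterlim_compose[OF lim this] have "((\<lambda>z. \<phi> (1 / (1 / z))) \<longlongrightarrow> L) (at \<xi> within Dstar)" .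
  then have l: "(\<phi> \<longlongrightarrow> L) (at \<xi> within Dstar)" by simp
  have "\<xi> \<in> frontier Dstar" unfolding frontier_Dstar using \<xi> by simp
  then have "\<xi> \<in> closure Dstar" unfolding frontier_def by blast
  moreover have "\<xi> \<notin> Dstar" using \<xi> by (simp add: Dstar_def)
  ultimately have "\<xi> islimpt Dstar" by (simp add: closure_def)
  then have "at \<xi> within Dstar \<noteq> bot" by (simp add: trivial_limit_within)
  then show ?thesis unfolding bdry_ext_def using l by (rule tendsto_Lim)
qed

text \<open>The exterior map is transported to the disc by \<open>\<Phi> \<zeta> = \<phi> (1 / \<zeta>)\<close>, and \<open>Y \<zeta> = \<zeta> * \<Phi> \<zeta>\<close> removes the pole at the origin.\<close>

locale exterior_map =
  fixes S :: "complex set" and h \<phi> :: "complex \<Rightarrow> complex" and c :: real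
  assumes QD: "LQD S True h" and RM: "riemann_map_unbdd S \<phi>"
    and lim_c: "((\<lambda>z. \<phi> z / z) \<longlongrightarrow> of_real c) at_infinity" and c: "0 < c"
begin

definition Y :: "complex \<Rightarrow> complex" where
  "Y \<zeta> = (if \<zeta> = 0 then of_real c else \<zeta> * \<phi> (1 / \<zeta>))"

definition \<Phi> :: "complex \<Rightarrow> complex" where "\<Phi> \<zeta> = \<phi> (1 / \<zeta>)"

abbreviation D :: "complex set" where "D \<equiv> ball 0 1 - {0}"

lemma open_S: "open S" using QD by (simp add: LQD_def rectifiable_domain_def)

lemma riemann_map: "\<phi> holomorphic_on Dstar" "inj_on \<phi> Dstar" "\<phi> ` Dstar = S" "filterlim \<phi> at_infinity at_infinity"
  using RM by (auto simp: riemann_map_unbdd_def)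

lemma inverse_D: "1 / \<zeta> \<in> Dstar" if "\<zeta> \<in> D"
  using that by (simp add: Dstar_def norm_divide)

lemma inverse_Dstar: "1 / z \<in> D" if "z \<in> Dstar"
proof -
  have "z \<noteq> 0" "1 < cmod z" using that by (auto simp: Dstar_def)
  then show ?thesis by (simp add: norm_divide)
qed

lemma \<Phi>_hol: "\<Phi> holomorphic_on D"
proof -
  have "(\<phi> \<circ> (\<lambda>\<zeta>. 1 / \<zeta>)) holomorphic_on D"
  proof (rule holomorphic_on_compose_gen[OF _ riemann_map(1)])
    show "(\<lambda>\<zeta>. 1 / \<zeta>) holomorphic_on D" by (intro holomorphic_intros) auto
    show "(\<lambda>\<zeta>. 1 / \<zeta>) ` D \<subseteq> Dstar" by (rule image_subsetI) (rule inverse_D)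
  qed
  then show ?thesis by (simp add: o_def \<Phi>_def[abs_def])
qed

lemma \<Phi>_inj: "inj_on \<Phi> D"
proof (rule inj_onI)
  fix x y assume xy: "x \<in> D" "y \<in> D" "\<Phi> x = \<Phi> y"
  then have "1 / x = 1 / y" using inj_onD[OF riemann_map(2) _ inverse_D[OF xy(1)] inverse_D[OF xy(2)]] by (simp add: \<Phi>_def)
  then show "x = y" by simp
qed

lemma \<Phi>_image: "\<Phi> ` D = S"
proof -
  have "\<Phi> ` D \<subseteq> S"
  proof (rule image_subsetI)
    fix x assume "x \<in> D"
    from imageI[OF inverse_D[OF this], of \<phi>] show "\<Phi> x \<in> S" unfolding riemann_map(3) by (simp add: \<Phi>_def)
  qed
  moreover have "w \<in> \<Phi> ` D" if w: "w \<in> S" for w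
  proof -
    obtain z where z: "z \<in> Dstar" "w = \<phi> z" using w riemann_map(3) by blast
    then have "w = \<Phi> (1 / z)" by (simp add: \<Phi>_def)
    then show ?thesis using inverse_Dstar[OF z(1)] by blast
  qed
  ultimately show ?thesis by blast
qed

lemma Y_eq: "\<zeta> \<noteq> 0 \<Longrightarrow> Y \<zeta> = \<zeta> * \<Phi> \<zeta>" by (simp add: Y_def \<Phi>_def)

lemma Y_0: "Y 0 = of_real c" by (simp add: Y_def)

lemma inverse_at_0: "filterlim (\<lambda>\<zeta>::complex. 1 / \<zeta>) at_infinity (at 0)"
  unfolding inverse_eq_divide[symmetric] by (rule filterlim_inverse_at_infinity)

lemma Y_hol: "Y holomorphic_on ball 0 1"
proof -
  have "(\<lambda>\<zeta>. \<zeta> * \<Phi> \<zeta>) holomorphic_on D" by (intro holomorphic_intros \<Phi>_hol)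
  moreover have "(\<lambda>\<zeta>. \<zeta> * \<Phi> \<zeta>) \<midarrow>0\<rightarrow> of_real c"
    using filterlim_compose[OF lim_c inverse_at_0] by (simp add: \<Phi>_def mult.commute)
  ultimately have "(\<lambda>\<zeta>. if \<zeta> = 0 then of_real c else \<zeta> * \<Phi> \<zeta>) holomorphic_on ball 0 1"
    by (intro removable_singularity) auto
  moreover have "Y = (\<lambda>\<zeta>. if \<zeta> = 0 then of_real c else \<zeta> * \<Phi> \<zeta>)" by (auto simp: fun_eq_iff Y_def \<Phi>_def)
  ultimately show ?thesis by simp
qed

lemma \<Phi>_at_0: "filterlim \<Phi> at_infinity (at 0)"
  using filterlim_compose[OF riemann_map(4) inverse_at_0] by (simp add: \<Phi>_def[abs_def])

text \<open>Y \<zeta> - \<Phi>(\<alpha>) \<zeta> is \<zeta> (\<Phi> \<zeta> - \<Phi> \<alpha>) freed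
  from the singularity at the centre. Its value there is c, not 0, and elsewhere injectivity of
  \<Phi> leaves \<alpha> as the only zero, a simple one.\<close>

lemma shifted_zero_factor:
  assumes a: "\<alpha> \<in> D"
  obtains e where "e holomorphic_on ball 0 1" "\<And>\<zeta>. \<zeta> \<in> ball 0 1 \<Longrightarrow> e \<zeta> \<noteq> 0"
    "\<And>\<zeta>. Y \<zeta> - \<Phi> \<alpha> * \<zeta> = (\<zeta> - \<alpha>) * e \<zeta>"
proof -
  let ?G = "\<lambda>\<zeta>. Y \<zeta> - \<Phi> \<alpha> * \<zeta>"
  have hG: "?G holomorphic_on ball 0 1" by (intro holomorphic_intros Y_hol)
  obtain e where e: "e holomorphic_on ball 0 1" "\<And>\<zeta>. ?G \<zeta> - ?G \<alpha> = (\<zeta> - \<alpha>) * e \<zeta>" "e \<alpha> = deriv ?G \<alpha>"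
    by (rule holomorphic_zero_factor[OF hG open_ball]) (rule that)
  have \<alpha>0: "\<alpha> \<noteq> 0" "\<alpha> \<in> ball 0 1" using a by auto
  have G\<alpha>: "?G \<alpha> = 0" using \<alpha>0 by (simp add: Y_eq)
  have oD: "open D" by (simp add: open_Diff)
  have "(\<Phi> has_field_derivative deriv \<Phi> \<alpha>) (at \<alpha>)" using \<Phi>_hol oD a by (rule holomorphic_derivI)
  then have "((\<lambda>\<zeta>. \<zeta> * \<Phi> \<zeta> - \<Phi> \<alpha> * \<zeta>) has_field_derivative \<alpha> * deriv \<Phi> \<alpha>) (at \<alpha>)"
    by (auto intro!: derivative_eq_intros)
  then have "(?G has_field_derivative \<alpha> * deriv \<Phi> \<alpha>) (at \<alpha>)"
    by (rule has_field_derivative_transform_within_open[OF _ oD a]) (simp add: Y_eq)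
  then have e\<alpha>: "e \<alpha> = \<alpha> * deriv \<Phi> \<alpha>" using e(3) by (simp add: DERIV_imp_deriv)
  have "deriv \<Phi> \<alpha> \<noteq> 0" by (rule holomorphic_injective_imp_regular[OF \<Phi>_hol oD \<Phi>_inj a])
  then have "e \<alpha> \<noteq> 0" using e\<alpha> \<alpha>0 by simp
  moreover have "e \<zeta> \<noteq> 0" if \<zeta>: "\<zeta> \<in> ball 0 1" "\<zeta> \<noteq> \<alpha>" for \<zeta>
  proof -
    have "?G \<zeta> \<noteq> 0"
    proof (cases "\<zeta> = 0")
      case True
      then show ?thesis using c by (simp add: Y_0)
    next
      case False
      then have "\<Phi> \<zeta> \<noteq> \<Phi> \<alpha>" using inj_onD[OF \<Phi>_inj, of \<zeta> \<alpha>] \<zeta> a by auto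
      moreover have "?G \<zeta> = \<zeta> * (\<Phi> \<zeta> - \<Phi> \<alpha>)" using False by (simp add: Y_eq algebra_simps)
      ultimately show ?thesis using False by simp
    qed
    then show ?thesis using e(2)[of \<zeta>] G\<alpha> by auto
  qed
  ultimately have "e \<zeta> \<noteq> 0" if "\<zeta> \<in> ball 0 1" for \<zeta> using that by blast
  then show ?thesis using e(1,2) G\<alpha> by (intro that) auto
qed

text \<open>Near the centre 1/\<Phi> extends to the non-constant holomorphic function \<zeta>/Y, an
  open map; so all sufficiently large values are taken there, and by injectivity nowhere
  else.\<close>

lemma \<Phi>_large:
  obtains M where "\<And>\<zeta>. \<zeta> \<in> D \<Longrightarrow> cmod (\<Phi> \<zeta>) > M \<Longrightarrow> cmod \<zeta> \<le> 1/2"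
proof -
  have "isCont Y 0"
    using holomorphic_on_imp_continuous_on[OF Y_hol] by (simp add: continuous_on_eq_continuous_at)
  then obtain s0 where "s0 > 0" "\<forall>\<zeta>. dist 0 \<zeta> < s0 \<longrightarrow> Y \<zeta> \<noteq> 0"
    using continuous_at_avoid[of 0 Y 0] c Y_0 by auto
  then have s0: "s0 > 0" "\<And>\<zeta>. \<zeta> \<in> ball 0 s0 \<Longrightarrow> Y \<zeta> \<noteq> 0" by auto
  define s where "s = min s0 (1/2)"
  have s: "s > 0" "s \<le> 1/2" "\<And>\<zeta>. \<zeta> \<in> ball 0 s \<Longrightarrow> Y \<zeta> \<noteq> 0" using s0 by (auto simp: s_def)
  define \<omega> where "\<omega> = (\<lambda>\<zeta>. \<zeta> / Y \<zeta>)"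
  have h\<omega>: "\<omega> holomorphic_on ball 0 s" unfolding \<omega>_def
    by (intro holomorphic_intros holomorphic_on_subset[OF Y_hol]) (use s in auto)
  have "\<not> \<omega> constant_on ball 0 s"
  proof
    assume "\<omega> constant_on ball 0 s"
    then have "\<omega> (of_real (s / 2)) = \<omega> 0" using s unfolding constant_on_def by force
    moreover have "\<omega> 0 = 0" by (simp add: \<omega>_def)
    moreover have "\<omega> (of_real (s / 2)) \<noteq> 0" using s(1) s(3)[of "of_real (s / 2)"] by (simp add: \<omega>_def)
    ultimately show False by simp
  qed
  then have "open (\<omega> ` ball 0 s)" by (intro open_mapping_thm[OF h\<omega>]) auto
  moreover have "0 \<in> \<omega> ` ball 0 s" using s(1) by (intro image_eqI[of _ _ 0]) (auto simp: \<omega>_def)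
  ultimately obtain \<delta> where \<delta>: "\<delta> > 0" "ball 0 \<delta> \<subseteq> \<omega> ` ball 0 s" by (meson open_contains_ball)
  show ?thesis
  proof (rule that[of "1 / \<delta>"])
    fix \<zeta> assume \<zeta>: "\<zeta> \<in> D" "cmod (\<Phi> \<zeta>) > 1 / \<delta>"
    have pos: "cmod (\<Phi> \<zeta>) > 0" using \<zeta>(2) \<delta>(1) by (meson less_trans zero_less_divide_1_iff)
    then have "1 / \<Phi> \<zeta> \<in> ball 0 \<delta>" using \<zeta>(2) \<delta>(1) by (simp add: norm_divide field_simps)
    then obtain \<eta> where \<eta>: "\<eta> \<in> ball 0 s" "1 / \<Phi> \<zeta> = \<omega> \<eta>" using \<delta>(2) by blast
    have "\<eta> \<noteq> 0" using \<eta>(2) pos by (auto simp: \<omega>_def)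
    then have "1 / \<Phi> \<zeta> = 1 / \<Phi> \<eta>" using \<eta>(2) s(3)[OF \<eta>(1)] by (simp add: \<omega>_def Y_eq)
    then have "\<Phi> \<zeta> = \<Phi> \<eta>" by simp
    moreover have "\<eta> \<in> D" using \<eta>(1) s(2) \<open>\<eta> \<noteq> 0\<close> by auto
    ultimately have "\<zeta> = \<eta>" using inj_onD[OF \<Phi>_inj] \<zeta>(1) by blast
    then show "cmod \<zeta> \<le> 1/2" using \<eta>(1) s(2) by auto
  qed
qed

text \<open>A dense regular open \<open>S\<close> would be the whole plane, and the inverse of
  \<Phi> a bounded entire function, hence constant. This secures an exterior reference point
  \<xi>'.\<close>

lemma closure_ne_UNIV: "closure S \<noteq> UNIV"
proof
  assume "closure S = UNIV"
  moreover have "interior (closure S) = S" using QD by (simp add: LQD_def)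
  ultimately have SU: "S = UNIV" by simp
  have oD: "open D" by (simp add: open_Diff)
  obtain g where g0: "g holomorphic_on \<Phi> ` D" "\<And>z. z \<in> D \<Longrightarrow> g (\<Phi> z) = z"
    by (rule holomorphic_has_inverse[OF \<Phi>_hol oD \<Phi>_inj]) (rule that)
  then have g: "g holomorphic_on UNIV" using \<Phi>_image SU by simp
  have "range g \<subseteq> ball 0 1"
  proof
    fix y assume "y \<in> range g"
    then obtain w where w: "y = g w" by blast
    have "w \<in> \<Phi> ` D" using \<Phi>_image SU by simp
    then obtain z where "z \<in> D" "w = \<Phi> z" by (rule imageE)
    then show "y \<in> ball 0 1" using w g0(2)[of z] by simp
  qed
  then have "bounded (range g)" using bounded_ball bounded_subset by blast
  then obtain d where d: "\<And>w. g w = d" using Liouville_theorem[OF g] by (auto simp: constant_on_def)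
  have "(1/2::complex) \<in> D" "(1/3::complex) \<in> D" by auto
  then have "(1/2::complex) = 1/3" using g0(2) d by metis
  then show False by simp
qed

text \<open>In the coordinate 1/z the two parts of the boundary values exchange roles: the principal
  part P/Q becomes analytic in the disc and survives the projection, while the analytic part
  \<open>N\<close> leaves only the constant N(0). Subtracting the value at 0 removes this constant,
  because the inverted principal part vanishes there.\<close>

lemma exterior_map_representation:
  assumes W: "open W" "cball 0 1 - {0} \<subseteq> W" and k: "k holomorphic_on W" "\<And>z. cmod z = 1 \<Longrightarrow> cmod (k z) = 1"
    and \<kappa>: "\<kappa> \<noteq> 0" and g: "g holomorphic_on ball 0 1" "g 0 = 0"
    and fac: "\<And>z. z \<in> D \<Longrightarrow> \<Phi> z = \<kappa> * k z * exp (g z)"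
    and r: "r = (\<lambda>z. faber_inv_unbdd \<phi> (\<lambda>w. w * h w) z - faber_inv_unbdd \<phi> (\<lambda>w. w * h w) 0)"
  shows "rational_on (ball 0 1) r" "\<exists>G. in_A (ball 0 1) False G \<and> (\<forall>z\<in>ball 0 1. G z = r z)"
    "\<And>z. z \<in> Dstar \<Longrightarrow> \<phi> z = \<kappa> * k (1 / z) * exp (reflect r z)"
proof -
  obtain A p q where A: "A holomorphic_on S" and q: "q \<noteq> 0" "\<And>z. poly q z = 0 \<Longrightarrow> z \<in> S"
    and h: "\<And>z. poly q z \<noteq> 0 \<Longrightarrow> h z = poly p z / poly q z"
    and bd: "\<And>e. e > 0 \<Longrightarrow> \<exists>V. open V \<and> frontier S \<subseteq> V \<and>
       (\<forall>w\<in>V \<inter> S. w \<noteq> 0 \<and> poly q w \<noteq> 0 \<and> cmod (log_sq w - A w - w * h w) < e)"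
    and A_inf: "True \<Longrightarrow> ((\<lambda>w. A w / w) \<longlongrightarrow> 0) at_infinity"
    by (rule LQD_boundary_identity[OF QD closure_ne_UNIV]) (rule that)
  have m\<Phi>: "mero_disc D \<Phi>"
    unfolding mero_disc_def by (intro exI[of _ Y] exI[of _ "[:0, 1:]"]) (use Y_hol Y_eq in auto)
  have inv: "mero_disc D (\<lambda>z. inverse (\<Phi> z - a))" if a: "a \<in> S" for a
  proof -
    obtain \<alpha> where \<alpha>: "\<alpha> \<in> D" "\<Phi> \<alpha> = a" using a \<Phi>_image by blast
    obtain e where e: "e holomorphic_on ball 0 1" "\<And>\<zeta>. \<zeta> \<in> ball 0 1 \<Longrightarrow> e \<zeta> \<noteq> 0"
      "\<And>\<zeta>. Y \<zeta> - \<Phi> \<alpha> * \<zeta> = (\<zeta> - \<alpha>) * e \<zeta>"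
      by (rule shifted_zero_factor[OF \<alpha>(1)]) (rule that)
    show ?thesis
      unfolding mero_disc_def
    proof (intro exI[of _ "\<lambda>z. z / e z"] exI[of _ "[:- \<alpha>, 1:]"] conjI allI ballI impI)
      show "(\<lambda>z. z / e z) holomorphic_on ball 0 1" using e by (intro holomorphic_intros) auto
      fix z assume z: "z \<in> D" "poly [:- \<alpha>, 1:] z \<noteq> 0"
      have nz: "z \<noteq> 0" "e z \<noteq> 0" "z - \<alpha> \<noteq> 0" using z e(2) by auto
      have "z * (\<Phi> z - a) = (z - \<alpha>) * e z" using e(3)[of z] nz \<alpha>(2) by (simp add: Y_eq algebra_simps)
      then have "\<Phi> z - a = (z - \<alpha>) * e z / z" using nz(1) by (simp add: field_simps)
      then show "inverse (\<Phi> z - a) = z / e z / poly [:- \<alpha>, 1:] z" by simp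
    qed (use \<alpha> in \<open>auto simp: eq_neg_iff_add_eq_0\<close>)
  qed
  have mer: "mero_disc D (\<lambda>z. \<Phi> z * (poly p (\<Phi> z) * inverse (poly q (\<Phi> z))))"
    by (rule mero_disc_mult[OF m\<Phi> mero_disc_mult[OF mero_disc_poly[OF m\<Phi>] mero_disc_inverse_poly[OF inv q]]])
  obtain M where M: "\<And>\<zeta>. \<zeta> \<in> D \<Longrightarrow> cmod (\<Phi> \<zeta>) > M \<Longrightarrow> cmod \<zeta> \<le> 1/2"
    by (rule \<Phi>_large) (rule that)
  have \<Phi>V: "eventually (\<lambda>z. \<Phi> z \<in> V) circle_filter" if "open V" "frontier S \<subseteq> V" for V
    by (rule boundary_approach[OF open_S order_refl \<Phi>_hol \<Phi>_inj \<Phi>_image M that])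
  have hAB: "(\<lambda>z. A (\<Phi> z)) holomorphic_on ball 0 1 - {0}"
    using holomorphic_on_compose_gen[OF \<Phi>_hol A] \<Phi>_image by (simp add: o_def)
  \<comment> \<open>A(w) = o(w) at infinity, while z \<Phi>(z) = Y(z) stays bounded at the centre;
    hence z A(\<Phi>(z)) tends to 0 and the singularity of A \<circ> \<Phi> is removable.\<close>
  have "((\<lambda>z. (A (\<Phi> z) / \<Phi> z) * Y z) \<longlongrightarrow> 0 * Y 0) (at 0)"
  proof (intro tendsto_mult)
    show "((\<lambda>z. A (\<Phi> z) / \<Phi> z) \<longlongrightarrow> 0) (at 0)" by (rule filterlim_compose[OF A_inf \<Phi>_at_0]) simp
    show "(Y \<longlongrightarrow> Y 0) (at 0)"
      using holomorphic_on_imp_continuous_on[OF Y_hol] by (simp add: continuous_on_eq_continuous_at isCont_def)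
  qed
  then have l: "((\<lambda>z. (A (\<Phi> z) / \<Phi> z) * Y z) \<longlongrightarrow> 0) (at 0)" by simp
  have lA: "((\<lambda>z. (z - 0) * A (\<Phi> z)) \<longlongrightarrow> 0) (at 0)"
  proof (rule Lim_transform_eventually[OF l])
    have "eventually (\<lambda>z. \<Phi> z \<noteq> 0) (at 0)"
      using \<Phi>_at_0 eventually_not_equal_at_infinity[of 0] by (rule eventually_compose_filterlim[rotated])
    moreover have "eventually (\<lambda>z. z \<noteq> 0) (at (0::complex))" by (simp add: eventually_at_filter)
    ultimately show "eventually (\<lambda>z. (A (\<Phi> z) / \<Phi> z) * Y z = (z - 0) * A (\<Phi> z)) (at 0)"
      by eventually_elim (simp add: Y_eq)
  qed
  obtain B where B: "B holomorphic_on ball 0 1" "\<And>z. z \<in> D \<Longrightarrow> B z = A (\<Phi> z)"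
    by (rule removable_singularity_o[OF hAB open_ball lA]) (rule that)
  have sW: "sphere 0 1 \<subseteq> W" 
  proof
    fix z :: complex assume "z \<in> sphere 0 1"
    then have "z \<in> cball 0 1 - {0}" by auto
    then show "z \<in> W" using W(2) by (rule subsetD[rotated])
  qed
  have \<Phi>S: "\<Phi> z \<in> S" if "z \<in> D" for z using imageI[OF that, of \<Phi>] unfolding \<Phi>_image .
  have fac': "\<Phi> z = \<kappa> * k z * exp (g z)" if "z \<in> W" "z \<in> D" for z using fac that by simp
  obtain P Q \<delta> N \<Phi>' where Q: "Q \<noteq> 0" "\<And>z. poly Q z = 0 \<Longrightarrow> z \<in> ball 0 1" and deg: "P = 0 \<or> degree P < degree Q"
    and gPQ: "\<And>z. z \<in> ball 0 1 - {0} \<Longrightarrow> g z = cnj (poly P (1 / cnj z) / poly Q (1 / cnj z))"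
    and \<delta>: "\<delta> > 0" and N: "N holomorphic_on ball 0 (1 + \<delta>)"
    and lim: "\<And>\<xi>. cmod \<xi> = 1 \<Longrightarrow> (\<Phi> \<longlongrightarrow> \<Phi>' \<xi>) (at \<xi> within ball 0 1)"
    and NPQ: "\<And>\<xi>. cmod \<xi> = 1 \<Longrightarrow> \<Phi>' \<xi> * h (\<Phi>' \<xi>) = N \<xi> + poly P \<xi> / poly Q \<xi>"
    by (rule disc_representation[OF open_S order_refl q(2) h bd \<Phi>S \<Phi>V B mer W(1) sW k \<kappa> g fac'];
        (assumption | rule that)+)
  obtain P1 Q1 where PQ1: "\<And>z. cmod z \<le> 1 \<Longrightarrow> poly Q1 z \<noteq> 0" "poly P1 0 = 0"
    "\<And>z. z \<noteq> 0 \<Longrightarrow> poly P (1 / z) / poly Q (1 / z) = poly P1 z / poly Q1 z"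
    by (rule rational_inversion[OF Q deg], assumption, rule that)
  have oQ1: "open {z. poly Q1 z \<noteq> 0}" by (rule open_poly_nonzero) (rule continuous_on_id)
  have sQ1: "sphere 0 1 \<subseteq> {z. poly Q1 z \<noteq> 0}" using PQ1(1) by auto
  obtain \<delta>1 :: real where \<delta>1: "0 < \<delta>1" "\<delta>1 < 1" "\<And>z::complex. 1 - \<delta>1 < cmod z \<Longrightarrow> cmod z < 1 + \<delta>1 \<Longrightarrow> z \<in> {z. poly Q1 z \<noteq> 0}"
    by (rule circle_neighbourhood[OF oQ1 sQ1]) (rule that)
  define \<epsilon> where "\<epsilon> = min \<delta> \<delta>1"
  have \<epsilon>: "\<epsilon> > 0" "\<epsilon> \<le> \<delta>" "\<epsilon> \<le> \<delta>1" using \<delta> \<delta>1 by (auto simp: \<epsilon>_def)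
  have F: "faber_inv_unbdd \<phi> (\<lambda>w. w * h w) z = N 0 + poly P1 z / poly Q1 z" if z: "cmod z < 1" for z
    unfolding faber_inv_unbdd_def
  proof (rule cauchy_proj_disc[OF \<epsilon>(1) _ _ _ z])
    show "N holomorphic_on ball 0 (1 + \<epsilon>)" by (rule holomorphic_on_subset[OF N]) (use \<epsilon> in auto)
    show "(\<lambda>z. poly P1 z / poly Q1 z) holomorphic_on ball 0 (1 + \<epsilon>)"
    proof (intro holomorphic_intros)
      fix z :: complex assume "z \<in> ball 0 (1 + \<epsilon>)"
      then show "poly Q1 z \<noteq> 0" using PQ1(1)[of z] \<delta>1(3)[of z] \<delta>1 \<epsilon> by (cases "cmod z \<le> 1") auto
    qed
    fix \<xi> :: complex assume \<xi>: "cmod \<xi> = 1"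
    have \<xi>': "cmod (1 / \<xi>) = 1" "\<xi> \<noteq> 0" using \<xi> by (auto simp: norm_divide)
    have "bdry_ext Dstar \<phi> \<xi> = \<Phi>' (1 / \<xi>)"
      by (rule tendsto_bdry_Dstar[OF \<xi>]) (use lim[OF \<xi>'(1)] in \<open>simp add: \<Phi>_def[abs_def]\<close>)
    then show "((\<lambda>w. w * h w) \<circ> bdry_ext Dstar \<phi>) \<xi> = N (1 / \<xi>) + poly P1 \<xi> / poly Q1 \<xi>"
      using NPQ[OF \<xi>'(1)] PQ1(3)[OF \<xi>'(2)] by simp
  qed
  have rz: "r z = poly P1 z / poly Q1 z" if "cmod z < 1" for z
    using F[OF that] F[of 0] PQ1(2) by (simp add: r)
  have "Q1 \<noteq> 0" using PQ1(1)[of 0] by auto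
  then show "rational_on (ball 0 1) r"
    unfolding rational_on_def using rz PQ1(1) by (intro exI[of _ P1] exI[of _ Q1]) auto
  show "\<exists>G. in_A (ball 0 1) False G \<and> (\<forall>z\<in>ball 0 1. G z = r z)"
  proof (intro exI[of _ "\<lambda>z. poly P1 z / poly Q1 z"] conjI)
    have "(\<lambda>z. poly P1 z / poly Q1 z) holomorphic_on ball 0 1"
      using PQ1(1) by (intro holomorphic_intros) auto
    moreover have "continuous_on (closure (ball 0 1)) (\<lambda>z. poly P1 z / poly Q1 z)"
      using PQ1(1) by (intro continuous_intros) auto
    ultimately show "in_A (ball 0 1) False (\<lambda>z. poly P1 z / poly Q1 z)" by (simp add: in_A_def)
  qed (use rz in auto)
  fix z assume z: "z \<in> Dstar"
  then have z1: "1 / z \<in> D" "z \<noteq> 0" using inverse_Dstar by (auto simp: Dstar_def)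
  have "reflect r z = cnj (r (1 / cnj z))" using z1(2) by (simp add: reflect_def)
  also have "r (1 / cnj z) = poly P1 (1 / cnj z) / poly Q1 (1 / cnj z)"
    using z by (intro rz) (auto simp: Dstar_def norm_divide divide_less_eq)
  also have "\<dots> = poly P (cnj z) / poly Q (cnj z)" using PQ1(3)[of "1 / cnj z"] z1(2) by simp
  finally have "reflect r z = g (1 / z)" using gPQ[OF z1(1)] by simp
  then show "\<phi> z = \<kappa> * k (1 / z) * exp (reflect r z)" using fac[OF z1(1)] by (simp add: \<Phi>_def)
qed

end

section \<open>The normal forms according to the position of the origin\<close>

lemma open_blaschke_domain: "open {z. cnj l * z - 1 \<noteq> 0}" for l :: complex
proof -
  have "closed {z. cnj l * z - 1 = 0}" by (intro closed_Collect_eq continuous_intros)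
  then show ?thesis by (simp add: open_Compl Collect_neg_eq)
qed

text \<open>The three normal forms differ in the factor that is unimodular on the circle: 1 if the
  map has no zero, z if it vanishes at the centre, a Blaschke factor otherwise. After division the
  map is zero-free in the disc and has a logarithm up to a constant factor, normalised to vanish at
  0.\<close>

lemma bounded_factorization:
  assumes QD: "LQD S False h" and R: "riemann_map_bdd S \<phi>"
  defines "r \<equiv> faber_inv_bdd \<phi> (\<lambda>w. w * h w + res_inf h)"
  shows "rational_on Dstar r \<and> (\<exists>g. in_A0 Dstar g \<and> (\<forall>z\<in>Dstar. g z = r z)) \<and>
        (0 \<notin> S \<longrightarrow> (\<forall>z\<in>ball 0 1. \<phi> z = \<phi> 0 * exp (reflect r z))) \<and>
        (0 \<in> S \<and> \<phi> 0 \<noteq> 0 \<longrightarrow>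
           (let z0 = inv_into (ball 0 1) \<phi> 0 in
              z0 \<in> ball 0 1 \<and>
              (\<forall>z\<in>ball 0 1. \<phi> z = \<phi> 0 / of_real (cmod z0) * blaschke z0 z * exp (reflect r z)))) \<and>
        (\<phi> 0 = 0 \<longrightarrow> (\<forall>z\<in>ball 0 1. \<phi> z = deriv \<phi> 0 * z * exp (reflect r z)))"
proof -
  have \<phi>: "\<phi> holomorphic_on ball 0 1" "inj_on \<phi> (ball 0 1)" "\<phi> ` ball 0 1 = S"
    using R by (auto simp: riemann_map_bdd_def)
  have \<phi>0S: "\<phi> 0 \<in> S" using imageI[of 0 "ball 0 1" \<phi>] unfolding \<phi>(3) by simp
  note bc = disc_map_representation[OF QD R, folded r_def]
  consider "0 \<notin> S" | "\<phi> 0 = 0" | "0 \<in> S" "\<phi> 0 \<noteq> 0" by blast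
  then show ?thesis
  proof cases
    case 1
    have nz: "\<phi> z \<noteq> 0" if "z \<in> ball 0 1" for z
      using imageI[OF that, of \<phi>] 1 unfolding \<phi>(3) by auto
    obtain g where g: "g holomorphic_on ball 0 1" "g 0 = 0" "\<And>z. z \<in> ball 0 1 \<Longrightarrow> \<phi> z = \<phi> 0 * exp (g z)"
      by (rule normalized_log[OF \<phi>(1) nz], assumption, rule that)
    have fac: "\<phi> z = \<phi> 0 * 1 * exp (g z)" if "z \<in> ball 0 1" for z using g(3)[OF that] by simp
    have k1: "(\<lambda>_. 1) holomorphic_on (UNIV :: complex set)" by (rule holomorphic_on_const)
    have nk: "cmod 1 = 1" if "cmod z = 1" for z by simp
    have \<phi>00: "\<phi> 0 \<noteq> 0" by (rule nz) simp
    note bc' = bc[OF open_UNIV subset_UNIV k1 nk \<phi>00 g(1,2) fac]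
    have res: "rational_on Dstar r" "\<exists>g. in_A0 Dstar g \<and> (\<forall>z\<in>Dstar. g z = r z)"
      "\<And>z. z \<in> ball 0 1 \<Longrightarrow> \<phi> z = \<phi> 0 * 1 * exp (reflect r z)"
      by (rule bc'; assumption)+
    from res(1,2) res(3)[unfolded mult_1_right] show ?thesis using 1 \<phi>00 by blast
  next
    case 2
    obtain e where e: "e holomorphic_on ball 0 1" "\<And>z. z \<in> ball 0 1 \<Longrightarrow> e z \<noteq> 0" "\<And>z. \<phi> z - \<phi> 0 = (z - 0) * e z" "e 0 = deriv \<phi> 0"
    proof -
      have "(0::complex) \<in> ball 0 1" by simp
      then show ?thesis by (rule injective_zero_factor[OF \<phi>(1) open_ball \<phi>(2)]) (rule that)
    qed
    obtain g where g: "g holomorphic_on ball 0 1" "g 0 = 0" "\<And>z. z \<in> ball 0 1 \<Longrightarrow> e z = e 0 * exp (g z)"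
      by (rule normalized_log[OF e(1,2)], assumption, rule that)
    have fac: "\<phi> z = deriv \<phi> 0 * z * exp (g z)" if "z \<in> ball 0 1" for z
      using e(3)[of z] e(4) g(3)[OF that] 2 by simp
    have d0: "deriv \<phi> 0 \<noteq> 0" using e(2)[of 0] e(4) by simp
    have k1: "(\<lambda>z. z) holomorphic_on (UNIV :: complex set)" by (rule holomorphic_on_ident)
    have nk: "cmod z = 1" if "cmod z = 1" for z using that .
    note bc' = bc[OF open_UNIV subset_UNIV k1 nk d0 g(1,2) fac]
    have res: "rational_on Dstar r" "\<exists>g. in_A0 Dstar g \<and> (\<forall>z\<in>Dstar. g z = r z)"
      "\<And>z. z \<in> ball 0 1 \<Longrightarrow> \<phi> z = deriv \<phi> 0 * z * exp (reflect r z)"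
      by (rule bc'; assumption)+
    have "0 \<in> S" using \<phi>0S unfolding 2 .
    with res 2 show ?thesis unfolding Let_def by blast
  next
    case 3
    define z0 where "z0 = inv_into (ball 0 1) \<phi> 0"
    have z0: "z0 \<in> ball 0 1" "\<phi> z0 = 0"
    proof -
      have "0 \<in> \<phi> ` ball 0 1" unfolding \<phi>(3) by (rule 3(1))
      then show "z0 \<in> ball 0 1" "\<phi> z0 = 0" unfolding z0_def by (rule inv_into_into, rule f_inv_into_f)
    qed
    have z00: "z0 \<noteq> 0" using z0 3 by auto
    obtain e where e: "e holomorphic_on ball 0 1" "\<And>z. z \<in> ball 0 1 \<Longrightarrow> e z \<noteq> 0" "\<And>z. \<phi> z - \<phi> z0 = (z - z0) * e z"
      by (rule injective_zero_factor[OF \<phi>(1) open_ball \<phi>(2) z0(1)]) (rule that)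
    have bnz: "cnj z0 * z - 1 \<noteq> 0" if "cmod z \<le> 1" for z
    proof
      assume "cnj z0 * z - 1 = 0"
      then have "cmod (cnj z0 * z) = 1" by simp
      moreover have "cmod z0 * cmod z \<le> cmod z0 * 1" using that by (intro mult_left_mono) auto
      ultimately show False using z0 by (simp add: norm_mult)
    qed
    \<comment> \<open>The quotient of \<phi> by the Blaschke factor, written with \<open>e\<close>
      so that it is visibly holomorphic and zero-free at \<open>z0\<close> too.\<close>
    define n where "n = (\<lambda>z. e z * (cnj z0 * z - 1) * of_real (cmod z0) / cnj z0)"
    have n: "n holomorphic_on ball 0 1" "\<And>z. z \<in> ball 0 1 \<Longrightarrow> n z \<noteq> 0"
      unfolding n_def using e(1,2) bnz z00 by (auto intro!: holomorphic_intros)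
    have \<phi>n: "\<phi> z = blaschke z0 z * n z" if z: "z \<in> ball 0 1" for z
    proof -
      have "cnj z0 * z - 1 \<noteq> 0" using z by (intro bnz) simp
      then have "blaschke z0 z * n z = (z - z0) * e z"
        using z00 by (simp add: blaschke_def n_def)
      then show ?thesis using e(3)[of z] z0 by simp
    qed
    \<comment> \<open>This value is the source of the divisor |z0| in the constant before the
      Blaschke factor.\<close>
    have "blaschke z0 0 = of_real (cmod z0)"
      using z00 by (simp add: blaschke_def complex_norm_square[symmetric] power2_eq_square mult.commute field_simps)
    then have n0: "n 0 = \<phi> 0 / of_real (cmod z0)" using \<phi>n[of 0] z00 by simp
    obtain g where g: "g holomorphic_on ball 0 1" "g 0 = 0" "\<And>z. z \<in> ball 0 1 \<Longrightarrow> n z = n 0 * exp (g z)"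
      by (rule normalized_log[OF n], assumption, rule that)
    have fac: "\<phi> z = n 0 * blaschke z0 z * exp (g z)" if "z \<in> ball 0 1" for z
      using \<phi>n[OF that] g(3)[OF that] by (simp add: mult_ac)
    have hb: "blaschke z0 holomorphic_on {z. cnj z0 * z - 1 \<noteq> 0}"
      unfolding blaschke_def by (intro holomorphic_intros) auto
    have cb: "cball 0 1 \<subseteq> {z. cnj z0 * z - 1 \<noteq> 0}" using bnz by auto
    have nb: "cmod (blaschke z0 z) = 1" if "cmod z = 1" for z
      by (rule norm_blaschke) (use z0 z00 that in auto)
    note bc' = bc[OF open_blaschke_domain cb hb nb n(2)[of 0, simplified] g(1,2) fac]
    have res: "rational_on Dstar r" "\<exists>g. in_A0 Dstar g \<and> (\<forall>z\<in>Dstar. g z = r z)"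
      "\<And>z. z \<in> ball 0 1 \<Longrightarrow> \<phi> z = n 0 * blaschke z0 z * exp (reflect r z)"
      by (rule bc'; assumption)+
    from res show ?thesis using 3 z0(1) unfolding n0 z0_def[symmetric] Let_def by blast
  qed
qed

text \<open>The logarithm is taken of a zero-free function built from Y = \<zeta> \<Phi>, whose
  value at the centre is c. If 0 is not in \<open>S\<close>, \<open>Y\<close> itself has no zero;
  otherwise its only zero is \<beta> = 1/z0, which the Blaschke factor evaluated at 1/\<zeta> takes
  up. The factor 1/\<zeta> in \<open>k\<close> restores the pole of \<Phi>.\<close>

lemma exterior_factorization:
  assumes QD: "LQD S True h" and R: "riemann_map_unbdd S \<phi>"
    and lim: "((\<lambda>z. \<phi> z / z) \<longlongrightarrow> of_real c) at_infinity" and c: "0 < c"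
  defines "r \<equiv> (\<lambda>z. faber_inv_unbdd \<phi> (\<lambda>w. w * h w) z - faber_inv_unbdd \<phi> (\<lambda>w. w * h w) 0)"
  shows "rational_on (ball 0 1) r \<and> (\<exists>g. in_A (ball 0 1) False g \<and> (\<forall>z\<in>ball 0 1. g z = r z)) \<and>
          r 0 = 0 \<and>
          (0 \<notin> S \<longrightarrow> (\<forall>z\<in>Dstar. \<phi> z = of_real c * z * exp (reflect r z))) \<and>
          (0 \<in> S \<longrightarrow>
             (let z0 = inv_into Dstar \<phi> 0 in
                1 < cmod z0 \<and>
                (\<forall>z\<in>Dstar. \<phi> z = of_real (c * cmod z0) * z * blaschke z0 z * exp (reflect r z))))"
proof -
  interpret exterior_map S h \<phi> c
    using QD R lim c by unfold_locales
  have r: "r = (\<lambda>z. faber_inv_unbdd \<phi> (\<lambda>w. w * h w) z - faber_inv_unbdd \<phi> (\<lambda>w. w * h w) 0)"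
    by (simp add: r_def)
  have r0: "r 0 = 0" by (simp add: r)
  have c0: "(of_real c :: complex) \<noteq> 0" using c by simp
  show ?thesis
  proof (cases "0 \<in> S")
    case False
    have nz: "Y z \<noteq> 0" if z: "z \<in> ball 0 1" for z
    proof (cases "z = 0")
      case True
      then show ?thesis using Y_0 c by simp
    next
      case z0: False
      then have "\<Phi> z \<in> S" using imageI[of z D \<Phi>] z unfolding \<Phi>_image by auto
      then have "\<Phi> z \<noteq> 0" using False by auto
      then show ?thesis using z0 by (simp add: Y_eq)
    qed
    obtain g where g: "g holomorphic_on ball 0 1" "g 0 = 0" "\<And>z. z \<in> ball 0 1 \<Longrightarrow> Y z = Y 0 * exp (g z)"
      by (rule normalized_log[OF Y_hol nz], assumption, rule that)
    have fac: "\<Phi> z = of_real c * (1 / z) * exp (g z)" if z: "z \<in> D" for z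
    proof -
      have "z * \<Phi> z = of_real c * exp (g z)" using g(3)[of z] z Y_eq[of z] Y_0 by simp
      then show ?thesis using z by (simp add: field_simps)
    qed
    have oW: "open (- {0::complex})" by (rule open_Compl[OF closed_singleton])
    have sub: "cball 0 1 - {0::complex} \<subseteq> - {0}" by auto
    have hk: "(\<lambda>z::complex. 1 / z) holomorphic_on - {0}" by (intro holomorphic_intros) auto
    have nk: "cmod (1 / z) = 1" if "cmod z = 1" for z using that by (simp add: norm_divide)
    note ec = exterior_map_representation[OF oW sub hk nk c0 g(1,2) fac r]
    have "rational_on (ball 0 1) r" "\<exists>G. in_A (ball 0 1) False G \<and> (\<forall>z\<in>ball 0 1. G z = r z)"
      "\<And>z. z \<in> Dstar \<Longrightarrow> \<phi> z = of_real c * (1 / (1 / z)) * exp (reflect r z)"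
      by (rule ec; assumption)+
    then show ?thesis using False r0 by simp
  next
    case True
    define z0 where "z0 = inv_into Dstar \<phi> 0"
    have z0: "z0 \<in> Dstar" "\<phi> z0 = 0"
    proof -
      have "0 \<in> \<phi> ` Dstar" unfolding riemann_map(3) by (rule True)
      then show "z0 \<in> Dstar" "\<phi> z0 = 0" unfolding z0_def by (rule inv_into_into, rule f_inv_into_f)
    qed
    define \<beta> where "\<beta> = 1 / z0"
    have z01: "1 < cmod z0" "z0 \<noteq> 0" using z0(1) by (auto simp: Dstar_def)
    have \<beta>: "\<beta> \<in> D" "\<Phi> \<beta> = 0" using inverse_Dstar[OF z0(1)] z0(2) by (auto simp: \<beta>_def \<Phi>_def)
    obtain e where e: "e holomorphic_on ball 0 1" "\<And>\<zeta>. \<zeta> \<in> ball 0 1 \<Longrightarrow> e \<zeta> \<noteq> 0"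
      "\<And>\<zeta>. Y \<zeta> - \<Phi> \<beta> * \<zeta> = (\<zeta> - \<beta>) * e \<zeta>"
      by (rule shifted_zero_factor[OF \<beta>(1)]) (rule that)
    have bnz: "cnj z0 - \<zeta> \<noteq> 0" if "cmod \<zeta> \<le> 1" for \<zeta> using that z01 by auto
    \<comment> \<open>\<open>Y\<close> divided by the Blaschke factor at 1/\<zeta>; the sign and the
      factor \<open>z0\<close> come from 1/\<zeta> - z0 = - z0 (\<zeta> - \<beta>)/\<zeta>.\<close>
    define n where "n = (\<lambda>\<zeta>. e \<zeta> * (cnj z0 - \<zeta>) * of_real (cmod z0) / (- cnj z0 * z0))"
    have n: "n holomorphic_on ball 0 1" "\<And>\<zeta>. \<zeta> \<in> ball 0 1 \<Longrightarrow> n \<zeta> \<noteq> 0"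
      unfolding n_def using e(1,2) bnz z01 by (auto intro!: holomorphic_intros)
    obtain g where g: "g holomorphic_on ball 0 1" "g 0 = 0" "\<And>z. z \<in> ball 0 1 \<Longrightarrow> n z = n 0 * exp (g z)"
      by (rule normalized_log[OF n], assumption, rule that)
    have bl: "blaschke z0 (1 / \<zeta>) = cnj z0 / of_real (cmod z0) * (- z0 * (\<zeta> - \<beta>) / (cnj z0 - \<zeta>))" if "\<zeta> \<noteq> 0" for \<zeta>
    proof -
      have "1 / \<zeta> - z0 = - z0 * (\<zeta> - \<beta>) / \<zeta>" "cnj z0 * (1 / \<zeta>) - 1 = (cnj z0 - \<zeta>) / \<zeta>"
        using that z01 by (auto simp: \<beta>_def field_simps)
      then show ?thesis using that by (simp add: blaschke_def)
    qed
    have Yn: "Y \<zeta> = blaschke z0 (1 / \<zeta>) * n \<zeta>" if z: "\<zeta> \<in> D" for \<zeta>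
    proof -
      have "cnj z0 - \<zeta> \<noteq> 0" "\<zeta> \<noteq> 0" using z by (auto intro!: bnz simp del: right_minus_eq)
      then have "blaschke z0 (1 / \<zeta>) * n \<zeta> = (\<zeta> - \<beta>) * e \<zeta>"
        using z01 by (simp add: bl n_def)
      then show ?thesis using e(3)[of \<zeta>] \<beta>(2) by simp
    qed
    \<comment> \<open>At the centre the Blaschke factor in 1/\<zeta> has the limit 1/|z0|, which
      accounts for the constant c |z0|.\<close>
    have n0: "n 0 = of_real (c * cmod z0)"
    proof -
      have "of_real c = - \<beta> * e 0" using e(3)[of 0] \<beta>(2) Y_0 by simp
      then have "e 0 = - of_real c * z0" using z01 by (simp add: \<beta>_def field_simps)
      then show ?thesis using z01 by (simp add: n_def)
    qed
    define k where "k = (\<lambda>\<zeta>. (1 / \<zeta>) * blaschke z0 (1 / \<zeta>))"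
    have fac: "\<Phi> z = of_real (c * cmod z0) * k z * exp (g z)" if z: "z \<in> D" for z
    proof -
      have "z * \<Phi> z = blaschke z0 (1 / z) * (n 0 * exp (g z))" using Yn[OF z] g(3)[of z] z Y_eq[of z] by simp
      then show ?thesis using z by (simp add: k_def n0 field_simps)
    qed
    \<comment> \<open>The excluded points are the singularities of \<open>k\<close>: the centre,
      which \<open>W\<close> may omit, and \<open>cnj z0\<close>, which lies outside the closed
      disc.\<close>
    define W where "W = - {0, cnj z0}"
    have oW: "open W" unfolding W_def by (intro open_Compl finite_imp_closed) auto
    have sub: "cball 0 1 - {0} \<subseteq> W" using z01 by (auto simp: W_def)
    have hk: "k holomorphic_on W"
    proof (rule holomorphic_transform)
      show "(\<lambda>\<zeta>. (1 / \<zeta>) * (cnj z0 / of_real (cmod z0) * (- z0 * (\<zeta> - \<beta>) / (cnj z0 - \<zeta>)))) holomorphic_on W"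
        using z01 by (intro holomorphic_intros) (auto simp: W_def)
    qed (auto simp: k_def bl W_def)
    have nk: "cmod (k z) = 1" if "cmod z = 1" for z
    proof -
      have "cmod (blaschke z0 (1 / z)) = 1" by (rule norm_blaschke) (use z01 that in \<open>auto simp: norm_divide\<close>)
      then show ?thesis using that by (simp add: k_def norm_mult norm_divide)
    qed
    have \<kappa>: "(of_real (c * cmod z0) :: complex) \<noteq> 0" using c z01 by simp
    note ec = exterior_map_representation[OF oW sub hk nk \<kappa> g(1,2) fac r]
    have "rational_on (ball 0 1) r" "\<exists>G. in_A (ball 0 1) False G \<and> (\<forall>z\<in>ball 0 1. G z = r z)"
      and rep: "\<And>z. z \<in> Dstar \<Longrightarrow> \<phi> z = of_real (c * cmod z0) * k (1 / z) * exp (reflect r z)"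
      by (rule ec; assumption)+
    moreover have "\<phi> z = of_real (c * cmod z0) * z * blaschke z0 z * exp (reflect r z)" if "z \<in> Dstar" for z
      using rep[OF that] by (simp add: k_def mult.assoc)
    ultimately show ?thesis using True z01 r0 unfolding z0_def[symmetric] Let_def by blast
  qed
qed

theorem mainTheorem17:
  fixes S :: "complex set" and inO :: bool and h \<phi> :: "complex \<Rightarrow> complex"
  assumes QD: "LQD S inO h"
    and SC: "sphere_simply_connected S inO"
  shows
   "(\<not> inO \<longrightarrow> riemann_map_bdd S \<phi> \<longrightarrow>
      (let r = faber_inv_bdd \<phi> (\<lambda>w. w * h w + res_inf h) in
        rational_on Dstar r \<and>
        (\<exists>g. in_A0 Dstar g \<and> (\<forall>z\<in>Dstar. g z = r z)) \<and>
        (0 \<notin> S \<longrightarrow> (\<forall>z\<in>ball 0 1. \<phi> z = \<phi> 0 * exp (reflect r z))) \<and>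
        (0 \<in> S \<and> \<phi> 0 \<noteq> 0 \<longrightarrow>
           (let z0 = inv_into (ball 0 1) \<phi> 0 in
              z0 \<in> ball 0 1 \<and>
              (\<forall>z\<in>ball 0 1. \<phi> z = \<phi> 0 / of_real (cmod z0) * blaschke z0 z * exp (reflect r z)))) \<and>
        (\<phi> 0 = 0 \<longrightarrow> (\<forall>z\<in>ball 0 1. \<phi> z = deriv \<phi> 0 * z * exp (reflect r z)))))
    \<and>
    (inO \<longrightarrow> riemann_map_unbdd S \<phi> \<longrightarrow>
      (\<forall>c::real. ((\<lambda>z. \<phi> z / z) \<longlongrightarrow> of_real c) at_infinity \<longrightarrow> 0 < c \<longrightarrow>
        (let F = faber_inv_unbdd \<phi> (\<lambda>w. w * h w); r = (\<lambda>z. F z - F 0) in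
          rational_on (ball 0 1) r \<and>
          (\<exists>g. in_A (ball 0 1) False g \<and> (\<forall>z\<in>ball 0 1. g z = r z)) \<and>
          r 0 = 0 \<and>
          (0 \<notin> S \<longrightarrow> (\<forall>z\<in>Dstar. \<phi> z = of_real c * z * exp (reflect r z))) \<and>
          (0 \<in> S \<longrightarrow>
             (let z0 = inv_into Dstar \<phi> 0 in
                1 < cmod z0 \<and>
                (\<forall>z\<in>Dstar. \<phi> z = of_real (c * cmod z0) * z * blaschke z0 z * exp (reflect r z)))))))"
proof (intro conjI impI allI, goal_cases)
  case 1
  then have "LQD S False h" using QD by simp
  from bounded_factorization[OF this 1(2)] show ?case unfolding Let_def .
next
  case (2 c)
  then have "LQD S True h" using QD by simp
  from exterior_factorization[OF this 2(2-4)] show ?case unfolding Let_def .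
qed

end
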